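(* Let $\{A_\gamma:\gamma\in\Gamma\}$ be a direct system of Noetherian Cohen-Macaulay rings whose transition maps satisfy lying over (e.g. are pure or integral extensions). Then $A=\varinjlim_{\gamma\in\Gamma}A_\gamma$ is Cohen-Macaulay in the sense of Hamilton-Marley.
   Context: All rings are commutative, not necessarily Noetherian. All direct systems are assumed to be filtered (indexed by a directed set). A ring homomorphism $R\to S$ satisfies lying over if every prime ideal of $R$ is the contraction of a prime ideal of $S$. A ring homomorphism $R\to S$ is pure if $M\to M\otimes_R S$ is injective for every $R$-module $M$. For a finite sequence $\underline{x}=x_1,\dots,x_\ell$ in a ring $R$, let $\mathbb{K}_\bullet(\underline{x})$ be the Koszul complex of $R$ with respect to $\underline{x}$, let $\underline{x}^m=x_1^m,\dots,x_\ell^m$, and let $H^i_{\underline{x}}(-)$ be the $i$-th Čech cohomology with respect to $\underline{x}$. For $m\ge n$ there is a chain map $\varphi^m_n(\underline{x}):\mathbb{K}_\bullet(\underline{x}^m)\to\mathbb{K}_\bullet(\underline{x}^n)$ induced by multiplication by $(\prod x_i)^{m-n}$ (that is, the tensor product of the maps of complexes $\mathbb{K}_\bullet(x_i^m)\to\mathbb{K}_\bullet(x_i^n)$ which are multiplication by $x_i^{m-n}$ in degree 1 and the identity in degree 0). The sequence $\underline{x}$ is weakly proregular if for each $n>0$ there is $m\ge n$ such that $H_i(\varphi^m_n(\underline{x}))=0$ for all $i\ge1$. It is a parameter sequence on $R$ if (1) $\underline{x}$ is weakly proregular, (2) $(\underline{x})R\ne R$, and (3) $H^\ell_{\underline{x}}(R)_{\mathfrak{p}}\ne0$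 for every prime $\mathfrak{p}\supseteq\underline{x}R$. It is a strong parameter sequence on $R$ if $x_1,\dots,x_i$ is a parameter sequence on $R$ for all $1\le i\le\ell$. $R$ is Cohen-Macaulay in the sense of Hamilton-Marley if every strong parameter sequence on $R$ is a regular sequence on $R$. *)

theory Defs
  imports "HOL-Algebra.QuotRing" "HOL-Algebra.Ring_Divisibility" "HOL-Library.Extended_Nat"
begin

section \<open>Modules: finite products, quotients, fractions\<close>

text \<open>The fields \<^const>\<open>monoid.mult\<close> and \<^const>\<open>one\<close> of a module record are only
  meaningful for \<open>self_module\<close>.\<close>

definition self_module :: "('a, 'm) ring_scheme \<Rightarrow> ('a, 'a) module" where
  "self_module R = \<lparr>carrier = carrier R, monoid.mult = monoid.mult R, one = one R,
     ring.zero = ring.zero R, add = add R, smult = monoid.mult R\<rparr>"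

definition prod_module :: "'i set \<Rightarrow> ('i \<Rightarrow> ('a, 'b, 'n) module_scheme) \<Rightarrow> ('a, 'i \<Rightarrow> 'b) module" where
  "prod_module I M = \<lparr>carrier = (\<Pi>\<^sub>E i\<in>I. carrier (M i)), monoid.mult = undefined, one = undefined,
     ring.zero = (\<lambda>i\<in>I. \<zero>\<^bsub>M i\<^esub>),
     add = (\<lambda>f g. \<lambda>i\<in>I. f i \<oplus>\<^bsub>M i\<^esub> g i),
     smult = (\<lambda>r f. \<lambda>i\<in>I. r \<odot>\<^bsub>M i\<^esub> f i)\<rparr>"

definition quot_module :: "('a, 'b, 'n) module_scheme \<Rightarrow> 'b set \<Rightarrow> ('a, 'b set) module" where
  "quot_module M N = \<lparr>carrier = a_rcosets\<^bsub>M\<^esub> N, monoid.mult = undefined, one = undefined,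
     ring.zero = N, add = set_add M,
     smult = (\<lambda>r C. \<Union>z\<in>C. N +>\<^bsub>M\<^esub> (r \<odot>\<^bsub>M\<^esub> z))\<rparr>"

text \<open>The homology \<open>ker d / B\<close>, where \<open>d : M \<rightarrow> N\<close> and \<open>B\<close> is the submodule of boundaries.\<close>

definition homology_module ::
  "('a, 'b) module \<Rightarrow> 'b set \<Rightarrow> ('b \<Rightarrow> 'c) \<Rightarrow> ('a, 'c) module \<Rightarrow> ('a, 'b set) module" where
  "homology_module M B d N =
     quot_module (M\<lparr>carrier := {z \<in> carrier M. d z = \<zero>\<^bsub>N\<^esub>}\<rparr>) B"

text \<open>The fraction \<open>m/s\<close> in \<open>S\<^sup>-\<^sup>1M\<close>, as a set of pairs. It is deliberately defined for all \<open>s\<close>,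
  not only for \<open>s \<in> S\<close>: if \<open>s\<close> merely divides an element of \<open>S\<close>, and so becomes invertible in
  \<open>S\<^sup>-\<^sup>1R\<close>, this is still the class representing \<open>m/s\<close>.\<close>

definition frac ::
  "('a, 'm) ring_scheme \<Rightarrow> 'a set \<Rightarrow> ('a, 'b, 'n) module_scheme \<Rightarrow> 'b \<Rightarrow> 'a \<Rightarrow> ('b \<times> 'a) set" where
  "frac R S M m s = {(n, t). n \<in> carrier M \<and> t \<in> S \<and>
     (\<exists>u\<in>S. (u \<otimes>\<^bsub>R\<^esub> s) \<odot>\<^bsub>M\<^esub> n = (u \<otimes>\<^bsub>R\<^esub> t) \<odot>\<^bsub>M\<^esub> m)}"

definition loc_module ::
  "('a, 'm) ring_scheme \<Rightarrow> 'a set \<Rightarrow> ('a, 'b, 'n) module_scheme \<Rightarrow> ('a, ('b \<times> 'a) set) module" where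
  "loc_module R S M =
    \<lparr>carrier = {frac R S M m s |m s. m \<in> carrier M \<and> s \<in> S},
     monoid.mult = undefined, one = undefined,
     ring.zero = frac R S M \<zero>\<^bsub>M\<^esub> \<one>\<^bsub>R\<^esub>,
     add = (\<lambda>X Y. \<Union>(m, s)\<in>X. \<Union>(n, t)\<in>Y.
              frac R S M (t \<odot>\<^bsub>M\<^esub> m \<oplus>\<^bsub>M\<^esub> s \<odot>\<^bsub>M\<^esub> n) (s \<otimes>\<^bsub>R\<^esub> t)),
     smult = (\<lambda>r X. \<Union>(m, s)\<in>X. frac R S M (r \<odot>\<^bsub>M\<^esub> m) s)\<rparr>"

definition loc_ring :: "('a, 'm) ring_scheme \<Rightarrow> 'a set \<Rightarrow> ('a \<times> 'a) set ring" where
  "loc_ring R S =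
    \<lparr>carrier = {frac R S (self_module R) a s |a s. a \<in> carrier R \<and> s \<in> S},
     monoid.mult = (\<lambda>X Y. \<Union>(a, s)\<in>X. \<Union>(b, t)\<in>Y. frac R S (self_module R) (a \<otimes>\<^bsub>R\<^esub> b) (s \<otimes>\<^bsub>R\<^esub> t)),
     one = frac R S (self_module R) \<one>\<^bsub>R\<^esub> \<one>\<^bsub>R\<^esub>,
     ring.zero = frac R S (self_module R) \<zero>\<^bsub>R\<^esub> \<one>\<^bsub>R\<^esub>,
     add = (\<lambda>X Y. \<Union>(a, s)\<in>X. \<Union>(b, t)\<in>Y.
              frac R S (self_module R) (t \<otimes>\<^bsub>R\<^esub> a \<oplus>\<^bsub>R\<^esub> s \<otimes>\<^bsub>R\<^esub> b) (s \<otimes>\<^bsub>R\<^esub> t))\<rparr>"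

text \<open>The canonical map \<open>S\<^sup>-\<^sup>1M \<rightarrow> S'\<^sup>-\<^sup>1M\<close>, for use when every element of \<open>S\<close> divides one of \<open>S'\<close>.\<close>

definition loc_map ::
  "('a, 'm) ring_scheme \<Rightarrow> ('a, 'b, 'n) module_scheme \<Rightarrow> 'a set \<Rightarrow> ('b \<times> 'a) set \<Rightarrow> ('b \<times> 'a) set" where
  "loc_map R M S' X = (\<Union>(m, s)\<in>X. frac R S' M m s)"

definition powers :: "('a, 'm) ring_scheme \<Rightarrow> 'a \<Rightarrow> 'a set" where
  "powers R f = range (\<lambda>n::nat. f [^]\<^bsub>R\<^esub> n)"


section \<open>Regular sequences and Noetherian Cohen-Macaulay rings\<close>

definition nonzerodivisor :: "('a, 'm) ring_scheme \<Rightarrow> 'a \<Rightarrow> bool" where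
  "nonzerodivisor R x \<longleftrightarrow> x \<in> carrier R \<and> (\<forall>y\<in>carrier R. x \<otimes>\<^bsub>R\<^esub> y = \<zero>\<^bsub>R\<^esub> \<longrightarrow> y = \<zero>\<^bsub>R\<^esub>)"

definition regular_sequence :: "('a, 'm) ring_scheme \<Rightarrow> 'a list \<Rightarrow> bool" where
  "regular_sequence R xs \<longleftrightarrow> set xs \<subseteq> carrier R \<and>
     (\<forall>i<length xs. let I = Idl\<^bsub>R\<^esub> (set (take i xs)) in nonzerodivisor (R Quot I) (I +>\<^bsub>R\<^esub> (xs ! i))) \<and>
     Idl\<^bsub>R\<^esub> (set xs) \<noteq> carrier R"

definition krull_dim :: "('a, 'm) ring_scheme \<Rightarrow> enat" where
  "krull_dim R = Sup {enat n |n. \<exists>P :: nat \<Rightarrow> 'a set.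
     (\<forall>i\<le>n. primeideal (P i) R) \<and> (\<forall>i<n. P i \<subset> P (Suc i))}"

definition depth :: "'a set \<Rightarrow> ('a, 'm) ring_scheme \<Rightarrow> enat" where
  "depth I R = Sup {enat (length xs) |xs. set xs \<subseteq> I \<and> regular_sequence R xs}"

definition local_cohen_macaulay :: "('a, 'm) ring_scheme \<Rightarrow> bool" where
  "local_cohen_macaulay R \<longleftrightarrow> cring R \<and> noetherian_ring R \<and>
     (\<exists>M. (\<forall>N. maximalideal N R \<longleftrightarrow> N = M) \<and> depth M R = krull_dim R)"

definition noetherian_cohen_macaulay :: "('a, 'm) ring_scheme \<Rightarrow> bool" where
  "noetherian_cohen_macaulay R \<longleftrightarrow> cring R \<and> noetherian_ring R \<and>
     (\<forall>M. maximalideal M R \<longrightarrow> local_cohen_macaulay (loc_ring R (carrier R - M)))"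


section \<open>Koszul complex and weak proregularity\<close>

definition subsets_of_card :: "nat \<Rightarrow> nat \<Rightarrow> nat set set" where
  "subsets_of_card l i = {T. T \<subseteq> {..<l} \<and> card T = i}"

text \<open>\<open>K\<^sub>i\<close> is free on the \<open>i\<close>-subsets \<open>T = {t\<^sub>0 < t\<^sub>1 < \<dots>}\<close> of \<open>{..<l}\<close>, the basis vector of
  \<open>T\<close> standing for \<open>e\<close>\<open>\<^bsub>t\<^sub>0\<^esub> \<and> e\<close>\<open>\<^bsub>t\<^sub>1\<^esub> \<and> \<dots>\<close>; elements are coefficient functions.
  \<open>koszul_diff R xs i\<close> is the differential \<open>K\<^bsub>i+1\<^esub> \<rightarrow> K\<^sub>i\<close>.\<close>

definition koszul :: "('a, 'm) ring_scheme \<Rightarrow> 'a list \<Rightarrow> nat \<Rightarrow> ('a, nat set \<Rightarrow> 'a) module" where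
  "koszul R xs i = prod_module (subsets_of_card (length xs) i) (\<lambda>_. self_module R)"

definition koszul_diff ::
  "('a, 'm) ring_scheme \<Rightarrow> 'a list \<Rightarrow> nat \<Rightarrow> (nat set \<Rightarrow> 'a) \<Rightarrow> nat set \<Rightarrow> 'a" where
  "koszul_diff R xs i f = (\<lambda>T\<in>subsets_of_card (length xs) i.
     \<Oplus>\<^bsub>R\<^esub>j\<in>{..<length xs} - T.
       (\<ominus>\<^bsub>R\<^esub> \<one>\<^bsub>R\<^esub>) [^]\<^bsub>R\<^esub> card {k\<in>T. k < j} \<otimes>\<^bsub>R\<^esub> (xs ! j) \<otimes>\<^bsub>R\<^esub> f (insert j T))"

definition koszul_boundaries :: "('a, 'm) ring_scheme \<Rightarrow> 'a list \<Rightarrow> nat \<Rightarrow> (nat set \<Rightarrow> 'a) set" where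
  "koszul_boundaries R xs i = koszul_diff R xs i ` carrier (koszul R xs (Suc i))"

text \<open>Meant for \<open>i \<ge> 1\<close> only: for \<open>i = 0\<close> the outgoing differential is a junk value.\<close>

definition koszul_homology ::
  "('a, 'm) ring_scheme \<Rightarrow> 'a list \<Rightarrow> nat \<Rightarrow> ('a, (nat set \<Rightarrow> 'a) set) module" where
  "koszul_homology R xs i = homology_module (koszul R xs i) (koszul_boundaries R xs i)
     (koszul_diff R xs (i - 1)) (koszul R xs (i - 1))"

definition seq_pow :: "('a, 'm) ring_scheme \<Rightarrow> 'a list \<Rightarrow> nat \<Rightarrow> 'a list" where
  "seq_pow R xs m = map (\<lambda>x. x [^]\<^bsub>R\<^esub> m) xs"

text \<open>The tensor product over \<open>j\<close> of the maps \<open>K(x\<^sub>j\<^sup>m) \<rightarrow> K(x\<^sub>j\<^sup>n)\<close> multiplies the coordinate at \<open>T\<close>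
  by one factor \<open>x\<^sub>j\<^bsup>m-n\<^esup>\<close> for each \<open>j \<in> T\<close>.\<close>

definition koszul_trans ::
  "('a, 'm) ring_scheme \<Rightarrow> 'a list \<Rightarrow> nat \<Rightarrow> nat \<Rightarrow> nat \<Rightarrow> (nat set \<Rightarrow> 'a) \<Rightarrow> nat set \<Rightarrow> 'a" where
  "koszul_trans R xs m n i f = (\<lambda>T\<in>subsets_of_card (length xs) i.
     (\<Otimes>\<^bsub>R\<^esub>j\<in>T. (xs ! j) [^]\<^bsub>R\<^esub> (m - n)) \<otimes>\<^bsub>R\<^esub> f T)"

definition koszul_homology_trans ::
  "('a, 'm) ring_scheme \<Rightarrow> 'a list \<Rightarrow> nat \<Rightarrow> nat \<Rightarrow> nat \<Rightarrow> (nat set \<Rightarrow> 'a) set \<Rightarrow> (nat set \<Rightarrow> 'a) set" where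
  "koszul_homology_trans R xs m n i C =
     (\<Union>z\<in>C. koszul_boundaries R (seq_pow R xs n) i +>\<^bsub>koszul R (seq_pow R xs n) i\<^esub>
              koszul_trans R xs m n i z)"

definition weakly_proregular :: "('a, 'm) ring_scheme \<Rightarrow> 'a list \<Rightarrow> bool" where
  "weakly_proregular R xs \<longleftrightarrow> (\<forall>n>0. \<exists>m\<ge>n. \<forall>i\<ge>1.
     \<forall>C\<in>carrier (koszul_homology R (seq_pow R xs m) i).
       koszul_homology_trans R xs m n i C = \<zero>\<^bsub>koszul_homology R (seq_pow R xs n) i\<^esub>)"


section \<open>Cech cohomology\<close>

text \<open>\<open>C\<^sup>i\<close> is the direct sum, over the \<open>i\<close>-subsets \<open>T\<close> of \<open>{..<l}\<close>, of the localizations of \<open>M\<close> at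
  the powers of the product of the \<open>x\<^sub>j\<close>, \<open>j \<in> T\<close>.\<close>

definition cech_powers :: "('a, 'm) ring_scheme \<Rightarrow> 'a list \<Rightarrow> nat set \<Rightarrow> 'a set" where
  "cech_powers R xs T = powers R (\<Otimes>\<^bsub>R\<^esub>j\<in>T. xs ! j)"

definition cech ::
  "('a, 'm) ring_scheme \<Rightarrow> ('a, 'b) module \<Rightarrow> 'a list \<Rightarrow> nat \<Rightarrow> ('a, nat set \<Rightarrow> ('b \<times> 'a) set) module" where
  "cech R M xs i = prod_module (subsets_of_card (length xs) i)
     (\<lambda>T. loc_module R (cech_powers R xs T) M)"

definition cech_diff ::
  "('a, 'm) ring_scheme \<Rightarrow> ('a, 'b) module \<Rightarrow> 'a list \<Rightarrow> nat \<Rightarrow>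
     (nat set \<Rightarrow> ('b \<times> 'a) set) \<Rightarrow> nat set \<Rightarrow> ('b \<times> 'a) set" where
  "cech_diff R M xs i f = (\<lambda>T\<in>subsets_of_card (length xs) (Suc i).
     let L = loc_module R (cech_powers R xs T) M in
     \<Oplus>\<^bsub>L\<^esub>j\<in>T. ((\<ominus>\<^bsub>R\<^esub> \<one>\<^bsub>R\<^esub>) [^]\<^bsub>R\<^esub> card {k\<in>T. k < j}) \<odot>\<^bsub>L\<^esub>
                loc_map R M (cech_powers R xs T) (f (T - {j})))"

definition cech_coboundaries ::
  "('a, 'm) ring_scheme \<Rightarrow> ('a, 'b) module \<Rightarrow> 'a list \<Rightarrow> nat \<Rightarrow> (nat set \<Rightarrow> ('b \<times> 'a) set) set" where
  "cech_coboundaries R M xs i =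
     (case i of 0 \<Rightarrow> {\<zero>\<^bsub>cech R M xs 0\<^esub>} | Suc k \<Rightarrow> cech_diff R M xs k ` carrier (cech R M xs k))"

definition cech_cohomology ::
  "('a, 'm) ring_scheme \<Rightarrow> ('a, 'b) module \<Rightarrow> 'a list \<Rightarrow> nat \<Rightarrow>
     ('a, (nat set \<Rightarrow> ('b \<times> 'a) set) set) module" where
  "cech_cohomology R M xs i = homology_module (cech R M xs i) (cech_coboundaries R M xs i)
     (cech_diff R M xs i) (cech R M xs (Suc i))"


section \<open>Parameter sequences and the Hamilton-Marley condition\<close>

definition parameter_sequence :: "('a, 'm) ring_scheme \<Rightarrow> 'a list \<Rightarrow> bool" where
  "parameter_sequence R xs \<longleftrightarrow> set xs \<subseteq> carrier R \<and>
     weakly_proregular R xs \<and>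
     Idl\<^bsub>R\<^esub> (set xs) \<noteq> carrier R \<and>
     (\<forall>p. primeideal p R \<and> Idl\<^bsub>R\<^esub> (set xs) \<subseteq> p \<longrightarrow>
        (let H = loc_module R (carrier R - p) (cech_cohomology R (self_module R) xs (length xs))
         in carrier H \<noteq> {\<zero>\<^bsub>H\<^esub>}))"

text \<open>Sequences \<open>x\<^sub>1, \<dots>, x\<^sub>l\<close> have \<open>l \<ge> 1\<close>. (This matters only for the zero ring, where the empty
  sequence is not regular.)\<close>

definition strong_parameter_sequence :: "('a, 'm) ring_scheme \<Rightarrow> 'a list \<Rightarrow> bool" where
  "strong_parameter_sequence R xs \<longleftrightarrow> xs \<noteq> [] \<and>
     (\<forall>i. 1 \<le> i \<and> i \<le> length xs \<longrightarrow> parameter_sequence R (take i xs))"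

definition hamilton_marley_cohen_macaulay :: "('a, 'm) ring_scheme \<Rightarrow> bool" where
  "hamilton_marley_cohen_macaulay R \<longleftrightarrow> cring R \<and>
     (\<forall>xs. strong_parameter_sequence R xs \<longrightarrow> regular_sequence R xs)"


section \<open>Filtered direct systems of rings\<close>

definition lying_over ::
  "('a, 'm) ring_scheme \<Rightarrow> ('b, 'n) ring_scheme \<Rightarrow> ('a \<Rightarrow> 'b) \<Rightarrow> bool" where
  "lying_over R S h \<longleftrightarrow>
     (\<forall>p. primeideal p R \<longrightarrow> (\<exists>q. primeideal q S \<and> p = {r \<in> carrier R. h r \<in> q}))"

locale direct_system =
  fixes \<Gamma> :: "'i set" and leq :: "'i \<Rightarrow> 'i \<Rightarrow> bool"
    and A :: "'i \<Rightarrow> ('a, 'm) ring_scheme" and \<phi> :: "'i \<Rightarrow> 'i \<Rightarrow> 'a \<Rightarrow> 'a"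
  assumes nonempty: "\<Gamma> \<noteq> {}"
    and le_refl: "\<gamma> \<in> \<Gamma> \<Longrightarrow> leq \<gamma> \<gamma>"
    and le_trans: "\<lbrakk>\<gamma> \<in> \<Gamma>; \<delta> \<in> \<Gamma>; \<epsilon> \<in> \<Gamma>; leq \<gamma> \<delta>; leq \<delta> \<epsilon>\<rbrakk> \<Longrightarrow> leq \<gamma> \<epsilon>"
    and directed: "\<lbrakk>\<gamma> \<in> \<Gamma>; \<delta> \<in> \<Gamma>\<rbrakk> \<Longrightarrow> \<exists>\<epsilon>\<in>\<Gamma>. leq \<gamma> \<epsilon> \<and> leq \<delta> \<epsilon>"
    and ring: "\<gamma> \<in> \<Gamma> \<Longrightarrow> cring (A \<gamma>)"
    and hom: "\<lbrakk>\<gamma> \<in> \<Gamma>; \<delta> \<in> \<Gamma>; leq \<gamma> \<delta>\<rbrakk> \<Longrightarrow> \<phi> \<gamma> \<delta> \<in> ring_hom (A \<gamma>) (A \<delta>)"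
    and hom_id: "\<lbrakk>\<gamma> \<in> \<Gamma>; a \<in> carrier (A \<gamma>)\<rbrakk> \<Longrightarrow> \<phi> \<gamma> \<gamma> a = a"
    and hom_comp: "\<lbrakk>\<gamma> \<in> \<Gamma>; \<delta> \<in> \<Gamma>; \<epsilon> \<in> \<Gamma>; leq \<gamma> \<delta>; leq \<delta> \<epsilon>; a \<in> carrier (A \<gamma>)\<rbrakk>
      \<Longrightarrow> \<phi> \<delta> \<epsilon> (\<phi> \<gamma> \<delta> a) = \<phi> \<gamma> \<epsilon> a"

text \<open>All rings of a system share one element type; this is no restriction, since any family of
  rings indexed by a type can be embedded in a common type. The limit is the quotient of the
  disjoint union; \<open>dlim_class\<close> is the class of \<open>a \<in> A \<gamma>\<close>.\<close>

definition dlim_class ::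
  "'i set \<Rightarrow> ('i \<Rightarrow> 'i \<Rightarrow> bool) \<Rightarrow> ('i \<Rightarrow> ('a, 'm) ring_scheme) \<Rightarrow> ('i \<Rightarrow> 'i \<Rightarrow> 'a \<Rightarrow> 'a) \<Rightarrow>
     'i \<Rightarrow> 'a \<Rightarrow> ('i \<times> 'a) set" where
  "dlim_class \<Gamma> leq A \<phi> \<gamma> a = {(\<delta>, b). \<delta> \<in> \<Gamma> \<and> b \<in> carrier (A \<delta>) \<and>
     (\<exists>\<epsilon>\<in>\<Gamma>. leq \<gamma> \<epsilon> \<and> leq \<delta> \<epsilon> \<and> \<phi> \<gamma> \<epsilon> a = \<phi> \<delta> \<epsilon> b)}"

definition dlim_op ::
  "'i set \<Rightarrow> ('i \<Rightarrow> 'i \<Rightarrow> bool) \<Rightarrow> ('i \<Rightarrow> ('a, 'm) ring_scheme) \<Rightarrow> ('i \<Rightarrow> 'i \<Rightarrow> 'a \<Rightarrow> 'a) \<Rightarrow>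
     ('i \<Rightarrow> 'a \<Rightarrow> 'a \<Rightarrow> 'a) \<Rightarrow> ('i \<times> 'a) set \<Rightarrow> ('i \<times> 'a) set \<Rightarrow> ('i \<times> 'a) set" where
  "dlim_op \<Gamma> leq A \<phi> f X Y =
     (\<Union>(\<gamma>, a)\<in>X. \<Union>(\<delta>, b)\<in>Y. \<Union>\<epsilon>\<in>{\<epsilon>\<in>\<Gamma>. leq \<gamma> \<epsilon> \<and> leq \<delta> \<epsilon>}.
        dlim_class \<Gamma> leq A \<phi> \<epsilon> (f \<epsilon> (\<phi> \<gamma> \<epsilon> a) (\<phi> \<delta> \<epsilon> b)))"

definition direct_limit ::
  "'i set \<Rightarrow> ('i \<Rightarrow> 'i \<Rightarrow> bool) \<Rightarrow> ('i \<Rightarrow> ('a, 'm) ring_scheme) \<Rightarrow> ('i \<Rightarrow> 'i \<Rightarrow> 'a \<Rightarrow> 'a) \<Rightarrow>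
     ('i \<times> 'a) set ring" where
  "direct_limit \<Gamma> leq A \<phi> =
    \<lparr>carrier = {dlim_class \<Gamma> leq A \<phi> \<gamma> a |\<gamma> a. \<gamma> \<in> \<Gamma> \<and> a \<in> carrier (A \<gamma>)},
     monoid.mult = dlim_op \<Gamma> leq A \<phi> (\<lambda>\<epsilon>. monoid.mult (A \<epsilon>)),
     one = (\<Union>\<gamma>\<in>\<Gamma>. dlim_class \<Gamma> leq A \<phi> \<gamma> \<one>\<^bsub>A \<gamma>\<^esub>),
     ring.zero = (\<Union>\<gamma>\<in>\<Gamma>. dlim_class \<Gamma> leq A \<phi> \<gamma> \<zero>\<^bsub>A \<gamma>\<^esub>),
     add = dlim_op \<Gamma> leq A \<phi> (\<lambda>\<epsilon>. add (A \<epsilon>))\<rparr>"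

end

theory Submission
  imports Defs
begin

text \<open>Let \<open>x\<^sub>1, \<dots>, x\<^sub>l\<close> be a strong parameter sequence on the limit \<open>A\<close>. It comes from some stage, and if
its image in every later stage \<open>A\<^sub>\<delta>\<close> is regular, then it is regular on \<open>A\<close>, because a relation
in \<open>A\<close> already holds at some stage (\<open>weakly_regular_limit\<close>). So it has to be shown that the
images are regular on the Noetherian Cohen-Macaulay rings \<open>A\<^sub>\<delta>\<close>.

What descends from \<open>A\<close> to \<open>A\<^sub>\<delta>\<close> is an elementary consequence of the nonvanishing of top Cech
cohomology. Write \<open>y\<close> for the product of the \<open>x\<^sub>j\<close>. The fraction \<open>1/y\<^sup>n\<close> is a coboundary as soon as
\<open>y\<^sup>k\<close> lies in the ideal generated by the \<open>x\<^sub>j\<^bsup>n+k\<^esup>\<close> for some \<open>k\<close>, and these fractions generate the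
top cohomology module. Hence if the localization of that module at \<open>p\<close> is nonzero, there is an \<open>n\<close>
such that no \<open>s y\<^sup>k\<close> with \<open>s \<notin> p\<close> lies in the ideal generated by the \<open>x\<^sub>j\<^bsup>n+k\<^esup>\<close>
(\<open>monomial_condition\<close>). Membership in an ideal is preserved by ring homomorphisms, so the
condition at a prime of \<open>A\<close> implies the condition at its contraction to \<open>A\<^sub>\<delta>\<close>. Lying over passes to
the limit (\<open>lying_over_limit\<close>), so every prime of \<open>A\<^sub>\<delta>\<close> containing the sequence is such a
contraction.

It remains to see that in a Noetherian Cohen-Macaulay ring these conditions, imposed on all initial
segments, force regularity. After localizing, suppose that \<open>x\<^sub>1, \<dots>, x\<^sub>i\<close> is regular and that
\<open>x\<^bsub>i+1\<^esub>\<close> is a zero divisor modulo it. Then \<open>x\<^bsub>i+1\<^esub>\<close> lies in an associated prime \<open>p\<close> of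
\<open>(x\<^sub>1, \<dots>, x\<^sub>i)\<close>, and by unmixedness \<open>p\<close> is minimal over this ideal. So in the localization at \<open>p\<close>
some power \<open>x\<^bsub>i+1\<^esub>\<^sup>k\<close> lies in \<open>(x\<^sub>1\<^sup>n, \<dots>, x\<^sub>i\<^sup>n)\<close>, for each given \<open>n\<close>. Multiplication by
\<open>(x\<^sub>1 \<cdots> x\<^sub>i)\<^sup>k\<close> yields a relation that contradicts the monomial condition for
\<open>x\<^sub>1, \<dots>, x\<^bsub>i+1\<^esub>\<close> at \<open>p\<close>.

Unmixedness (\<open>assoc_prime_weakly_regular_minimal\<close>) is a count of chains of primes in a local ring of
depth and dimension \<open>d\<close>. Modulo a regular sequence of length \<open>r\<close> there is still a regular sequence
of length \<open>d - r\<close> (\<open>depth_ge_weakly_regular\<close>), so a chain of length \<open>d - r\<close> starts at each associated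
prime (\<open>prime_chain_above_assoc_prime\<close>). If such a prime were not minimal, a chain of length
\<open>d - r + 1\<close> would start at a prime containing the sequence, and each element of the sequence
extends it downwards by one (\<open>weakly_regular_extends_prime_chain\<close>), beyond the dimension.\<close>

section \<open>Prime ideals, associated primes and prime avoidance\<close>

definition colon :: "('a, 'm) ring_scheme \<Rightarrow> 'a set \<Rightarrow> 'a \<Rightarrow> 'a set" where
  "colon R J a = {r \<in> carrier R. a \<otimes>\<^bsub>R\<^esub> r \<in> J}"

definition nzd_mod :: "('a, 'm) ring_scheme \<Rightarrow> 'a set \<Rightarrow> 'a \<Rightarrow> bool" where
  "nzd_mod R J x \<longleftrightarrow> (\<forall>b\<in>carrier R. x \<otimes>\<^bsub>R\<^esub> b \<in> J \<longrightarrow> b \<in> J)"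

text \<open>The associated primes of the module \<open>R/J\<close>.\<close>

definition assoc_primes :: "('a, 'm) ring_scheme \<Rightarrow> 'a set \<Rightarrow> 'a set set" where
  "assoc_primes R J = {p. primeideal p R \<and> (\<exists>a\<in>carrier R. a \<notin> J \<and> p = colon R J a)}"

lemma nzd_modI: "(\<And>b. b \<in> carrier R \<Longrightarrow> x \<otimes>\<^bsub>R\<^esub> b \<in> J \<Longrightarrow> b \<in> J) \<Longrightarrow> nzd_mod R J x"
  by (simp add: nzd_mod_def)

lemma nzd_modD: "nzd_mod R J x \<Longrightarrow> b \<in> carrier R \<Longrightarrow> x \<otimes>\<^bsub>R\<^esub> b \<in> J \<Longrightarrow> b \<in> J"
  by (simp add: nzd_mod_def)

context cring begin

lemma ideal_simps:
  assumes "ideal I R"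
  shows "a \<in> I \<Longrightarrow> a \<in> carrier R"
    and "a \<in> I \<Longrightarrow> b \<in> I \<Longrightarrow> a \<oplus> b \<in> I"
    and "a \<in> I \<Longrightarrow> b \<in> I \<Longrightarrow> a \<ominus> b \<in> I"
    and "a \<in> I \<Longrightarrow> x \<in> carrier R \<Longrightarrow> x \<otimes> a \<in> I"
    and "a \<in> I \<Longrightarrow> x \<in> carrier R \<Longrightarrow> a \<otimes> x \<in> I"
    and "\<zero> \<in> I"
proof -
  interpret ideal I R by fact
  show "a \<in> I \<Longrightarrow> a \<in> carrier R" by (rule Icarr)
  show "a \<in> I \<Longrightarrow> b \<in> I \<Longrightarrow> a \<oplus> b \<in> I" by (rule a_closed)
  show "a \<in> I \<Longrightarrow> b \<in> I \<Longrightarrow> a \<ominus> b \<in> I" by (simp add: a_minus_def)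
  show "a \<in> I \<Longrightarrow> x \<in> carrier R \<Longrightarrow> x \<otimes> a \<in> I" by (rule I_l_closed)
  show "a \<in> I \<Longrightarrow> x \<in> carrier R \<Longrightarrow> a \<otimes> x \<in> I" by (rule I_r_closed)
  show "\<zero> \<in> I" by simp
qed

lemma ideal_of_closed:
  assumes K: "K \<subseteq> carrier R" "K \<noteq> {}"
    and add: "\<And>a b. a \<in> K \<Longrightarrow> b \<in> K \<Longrightarrow> a \<oplus> b \<in> K"
    and mult: "\<And>a x. a \<in> K \<Longrightarrow> x \<in> carrier R \<Longrightarrow> x \<otimes> a \<in> K"
  shows "ideal K R"
proof (rule idealI[OF ring_axioms])
  show "subgroup K (add_monoid R)"
  proof (rule add.subgroupI[OF K])
    fix a assume a: "a \<in> K"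
    have "(\<ominus> \<one>) \<otimes> a \<in> K" by (rule mult[OF a]) simp
    then show "\<ominus> a \<in> K" using a K(1) by (auto simp: l_minus)
  qed (rule add)
  fix a x assume ax: "a \<in> K" "x \<in> carrier R"
  show "x \<otimes> a \<in> K" by (rule mult[OF ax])
  then show "a \<otimes> x \<in> K" using m_comm[of a x] ax K(1) by auto
qed

lemma ideal_diff_mem:
  assumes "ideal I R" "a \<oplus> b \<in> I" "b \<in> I" "a \<in> carrier R"
  shows "a \<in> I"
proof -
  have b: "b \<in> carrier R" by (rule ideal_simps(1)[OF assms(1,3)])
  have "a = (a \<oplus> b) \<ominus> b" using assms(4) b by algebra
  then show ?thesis using ideal_simps(3)[OF assms(1,2,3)] by simp
qed

lemma ideal_colon:
  assumes "ideal J R" "a \<in> carrier R"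
  shows "ideal (colon R J a) R"
  unfolding colon_def by (rule ideal.helper_max_prime[OF assms(1) is_cring assms(2)])

lemma colon_super: "ideal J R \<Longrightarrow> a \<in> carrier R \<Longrightarrow> J \<subseteq> colon R J a"
  by (auto simp: colon_def ideal_simps(1) ideal_simps(4))

lemma Idl_insert_iff:
  assumes S: "S \<subseteq> carrier R" and x: "x \<in> carrier R"
  shows "c \<in> Idl (insert x S) \<longleftrightarrow> (\<exists>i\<in>Idl S. \<exists>r\<in>carrier R. c = i \<oplus> r \<otimes> x)"
proof -
  have id: "ideal (Idl S) R" and idx: "ideal (Idl (insert x S)) R"
    using S x by (auto intro: genideal_ideal)
  have "ideal (set_add R (Idl S) (PIdl x)) R"
    by (rule add_ideals[OF id cgenideal_ideal[OF x]])
  moreover have "insert x S \<subseteq> set_add R (Idl S) (PIdl x)"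
  proof -
    have "s \<in> set_add R (Idl S) (PIdl x)" if "s \<in> S" for s
    proof -
      have "s \<in> Idl S" "\<zero> \<in> PIdl x" "s = s \<oplus> \<zero>"
        using that S genideal_self[OF S] ideal_simps(6)[OF cgenideal_ideal[OF x]] by auto
      then show ?thesis unfolding set_add_def' by blast
    qed
    moreover have "x \<in> set_add R (Idl S) (PIdl x)"
    proof -
      have "\<zero> \<in> Idl S" "x \<in> PIdl x" "x = \<zero> \<oplus> x"
        using x ideal_simps(6)[OF id] cgenideal_self[OF x] by auto
      then show ?thesis unfolding set_add_def' by blast
    qed
    ultimately show ?thesis by auto
  qed
  ultimately have "Idl (insert x S) \<subseteq> set_add R (Idl S) (PIdl x)" by (rule genideal_minimal)
  moreover have "i \<oplus> r \<otimes> x \<in> Idl (insert x S)" if "i \<in> Idl S" "r \<in> carrier R" for i r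
  proof -
    have "i \<in> Idl (insert x S)" using that(1) S x subset_Idl_subset[of "insert x S" S] by auto
    moreover have "x \<in> Idl (insert x S)" using S x genideal_self[of "insert x S"] by auto
    ultimately show ?thesis using that(2) by (intro ideal_simps(2,4)[OF idx])
  qed
  ultimately show ?thesis unfolding set_add_def' cgenideal_def by blast
qed

lemma exists_maximal_disjoint_ideal:
  assumes "ideal I R" "I \<inter> W = {}"
  shows "\<exists>q. ideal q R \<and> I \<subseteq> q \<and> q \<inter> W = {} \<and>
    (\<forall>J. ideal J R \<longrightarrow> q \<subseteq> J \<longrightarrow> J \<inter> W = {} \<longrightarrow> J = q)"
proof -
  define F where "F = {J. ideal J R \<and> I \<subseteq> J \<and> J \<inter> W = {}}"
  have "\<exists>q\<in>F. \<forall>J\<in>F. q \<subseteq> J \<longrightarrow> J = q"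
  proof (rule subset_Zorn_nonempty)
    show "F \<noteq> {}" using assms by (auto simp: F_def)
    fix C assume C: "C \<noteq> {}" "subset.chain F C"
    then have "subset.chain {J. ideal J R} C" by (auto simp: F_def pred_on.chain_def)
    from chain_Union_is_ideal[OF this] have "ideal (\<Union>C) R" using C(1) by auto
    moreover have "C \<subseteq> F" using C(2) by (auto simp: pred_on.chain_def)
    moreover from this have "I \<subseteq> \<Union>C" "\<Union>C \<inter> W = {}" using C(1) unfolding F_def by blast+
    ultimately show "\<Union>C \<in> F" by (auto simp: F_def)
  qed
  then obtain q where q: "q \<in> F" "\<forall>J\<in>F. q \<subseteq> J \<longrightarrow> J = q" by auto
  show ?thesis
    by (rule exI[of _ q]) (use q in \<open>auto simp: F_def\<close>)
qed

text \<open>An ideal that is maximal among those disjoint from a multiplicative set is prime.\<close>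

lemma exists_prime_disjoint:
  assumes "ideal I R" "I \<inter> W = {}"
    and W: "W \<subseteq> carrier R" "\<one> \<in> W" "\<And>a b. a \<in> W \<Longrightarrow> b \<in> W \<Longrightarrow> a \<otimes> b \<in> W"
  shows "\<exists>q. primeideal q R \<and> I \<subseteq> q \<and> q \<inter> W = {}"
proof -
  obtain q where q: "ideal q R" "I \<subseteq> q" "q \<inter> W = {}"
    and max: "\<And>J. ideal J R \<Longrightarrow> q \<subseteq> J \<Longrightarrow> J \<inter> W = {} \<Longrightarrow> J = q"
    using exists_maximal_disjoint_ideal[OF assms(1,2)] by auto
  have qc: "q \<subseteq> carrier R" using ideal_simps(1)[OF q(1)] by auto
  have meet: "\<exists>i\<in>q. \<exists>r\<in>carrier R. i \<oplus> r \<otimes> a \<in> W" if a: "a \<in> carrier R" "a \<notin> q" for a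
  proof -
    have sub: "insert a q \<subseteq> Idl (insert a q)" using a qc by (intro genideal_self) auto
    have id: "ideal (Idl (insert a q)) R" using a qc by (intro genideal_ideal) auto
    then have "Idl (insert a q) \<inter> W \<noteq> {}" using max[OF id] sub a(2) by blast
    then obtain w where w: "w \<in> W" "w \<in> Idl (insert a q)" by auto
    have "Idl q = q" using genideal_minimal[OF q(1)] genideal_self[OF qc] by auto
    then show ?thesis using w Idl_insert_iff[OF qc a(1)] by auto
  qed
  have "primeideal q R"
  proof (rule primeidealI[OF q(1) is_cring])
    show "carrier R \<noteq> q" using W(2) q(3) by auto
    fix a b assume ab: "a \<in> carrier R" "b \<in> carrier R" "a \<otimes> b \<in> q"
    show "a \<in> q \<or> b \<in> q"
    proof (rule ccontr)
      assume n: "\<not> (a \<in> q \<or> b \<in> q)"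
      obtain i r where i: "i \<in> q" "r \<in> carrier R" "i \<oplus> r \<otimes> a \<in> W" using meet ab n by blast
      obtain j s where j: "j \<in> q" "s \<in> carrier R" "j \<oplus> s \<otimes> b \<in> W" using meet ab n by blast
      have ic: "i \<in> carrier R" "j \<in> carrier R" using i j qc by auto
      have "(i \<oplus> r \<otimes> a) \<otimes> (j \<oplus> s \<otimes> b) = i \<otimes> (j \<oplus> s \<otimes> b) \<oplus> j \<otimes> (r \<otimes> a) \<oplus> (r \<otimes> s) \<otimes> (a \<otimes> b)"
        using ic ab i(2) j(2) by algebra
      moreover have "\<dots> \<in> q"
        using ic ab i(2) j(2) ideal_simps(5)[OF q(1) i(1)] ideal_simps(4)[OF q(1) ab(3)]
          ideal_simps(5)[OF q(1) j(1)] ideal_simps(2)[OF q(1)] by simp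
      ultimately show False using W(3)[OF i(3) j(3)] q(3) by auto
    qed
  qed
  then show ?thesis using q by auto
qed

lemma exists_maximal_ideal_above:
  assumes "ideal I R" "I \<noteq> carrier R"
  shows "\<exists>m. maximalideal m R \<and> I \<subseteq> m"
proof -
  have one: "J \<inter> {\<one>} = {} \<longleftrightarrow> J \<noteq> carrier R" if "ideal J R" for J
    using that ideal.one_imp_carrier[OF that] by auto
  obtain m where m: "ideal m R" "I \<subseteq> m" "m \<inter> {\<one>} = {}"
    and max: "\<And>J. ideal J R \<Longrightarrow> m \<subseteq> J \<Longrightarrow> J \<inter> {\<one>} = {} \<Longrightarrow> J = m"
    using exists_maximal_disjoint_ideal[OF assms(1), of "{\<one>}"] one[OF assms(1)] assms(2) by auto
  have "maximalideal m R"
  proof (rule maximalidealI[OF m(1)])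
    show "carrier R \<noteq> m" using m(3) by auto
    show "J = m \<or> J = carrier R" if "ideal J R" "m \<subseteq> J" for J
      using max[OF that] one[OF that(1)] by blast
  qed
  then show ?thesis using m by auto
qed

lemma primeideal_not_mem_mult:
  assumes "primeideal p R" "a \<in> carrier R" "b \<in> carrier R" "a \<notin> p" "b \<notin> p"
  shows "a \<otimes> b \<notin> p"
  using primeideal.I_prime[OF assms(1)] assms by blast

lemma primeideal_one_notin: "primeideal p R \<Longrightarrow> \<one> \<notin> p"
  using ideal.one_imp_carrier[OF primeideal.axioms(1)] primeideal.I_notcarr by blast

lemma primeideal_pow:
  assumes p: "primeideal p R" and "a \<in> carrier R" "a [^] (n::nat) \<in> p"
  shows "a \<in> p"
  using assms(3)
proof (induction n)
  case 0
  then show ?case using primeideal_one_notin[OF p] by simp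
next
  case (Suc n)
  then show ?case using primeideal.I_prime[OF p] assms(2) by (metis nat_pow_Suc nat_pow_closed)
qed

text \<open>The elements \<open>s x\<^sup>n\<close> with \<open>s \<notin> p\<close> form a multiplicative set, and a prime is disjoint from it
exactly if it lies inside \<open>p\<close> and avoids \<open>x\<close>. In geometric terms: if \<open>x\<close> is not nilpotent in the
localization of \<open>R/J\<close> at \<open>p\<close>, some prime of that localization avoids it.\<close>

lemma prime_below_avoiding_element:
  assumes p: "primeideal p R" and x: "x \<in> carrier R" and J: "ideal J R"
    and disj: "\<And>s n. s \<in> carrier R \<Longrightarrow> s \<notin> p \<Longrightarrow> s \<otimes> x [^] (n::nat) \<notin> J"
  shows "\<exists>q. primeideal q R \<and> J \<subseteq> q \<and> q \<subseteq> p \<and> x \<notin> q"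
proof -
  define W where "W = {s \<otimes> x [^] (n::nat) |s n. s \<in> carrier R \<and> s \<notin> p}"
  have one: "\<one> \<notin> p" by (rule primeideal_one_notin[OF p])
  have memW: "s \<in> W" if "s \<in> carrier R" "s \<notin> p" for s
  proof -
    have "s = s \<otimes> x [^] (0::nat)" using that by simp
    then show ?thesis unfolding W_def using that by blast
  qed
  have xW: "x \<in> W"
  proof -
    have "x = \<one> \<otimes> x [^] (1::nat)" using x by simp
    then show ?thesis unfolding W_def using one by blast
  qed
  have "\<exists>q. primeideal q R \<and> J \<subseteq> q \<and> q \<inter> W = {}"
  proof (rule exists_prime_disjoint[OF J])
    show "J \<inter> W = {}" using disj by (auto simp: W_def)
    show "W \<subseteq> carrier R" using x by (auto simp: W_def)
    show "\<one> \<in> W" using memW one by auto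
    fix a b assume "a \<in> W" "b \<in> W"
    then obtain s n t m where *: "a = s \<otimes> x [^] (n::nat)" "s \<in> carrier R" "s \<notin> p"
      "b = t \<otimes> x [^] (m::nat)" "t \<in> carrier R" "t \<notin> p" unfolding W_def by auto
    have "a \<otimes> b = (s \<otimes> t) \<otimes> (x [^] n \<otimes> x [^] m)"
      using * x nat_pow_closed[OF x, of n] nat_pow_closed[OF x, of m] by (simp add: m_ac)
    also have "\<dots> = (s \<otimes> t) \<otimes> x [^] (n + m)" using x by (simp add: nat_pow_mult)
    finally show "a \<otimes> b \<in> W"
      unfolding W_def using * primeideal_not_mem_mult[OF p, of s t] by blast
  qed
  then obtain q where q: "primeideal q R" "J \<subseteq> q" "q \<inter> W = {}" by auto
  have "q \<subseteq> carrier R" using q(1) primeideal.axioms(1) ideal_simps(1) by blast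
  then have "q \<subseteq> p" using q(3) memW by auto
  then show ?thesis using q xW by auto
qed

lemma exists_in_all_not_in:
  assumes "finite F" "ideal M R" "primeideal p R" "\<not> M \<subseteq> p"
    and "\<And>q. q \<in> F \<Longrightarrow> primeideal q R \<and> \<not> q \<subseteq> p"
  shows "\<exists>w\<in>M. w \<notin> p \<and> (\<forall>q\<in>F. w \<in> q)"
  using assms(1,5)
proof (induction F rule: finite_induct)
  case empty
  then show ?case using assms(4) by auto
next
  case (insert q F)
  then obtain w where w: "w \<in> M" "w \<notin> p" "\<forall>q\<in>F. w \<in> q" by auto
  obtain e where e: "e \<in> q" "e \<notin> p" using insert.prems by auto
  have iq: "ideal q R" using insert.prems primeideal.axioms(1) by auto
  have c: "w \<in> carrier R" "e \<in> carrier R" using ideal_simps(1)[OF assms(2) w(1)] ideal_simps(1)[OF iq e(1)] by auto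
  have "w \<otimes> e \<in> M" "w \<otimes> e \<notin> p" "w \<otimes> e \<in> q"
    using ideal_simps(5)[OF assms(2) w(1) c(2)] primeideal_not_mem_mult[OF assms(3) c w(2) e(2)]
      ideal_simps(4)[OF iq e(1) c(1)] by auto
  moreover have "w \<otimes> e \<in> q'" if "q' \<in> F" for q'
    using ideal_simps(5)[of q' w e] insert.prems that w(3) c primeideal.axioms(1) by auto
  ultimately show ?case by auto
qed

text \<open>Remove one prime \<open>p\<close> together with all primes below it, and let \<open>z\<close> avoid the remaining ones. If
\<open>z\<close> happens to lie in \<open>p\<close>, it is corrected by adding an element of \<open>M\<close> outside \<open>p\<close> that lies in
all remaining primes, which exists because none of them is below \<open>p\<close>.\<close>

lemma prime_avoidance:
  assumes "finite F" "ideal M R" "\<And>q. q \<in> F \<Longrightarrow> primeideal q R \<and> \<not> M \<subseteq> q"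
  shows "\<exists>z\<in>M. \<forall>q\<in>F. z \<notin> q"
  using assms(1,3)
proof (induction "card F" arbitrary: F rule: less_induct)
  case less
  show ?case
  proof (cases "F = {}")
    case True
    then show ?thesis using ideal_simps(6)[OF assms(2)] by auto
  next
    case False
    then obtain p where p: "p \<in> F" by auto
    then have pp: "primeideal p R" "\<not> M \<subseteq> p" using less by auto
    define F' where "F' = {q \<in> F. \<not> q \<subseteq> p}"
    have F': "F' \<subset> F" "finite F'" using p less(2) by (auto simp: F'_def)
    have "card F' < card F" by (rule psubset_card_mono[OF less(2) F'(1)])
    have "\<exists>z\<in>M. \<forall>q\<in>F'. z \<notin> q"
      by (rule less(1)[OF \<open>card F' < card F\<close> F'(2)]) (use less(3) F'(1) in auto)
    then obtain z where z: "z \<in> M" "\<forall>q\<in>F'. z \<notin> q" by auto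
    show ?thesis
    proof (cases "z \<in> p")
      case False
      then show ?thesis using z by (auto simp: F'_def)
    next
      case True
      obtain w where w: "w \<in> M" "w \<notin> p" "\<forall>q\<in>F'. w \<in> q"
        using exists_in_all_not_in[OF F'(2) assms(2) pp] less(3) unfolding F'_def by blast
      have c: "z \<in> carrier R" "w \<in> carrier R" using z w ideal_simps(1)[OF assms(2)] by auto
      have notp: "w \<oplus> z \<notin> p"
        using ideal_diff_mem[OF primeideal.axioms(1)[OF pp(1)] _ True c(2)] w(2) by auto
      have "z \<oplus> w \<notin> q" if "q \<in> F'" for q
      proof -
        have "ideal q R" using primeideal.axioms(1) less(3)[of q] F'(1) that by auto
        then show ?thesis using ideal_diff_mem[of q z w] w(3) z(2) c that by auto
      qed
      then have "w \<oplus> z \<notin> q" if "q \<in> F" for q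
        using that notp F'_def c a_comm by auto
      then show ?thesis using ideal_simps(2)[OF assms(2) w(1) z(1)] by auto
    qed
  qed
qed

end

locale noetherian_cring = cring R + noetherian_ring R for R (structure)
begin

lemma exists_maximal_ideal_in_family:
  assumes "A \<noteq> {}" and ideal: "\<And>a. a \<in> A \<Longrightarrow> ideal (f a) R"
  shows "\<exists>a\<in>A. \<forall>b\<in>A. f a \<subseteq> f b \<longrightarrow> f b = f a"
proof -
  have "\<exists>m\<in>f ` A. \<forall>J\<in>f ` A. m \<subseteq> J \<longrightarrow> J = m"
  proof (rule subset_Zorn_nonempty)
    show "f ` A \<noteq> {}" using assms(1) by simp
    fix C assume C: "C \<noteq> {}" "subset.chain (f ` A) C"
    then have sub: "C \<subseteq> f ` A" by (simp add: pred_on.chain_def)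
    have "C \<subseteq> {J. ideal J R}"
    proof
      fix J assume "J \<in> C"
      then obtain a where "a \<in> A" "J = f a" using sub by auto
      then show "J \<in> {J. ideal J R}" using ideal by simp
    qed
    then have "subset.chain {J. ideal J R} C"
      using C(2) by (simp add: pred_on.chain_def)
    then have "\<Union>C \<in> C" using ideal_chain_is_trivial C(1) by simp
    then show "\<Union>C \<in> f ` A" using sub by (rule rev_subsetD)
  qed
  then show ?thesis by simp
qed

lemma ideal_induct [consumes 1, case_names step]:
  assumes "ideal I R"
    and step: "\<And>I. ideal I R \<Longrightarrow> (\<And>J. ideal J R \<Longrightarrow> I \<subset> J \<Longrightarrow> P J) \<Longrightarrow> P I"
  shows "P I"
proof (rule ccontr)
  assume "\<not> P I"
  then have "{J. ideal J R \<and> \<not> P J} \<noteq> {}" using assms(1) by blast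
  then have "\<exists>m\<in>{J. ideal J R \<and> \<not> P J}. \<forall>J\<in>{J. ideal J R \<and> \<not> P J}. m \<subseteq> J \<longrightarrow> J = m"
    by (rule exists_maximal_ideal_in_family) simp
  then obtain m where m: "ideal m R" "\<not> P m" and max: "\<forall>J\<in>{J. ideal J R \<and> \<not> P J}. m \<subseteq> J \<longrightarrow> J = m"
    by blast
  have "P m"
  proof (rule step[OF m(1)])
    fix J assume "ideal J R" "m \<subset> J"
    then show "P J" using max by blast
  qed
  then show False using m(2) by simp
qed

text \<open>A maximal element among the proper colon ideals \<open>(J : a)\<close> is prime: if \<open>r s \<in> (J : a)\<close> and
\<open>s \<notin> (J : a)\<close>, then \<open>(J : as)\<close> contains \<open>(J : a)\<close> and \<open>r\<close>, hence equals \<open>(J : a)\<close>.\<close>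

lemma exists_assoc_prime_above_colon:
  assumes J: "ideal J R" and c: "c \<in> carrier R" "c \<notin> J"
  shows "\<exists>p\<in>assoc_primes R J. colon R J c \<subseteq> p"
proof -
  define A where "A = {a \<in> carrier R. a \<notin> J \<and> colon R J c \<subseteq> colon R J a}"
  have "\<exists>a\<in>A. \<forall>b\<in>A. colon R J a \<subseteq> colon R J b \<longrightarrow> colon R J b = colon R J a"
  proof (rule exists_maximal_ideal_in_family)
    show "A \<noteq> {}" using c unfolding A_def by blast
    show "ideal (colon R J a) R" if "a \<in> A" for a
      by (rule ideal_colon[OF J]) (use that in \<open>simp add: A_def\<close>)
  qed
  then obtain a where aA: "a \<in> A" and maxA: "\<forall>b\<in>A. colon R J a \<subseteq> colon R J b \<longrightarrow> colon R J b = colon R J a"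
    by (rule bexE)
  have a: "a \<in> carrier R" "a \<notin> J" "colon R J c \<subseteq> colon R J a" using aA by (simp_all add: A_def)
  have max: "colon R J b = colon R J a"
    if "b \<in> carrier R" "b \<notin> J" "colon R J a \<subseteq> colon R J b" for b
    using maxA[rule_format, of b] that a(3) unfolding A_def by simp
  have "primeideal (colon R J a) R"
  proof (rule primeidealI[OF ideal_colon[OF J a(1)] is_cring])
    have "\<one> \<notin> colon R J a" using a by (simp add: colon_def)
    then show "carrier R \<noteq> colon R J a" using one_closed by metis
    fix r s assume rs: "r \<in> carrier R" "s \<in> carrier R" "r \<otimes> s \<in> colon R J a"
    show "r \<in> colon R J a \<or> s \<in> colon R J a"
    proof (rule disjCI)
      assume "s \<notin> colon R J a"
      then have s: "a \<otimes> s \<notin> J" using rs by (auto simp: colon_def)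
      have "colon R J a \<subseteq> colon R J (a \<otimes> s)"
      proof
        fix t assume t: "t \<in> colon R J a"
        then have "(a \<otimes> t) \<otimes> s \<in> J" using rs ideal_simps(5)[OF J] by (simp add: colon_def)
        moreover have "(a \<otimes> t) \<otimes> s = (a \<otimes> s) \<otimes> t" using t a(1) rs by (simp add: colon_def m_ac)
        ultimately show "t \<in> colon R J (a \<otimes> s)" using t by (auto simp: colon_def)
      qed
      then have eq: "colon R J (a \<otimes> s) = colon R J a" using max[of "a \<otimes> s"] a(1) rs(2) s by auto
      have "(a \<otimes> s) \<otimes> r = a \<otimes> (r \<otimes> s)" using a(1) rs by (simp add: m_ac)
      then have "r \<in> colon R J (a \<otimes> s)" using rs by (auto simp: colon_def)
      then show "r \<in> colon R J a" using eq by simp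
    qed
  qed
  then show ?thesis using a by (auto simp: assoc_primes_def)
qed

text \<open>Noetherian induction along \<open>0 \<rightarrow> R/p \<rightarrow> R/I \<rightarrow> R/(I, a) \<rightarrow> 0\<close>, where \<open>p = (I : a)\<close> is some
associated prime: the only associated prime of \<open>R/p\<close> is \<open>p\<close>.\<close>

lemma finite_assoc_primes:
  assumes "ideal I R"
  shows "finite (assoc_primes R I)"
  using assms
proof (induction rule: ideal_induct)
  case (step I)
  show ?case
  proof (cases "I = carrier R")
    case True
    then show ?thesis by (simp add: assoc_primes_def)
  next
    case False
    then have "\<one> \<notin> I" using ideal.one_imp_carrier[OF step(1)] by auto
    then obtain p where p: "p \<in> assoc_primes R I"
      using exists_assoc_prime_above_colon[OF step(1), of \<one>] by auto
    then obtain a where a: "a \<in> carrier R" "a \<notin> I" "p = colon R I a" and pp: "primeideal p R"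
      by (auto simp: assoc_primes_def)
    have Ic: "I \<subseteq> carrier R" using ideal_simps(1)[OF step(1)] by auto
    have II: "Idl I = I" using genideal_minimal[OF step(1)] genideal_self[OF Ic] by auto
    define I' where "I' = Idl (insert a I)"
    have I': "ideal I' R" "I \<subset> I'"
      using genideal_ideal[of "insert a I"] genideal_self[of "insert a I"] Ic a by (auto simp: I'_def)
    have I'_iff: "c \<in> I' \<longleftrightarrow> (\<exists>i\<in>I. \<exists>r\<in>carrier R. c = i \<oplus> r \<otimes> a)" for c
      unfolding I'_def using Idl_insert_iff[OF Ic a(1), of c] II by simp
    \<comment> \<open>An associated prime of \<open>I\<close> survives modulo \<open>a\<close> unless a nonzero multiple of its witness
      lands in the submodule of \<open>R/I\<close> generated by \<open>a\<close>, where every nonzero element has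
      annihilator \<open>p\<close>.\<close>
    have "assoc_primes R I \<subseteq> insert p (assoc_primes R I')"
    proof
      fix q assume q: "q \<in> assoc_primes R I"
      then obtain b where b: "b \<in> carrier R" "b \<notin> I" "q = colon R I b" and qp: "primeideal q R"
        by (auto simp: assoc_primes_def)
      show "q \<in> insert p (assoc_primes R I')"
      proof (cases "colon R I' b = q")
        case True
        have "b \<notin> I'"
        proof
          assume "b \<in> I'"
          then have "\<one> \<in> q" using True b(1) by (auto simp: colon_def)
          then show False using primeideal_one_notin[OF qp] by simp
        qed
        then show ?thesis using True qp b(1) by (auto simp: assoc_primes_def)
      next
        case False
        moreover have "q \<subseteq> colon R I' b" using b(3) I'(2) by (auto simp: colon_def)
        ultimately obtain r where r: "r \<in> carrier R" "b \<otimes> r \<in> I'" "r \<notin> q"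
          by (auto simp: colon_def)
        obtain i c where ic: "i \<in> I" "c \<in> carrier R" "b \<otimes> r = i \<oplus> c \<otimes> a" using r(2) I'_iff by auto
        have i: "i \<in> carrier R" using ic(1) Ic by auto
        have br: "b \<otimes> r \<notin> I" using r b by (auto simp: colon_def)
        have cp: "c \<notin> p"
        proof
          assume "c \<in> p"
          then have "a \<otimes> c \<in> I" using a by (auto simp: colon_def)
          then have "c \<otimes> a \<in> I" using a(1) ic(2) by (simp add: m_comm)
          then have "b \<otimes> r \<in> I" using ic ideal_simps(2)[OF step(1)] by auto
          then show False using br by simp
        qed
        have "s \<in> q \<longleftrightarrow> s \<in> p" if s: "s \<in> carrier R" for s
        proof -
          have "s \<in> q \<longleftrightarrow> r \<otimes> s \<in> q"
            using primeideal.I_prime[OF qp r(1) s] r(1,3) ideal_simps(4)[OF primeideal.axioms(1)[OF qp], of s r] by auto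
          also have "\<dots> \<longleftrightarrow> b \<otimes> (r \<otimes> s) \<in> I" using b(3) r(1) s by (auto simp: colon_def)
          also have "b \<otimes> (r \<otimes> s) = c \<otimes> s \<otimes> a \<oplus> i \<otimes> s"
          proof -
            have "b \<otimes> (r \<otimes> s) = (b \<otimes> r) \<otimes> s" using b(1) r(1) s by (simp add: m_assoc)
            also have "\<dots> = c \<otimes> s \<otimes> a \<oplus> i \<otimes> s" unfolding ic(3) using i ic(2) a(1) s by algebra
            finally show ?thesis .
          qed
          also have "\<dots> \<in> I \<longleftrightarrow> c \<otimes> s \<otimes> a \<in> I"
            using ideal_diff_mem[OF step(1), of "c \<otimes> s \<otimes> a" "i \<otimes> s"] ideal_simps(2)[OF step(1)]
              ideal_simps(5)[OF step(1) ic(1) s] ic(2) s a(1) by auto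
          also have "\<dots> \<longleftrightarrow> c \<otimes> s \<in> p" using a ic(2) s by (auto simp: colon_def m_comm)
          also have "\<dots> \<longleftrightarrow> s \<in> p"
            using primeideal.I_prime[OF pp ic(2) s] cp ic(2) ideal_simps(4)[OF primeideal.axioms(1)[OF pp], of s c] by auto
          finally show ?thesis .
        qed
        moreover have "q \<subseteq> carrier R" "p \<subseteq> carrier R" using b(3) a(3) by (auto simp: colon_def)
        ultimately have "q = p" by blast
        then show ?thesis by simp
      qed
    qed
    moreover have "finite (assoc_primes R I')" using step(2) I' by auto
    ultimately show ?thesis using finite_subset by blast
  qed
qed

text \<open>The zero divisors modulo each of the ideals lie in the union of its associated primes. There are
finitely many of these, and the hypothesis says that none of them contains \<open>M\<close>.\<close>

lemma exists_common_nonzerodivisor: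
  assumes M: "ideal M R" and fin: "finite Js"
    and Js: "\<And>J. J \<in> Js \<Longrightarrow> ideal J R"
    and soc: "\<And>J a. J \<in> Js \<Longrightarrow> a \<in> carrier R \<Longrightarrow> a \<notin> J \<Longrightarrow> \<not> M \<subseteq> colon R J a"
  shows "\<exists>z\<in>M. \<forall>J\<in>Js. nzd_mod R J z"
proof -
  define F where "F = (\<Union>J\<in>Js. assoc_primes R J)"
  have "finite F" using fin Js finite_assoc_primes by (auto simp: F_def)
  moreover have "primeideal q R \<and> \<not> M \<subseteq> q" if "q \<in> F" for q
    using that soc by (auto simp: F_def assoc_primes_def)
  ultimately obtain z where z: "z \<in> M" "\<forall>q\<in>F. z \<notin> q" using prime_avoidance[OF _ M] by blast
  have "nzd_mod R J z" if J: "J \<in> Js" for J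
  proof (rule nzd_modI, rule ccontr)
    fix b assume b: "b \<in> carrier R" "z \<otimes> b \<in> J" "b \<notin> J"
    obtain p where p: "p \<in> assoc_primes R J" "colon R J b \<subseteq> p"
      using exists_assoc_prime_above_colon[OF Js[OF J] b(1,3)] by auto
    have "z \<in> colon R J b" using b z(1) ideal_simps(1)[OF M] by (auto simp: colon_def m_comm)
    then show False using p z(2) J by (auto simp: F_def)
  qed
  then show ?thesis using z by auto
qed

end

section \<open>Chains of primes, depth and regular sequences\<close>

fun prime_chain_above :: "('a, 'm) ring_scheme \<Rightarrow> 'a set \<Rightarrow> nat \<Rightarrow> bool" where
  "prime_chain_above R p 0 \<longleftrightarrow> primeideal p R"
| "prime_chain_above R p (Suc n) \<longleftrightarrow> primeideal p R \<and> (\<exists>q. p \<subset> q \<and> prime_chain_above R q n)"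

lemma prime_chain_above_prime: "prime_chain_above R p n \<Longrightarrow> primeideal p R"
  by (cases n) auto

lemma prime_chain_above_imp_sequence:
  "prime_chain_above R p n \<Longrightarrow>
    \<exists>P. P 0 = p \<and> (\<forall>i\<le>n. primeideal (P i) R) \<and> (\<forall>i<n. P i \<subset> P (Suc i))"
proof (induction n arbitrary: p)
  case 0
  then show ?case by (intro exI[of _ "\<lambda>_. p"]) auto
next
  case (Suc n)
  then obtain q where pq: "primeideal p R" "p \<subset> q" "prime_chain_above R q n" by auto
  from Suc.IH[OF pq(3)] obtain P where P: "P 0 = q"
    "\<forall>i\<le>n. primeideal (P i) R" "\<forall>i<n. P i \<subset> P (Suc i)" by blast
  have "primeideal (case_nat p P i) R" if "i \<le> Suc n" for i
    using pq(1) P(2) that by (cases i) auto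
  moreover have "case_nat p P i \<subset> case_nat p P (Suc i)" if "i < Suc n" for i
    using pq(2) P(1,3) that by (cases i) auto
  ultimately show ?case by (intro exI[of _ "case_nat p P"]) simp
qed

lemma prime_chain_above_le_krull_dim:
  assumes "prime_chain_above R p n"
  shows "enat n \<le> krull_dim R"
  unfolding krull_dim_def using prime_chain_above_imp_sequence[OF assms] by (intro Sup_upper) blast

text \<open>Generators \<open>S\<close> stand for the ideal, so that adjoining two elements in either order gives the same set.\<close>

fun depth_ge :: "('a, 'm) ring_scheme \<Rightarrow> 'a set \<Rightarrow> nat \<Rightarrow> 'a set \<Rightarrow> bool" where
  "depth_ge R M 0 S \<longleftrightarrow> True"
| "depth_ge R M (Suc t) S \<longleftrightarrow>
    (\<exists>y\<in>M. nzd_mod R (genideal R S) y \<and> depth_ge R M t (insert y S))"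

text \<open>A regular sequence without the requirement that it generates a proper ideal.\<close>

definition weakly_regular :: "('a, 'm) ring_scheme \<Rightarrow> 'a list \<Rightarrow> bool" where
  "weakly_regular R xs \<longleftrightarrow> (\<forall>i<length xs. nzd_mod R (genideal R (set (take i xs))) (xs ! i))"

lemma weakly_regular_snoc:
  "weakly_regular R (xs @ [x]) \<longleftrightarrow> weakly_regular R xs \<and> nzd_mod R (genideal R (set xs)) x"
  by (auto simp: weakly_regular_def nth_append less_Suc_eq)

context cring begin

lemma nzd_mod_Quot_iff:
  assumes I: "ideal I R" and x: "x \<in> carrier R"
  shows "nonzerodivisor (R Quot I) (I +> x) \<longleftrightarrow> nzd_mod R I x"
proof -
  have zero: "I +> b = I \<longleftrightarrow> b \<in> I" if "b \<in> carrier R" for b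
    using ideal.rcos_const_imp_mem[OF I that] a_rcos_zero[OF I] by blast
  have mult: "(I +> x) \<otimes>\<^bsub>R Quot I\<^esub> (I +> b) = I +> (x \<otimes> b)" if "b \<in> carrier R" for b
    using ideal.rcoset_mult_add[OF I x that] by (simp add: FactRing_def)
  have car: "carrier (R Quot I) = (\<lambda>b. I +> b) ` carrier R" "\<zero>\<^bsub>R Quot I\<^esub> = I"
    by (auto simp: FactRing_simps)
  have "nonzerodivisor (R Quot I) (I +> x) \<longleftrightarrow> (\<forall>b\<in>carrier R. I +> (x \<otimes> b) = I \<longrightarrow> I +> b = I)"
    unfolding nonzerodivisor_def car using mult x by auto
  also have "\<dots> \<longleftrightarrow> nzd_mod R I x" unfolding nzd_mod_def using zero x by auto
  finally show ?thesis .
qed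

lemma regular_sequence_iff:
  assumes "set xs \<subseteq> carrier R"
  shows "regular_sequence R xs \<longleftrightarrow> weakly_regular R xs \<and> Idl (set xs) \<noteq> carrier R"
proof -
  have "nonzerodivisor (R Quot Idl (set (take i xs))) (Idl (set (take i xs)) +> xs ! i) \<longleftrightarrow>
      nzd_mod R (Idl (set (take i xs))) (xs ! i)" if "i < length xs" for i
  proof (rule nzd_mod_Quot_iff)
    show "ideal (Idl (set (take i xs))) R"
      using assms by (intro genideal_ideal) (auto dest: in_set_takeD)
    show "xs ! i \<in> carrier R" using that assms by auto
  qed
  then show ?thesis using assms by (auto simp: regular_sequence_def weakly_regular_def Let_def)
qed

lemma nzd_mod_insert_swap:
  assumes S: "S \<subseteq> carrier R" and x: "x \<in> carrier R" and y: "y \<in> carrier R"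
    and ny: "nzd_mod R (Idl S) y" and nx: "nzd_mod R (Idl (insert y S)) x"
  shows "nzd_mod R (Idl (insert x S)) y"
proof (rule nzd_modI)
  fix b assume b: "b \<in> carrier R" "y \<otimes> b \<in> Idl (insert x S)"
  have id: "ideal (Idl S) R" by (rule genideal_ideal[OF S])
  obtain i c where ic: "i \<in> Idl S" "c \<in> carrier R" "y \<otimes> b = i \<oplus> c \<otimes> x"
    using b(2) Idl_insert_iff[OF S x] by auto
  have i: "i \<in> carrier R" using ideal_simps(1)[OF id ic(1)] .
  have "x \<otimes> c = \<ominus> i \<oplus> b \<otimes> y"
  proof -
    have "x \<otimes> c = (i \<oplus> c \<otimes> x) \<ominus> i" using x ic i by algebra
    also have "\<dots> = \<ominus> i \<oplus> b \<otimes> y" unfolding ic(3)[symmetric] using y b i by algebra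
    finally show ?thesis .
  qed
  moreover have "\<ominus> i \<in> Idl S"
    using ideal_simps(3)[OF id ideal_simps(6)[OF id] ic(1)] i by (simp add: a_minus_def)
  ultimately have "x \<otimes> c \<in> Idl (insert y S)" using Idl_insert_iff[OF S y] b(1) by blast
  then have "c \<in> Idl (insert y S)" using nzd_modD[OF nx ic(2)] by simp
  then obtain j d where jd: "j \<in> Idl S" "d \<in> carrier R" "c = j \<oplus> d \<otimes> y"
    using Idl_insert_iff[OF S y] by auto
  have j: "j \<in> carrier R" using ideal_simps(1)[OF id jd(1)] .
  have "y \<otimes> (b \<ominus> d \<otimes> x) = y \<otimes> b \<ominus> y \<otimes> (d \<otimes> x)" using y b jd x by algebra
  also have "\<dots> = i \<oplus> j \<otimes> x" unfolding ic(3) jd(3) using y b jd x i j by algebra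
  also have "\<dots> \<in> Idl S" using ideal_simps(2,5)[OF id] ic(1) jd(1) x by blast
  finally have "b \<ominus> d \<otimes> x \<in> Idl S" using nzd_modD[OF ny, of "b \<ominus> d \<otimes> x"] b x jd by simp
  moreover have "b = (b \<ominus> d \<otimes> x) \<oplus> d \<otimes> x" using b x jd by algebra
  ultimately show "b \<in> Idl (insert x S)" using Idl_insert_iff[OF S x] jd(2) by blast
qed

text \<open>Minimal primes over \<open>I\<close> consist of zero divisors modulo \<open>I\<close>, so a prime that contains a nonzerodivisor
is not minimal.\<close>

lemma exists_prime_strictly_below:
  assumes I: "ideal I R" and x: "x \<in> carrier R" and nx: "nzd_mod R I x"
    and p: "primeideal p R" "I \<subseteq> p" "x \<in> p"
  shows "\<exists>q. primeideal q R \<and> I \<subseteq> q \<and> q \<subset> p"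
proof -
  have "s \<otimes> x [^] (n::nat) \<notin> I" if s: "s \<in> carrier R" "s \<notin> p" for s n
  proof (induction n)
    case 0
    then show ?case using s p by auto
  next
    case (Suc n)
    have "s \<otimes> x [^] Suc n = x \<otimes> (s \<otimes> x [^] n)" using s x by (simp add: m_ac)
    then show ?case using nzd_modD[OF nx, of "s \<otimes> x [^] n"] Suc s x by auto
  qed
  then obtain q where "primeideal q R" "I \<subseteq> q" "q \<subseteq> p" "x \<notin> q"
    using prime_below_avoiding_element[OF p(1) x I] by auto
  then show ?thesis using p(3) by blast
qed

lemma weakly_regular_extends_prime_chain:
  assumes "set xs \<subseteq> carrier R" "weakly_regular R xs" "set xs \<subseteq> p" "prime_chain_above R p n"
  shows "\<exists>q. prime_chain_above R q (n + length xs)"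
  using assms
proof (induction xs arbitrary: p n rule: rev_induct)
  case Nil
  then show ?case by auto
next
  case (snoc x xs)
  have pp: "primeideal p R" using prime_chain_above_prime snoc.prems by blast
  have id: "ideal (Idl (set xs)) R" using snoc.prems by (intro genideal_ideal) auto
  have "Idl (set xs) \<subseteq> p" using snoc.prems by (intro genideal_minimal primeideal.axioms(1)[OF pp]) auto
  then obtain q where q: "primeideal q R" "Idl (set xs) \<subseteq> q" "q \<subset> p"
    using exists_prime_strictly_below[OF id _ _ pp, of x] snoc.prems by (auto simp: weakly_regular_snoc)
  then have "prime_chain_above R q (Suc n)" using snoc.prems by auto
  moreover have "set xs \<subseteq> q" using q(2) genideal_self[of "set xs"] snoc.prems by auto
  ultimately have "\<exists>q. prime_chain_above R q (Suc n + length xs)"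
    using snoc.prems by (intro snoc.IH[of q]) (auto simp: weakly_regular_snoc)
  then show ?case by simp
qed

end

section \<open>Depth in Noetherian local rings\<close>

locale noetherian_local_ring = noetherian_cring R for R (structure) +
  fixes M
  assumes M_ideal: "ideal M R" and M_proper: "\<one> \<notin> M"
    and Units_outside: "x \<in> carrier R \<Longrightarrow> x \<notin> M \<Longrightarrow> x \<in> Units R"
begin

lemma M_sub: "M \<subseteq> carrier R" using ideal_simps(1)[OF M_ideal] by auto

lemma ideal_cancel_unit:
  assumes I: "ideal I R" and u: "u \<in> Units R" and a: "a \<in> carrier R" and "u \<otimes> a \<in> I"
  shows "a \<in> I"
proof -
  have "inv u \<otimes> (u \<otimes> a) \<in> I" using assms(4) u by (simp add: ideal_simps(4)[OF I])
  moreover have "inv u \<otimes> (u \<otimes> a) = a"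
    using Units_closed[OF u] Units_inv_closed[OF u] a Units_l_inv[OF u] by (simp flip: m_assoc)
  ultimately show ?thesis by simp
qed

lemma one_minus_unit:
  assumes "y \<in> M" shows "\<one> \<ominus> y \<in> Units R"
proof (rule Units_outside)
  have yc: "y \<in> carrier R" using assms M_sub by auto
  then show "\<one> \<ominus> y \<in> carrier R" by simp
  show "\<one> \<ominus> y \<notin> M"
  proof
    assume "\<one> \<ominus> y \<in> M"
    then have "(\<one> \<ominus> y) \<oplus> y \<in> M" using assms by (rule ideal_simps(2)[OF M_ideal])
    moreover have "(\<one> \<ominus> y) \<oplus> y = \<one>" using yc by algebra
    ultimately show False using M_proper by simp
  qed
qed

text \<open>The socles of \<open>R/(S, x)\<close> and \<open>R/(S, y)\<close> are isomorphic, both being \<open>Ext\<^sup>1(R/M, R/(S))\<close>. The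
isomorphism sends \<open>u\<close> to the \<open>v\<close> with \<open>u y = v x\<close> modulo \<open>S\<close>.\<close>

lemma colon_transfer:
  assumes S: "S \<subseteq> carrier R" and x: "x \<in> M" and y: "y \<in> M"
    and nx: "nzd_mod R (Idl S) x" and ny: "nzd_mod R (Idl S) y"
    and u: "u \<in> carrier R" "u \<notin> Idl (insert x S)" "M \<subseteq> colon R (Idl (insert x S)) u"
  shows "\<exists>v\<in>carrier R. v \<notin> Idl (insert y S) \<and> M \<subseteq> colon R (Idl (insert y S)) v"
proof -
  have xc: "x \<in> carrier R" and yc: "y \<in> carrier R" using x y M_sub by auto
  have id: "ideal (Idl S) R" by (rule genideal_ideal[OF S])
  have iff_x: "\<And>c. c \<in> Idl (insert x S) \<longleftrightarrow> (\<exists>i\<in>Idl S. \<exists>r\<in>carrier R. c = i \<oplus> r \<otimes> x)"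
    by (rule Idl_insert_iff[OF S xc])
  have iff_y: "\<And>c. c \<in> Idl (insert y S) \<longleftrightarrow> (\<exists>i\<in>Idl S. \<exists>r\<in>carrier R. c = i \<oplus> r \<otimes> y)"
    by (rule Idl_insert_iff[OF S yc])
  have "u \<otimes> y \<in> Idl (insert x S)" using u(3) y by (auto simp: colon_def)
  then obtain i v where iv: "i \<in> Idl S" "v \<in> carrier R" "u \<otimes> y = i \<oplus> v \<otimes> x" using iff_x by auto
  have ic: "i \<in> carrier R" using ideal_simps(1)[OF id iv(1)] .
  have "v \<notin> Idl (insert y S)"
  proof
    assume "v \<in> Idl (insert y S)"
    then obtain j w where jw: "j \<in> Idl S" "w \<in> carrier R" "v = j \<oplus> w \<otimes> y" using iff_y by auto
    have jc: "j \<in> carrier R" using ideal_simps(1)[OF id jw(1)] .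
    have "y \<otimes> (u \<ominus> w \<otimes> x) = u \<otimes> y \<ominus> y \<otimes> (w \<otimes> x)" using yc u(1) jw xc by algebra
    also have "\<dots> = i \<oplus> j \<otimes> x" unfolding iv(3) jw(3) using yc u(1) jw xc ic jc by algebra
    also have "\<dots> \<in> Idl S" using ideal_simps(2,5)[OF id] iv(1) jw(1) xc by blast
    finally have "u \<ominus> w \<otimes> x \<in> Idl S" using nzd_modD[OF ny] u xc jw by simp
    moreover have "u = (u \<ominus> w \<otimes> x) \<oplus> w \<otimes> x" using u xc jw by algebra
    ultimately have "u \<in> Idl (insert x S)" using iff_x jw(2) by blast
    then show False using u(2) by simp
  qed
  moreover have "v \<otimes> r \<in> Idl (insert y S)" if r: "r \<in> M" for r
  proof -
    have rc: "r \<in> carrier R" using r M_sub by auto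
    have "u \<otimes> r \<in> Idl (insert x S)" using u(3) r by (auto simp: colon_def)
    then obtain k w where kw: "k \<in> Idl S" "w \<in> carrier R" "u \<otimes> r = k \<oplus> w \<otimes> x" using iff_x by auto
    have kc: "k \<in> carrier R" using ideal_simps(1)[OF id kw(1)] .
    have "x \<otimes> (v \<otimes> r \<ominus> w \<otimes> y) = ((i \<oplus> v \<otimes> x) \<ominus> i) \<otimes> r \<ominus> ((k \<oplus> w \<otimes> x) \<ominus> k) \<otimes> y"
      using xc yc rc kc kw(2) iv(2) ic by algebra
    also have "\<dots> = k \<otimes> y \<ominus> i \<otimes> r"
      unfolding iv(3)[symmetric] kw(3)[symmetric] using u(1) yc rc kc ic by algebra
    also have "\<dots> \<in> Idl S" using ideal_simps(3,5)[OF id] iv(1) kw(1) yc rc by blast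
    finally have "v \<otimes> r \<ominus> w \<otimes> y \<in> Idl S" using nzd_modD[OF nx] iv kw rc yc by simp
    moreover have "v \<otimes> r = (v \<otimes> r \<ominus> w \<otimes> y) \<oplus> w \<otimes> y" using iv rc kw yc by algebra
    ultimately show ?thesis using iff_y kw(2) by blast
  qed
  ultimately show ?thesis using iv(2) M_sub by (auto simp: colon_def)
qed

lemma not_M_sub_colon:
  assumes "ideal J R" "z \<in> M" "nzd_mod R J z" "a \<in> carrier R" "a \<notin> J"
  shows "\<not> M \<subseteq> colon R J a"
proof
  assume "M \<subseteq> colon R J a"
  then have "z \<otimes> a \<in> J" using assms M_sub by (auto simp: colon_def m_comm)
  then show False using nzd_modD[OF assms(3,4)] assms(5) by simp
qed

text \<open>Cutting by any regular element lowers the depth by at most one. If the given sequence starts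
with \<open>y\<close> and has further terms, then \<open>R/(S, y)\<close> has zero socle, hence so has \<open>R/(S, x)\<close> by \<open>colon_transfer\<close>, and
some \<open>z \<in> M\<close> is regular modulo \<open>S\<close>, \<open>(S, x)\<close> and \<open>(S, y)\<close> at once. The induction hypothesis replaces
\<open>y, \<dots>\<close> first by a sequence starting with \<open>y, z\<close>, and then, the order of \<open>y, z\<close> being immaterial, by
one starting with \<open>z, x\<close>.\<close>

lemma depth_ge_quotient:
  assumes "S \<subseteq> carrier R" "depth_ge R M (Suc t) S" "x \<in> M" "nzd_mod R (Idl S) x"
  shows "depth_ge R M t (insert x S)"
  using assms
proof (induction t arbitrary: S x)
  case 0
  then show ?case by simp
next
  case (Suc t)
  note S = Suc.prems(1) and x = Suc.prems(3) and nx = Suc.prems(4)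
  obtain y where y: "y \<in> M" and ny: "nzd_mod R (Idl S) y" and dy: "depth_ge R M (Suc t) (insert y S)"
    using Suc.prems(2) by auto
  obtain w where w: "w \<in> M" "nzd_mod R (Idl (insert y S)) w" using dy by auto
  have xc: "x \<in> carrier R" and yc: "y \<in> carrier R" using x y M_sub by auto
  have idS: "ideal (Idl S) R" and idx: "ideal (Idl (insert x S)) R" and idy: "ideal (Idl (insert y S)) R"
    using S xc yc by (auto intro: genideal_ideal)
  have socx: "\<not> M \<subseteq> colon R (Idl (insert x S)) a" if "a \<in> carrier R" "a \<notin> Idl (insert x S)" for a
    using colon_transfer[OF S x y nx ny that] not_M_sub_colon[OF idy w] by blast
  have "\<exists>z\<in>M. \<forall>J\<in>{Idl S, Idl (insert x S), Idl (insert y S)}. nzd_mod R J z"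
  proof (rule exists_common_nonzerodivisor[OF M_ideal])
    fix J a assume "J \<in> {Idl S, Idl (insert x S), Idl (insert y S)}" "a \<in> carrier R" "a \<notin> J"
    then show "\<not> M \<subseteq> colon R J a"
      using not_M_sub_colon[OF idS x nx] not_M_sub_colon[OF idy w] socx by auto
  qed (use idS idx idy in auto)
  then obtain z where z: "z \<in> M" and nz: "nzd_mod R (Idl S) z"
    "nzd_mod R (Idl (insert x S)) z" "nzd_mod R (Idl (insert y S)) z" by auto
  have zc: "z \<in> carrier R" using z M_sub by auto
  have "depth_ge R M t (insert z (insert y S))"
    by (rule Suc.IH[OF _ dy z nz(3)]) (use S yc in auto)
  moreover have "nzd_mod R (Idl (insert z S)) y" by (rule nzd_mod_insert_swap[OF S zc yc ny nz(3)])
  ultimately have dz: "depth_ge R M (Suc t) (insert z S)" using y by (auto simp: insert_commute)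
  have "nzd_mod R (Idl (insert z S)) x" by (rule nzd_mod_insert_swap[OF S zc xc nx nz(2)])
  then have "depth_ge R M t (insert x (insert z S))"
    by (intro Suc.IH[OF _ dz x]) (use S zc in auto)
  then show ?case using z nz(2) by (auto simp: insert_commute)
qed

lemma depth_ge_weakly_regular:
  assumes "set xs \<subseteq> M" "weakly_regular R xs" "depth_ge R M d {}"
  shows "depth_ge R M (d - length xs) (set xs)"
  using assms(1,2)
proof (induction xs rule: rev_induct)
  case Nil
  then show ?case using assms(3) by simp
next
  case (snoc x xs)
  show ?case
  proof (cases "d - length xs")
    case 0
    then show ?thesis by simp
  next
    case (Suc t)
    have "depth_ge R M (Suc t) (set xs)" using snoc Suc by (auto simp: weakly_regular_snoc)
    then have "depth_ge R M t (insert x (set xs))"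
      by (rule depth_ge_quotient[rotated]) (use snoc M_sub in \<open>auto simp: weakly_regular_snoc\<close>)
    moreover have "t = d - length (xs @ [x])" using Suc by simp
    ultimately show ?thesis by simp
  qed
qed

lemma depth_ge_of_weakly_regular:
  assumes "set xs \<subseteq> M" "weakly_regular R xs"
  shows "depth_ge R M (length xs) {}"
proof -
  have "depth_ge R M k (set (take (length xs - k) xs))" if "k \<le> length xs" for k
    using that
  proof (induction k)
    case 0
    then show ?case by simp
  next
    case (Suc k)
    define i where "i = length xs - Suc k"
    have i: "i < length xs" "length xs - k = Suc i" using Suc.prems by (auto simp: i_def)
    have "depth_ge R M k (insert (xs ! i) (set (take i xs)))"
      using Suc i by (simp add: take_Suc_conv_app_nth)
    moreover have "xs ! i \<in> M" "nzd_mod R (Idl (set (take i xs))) (xs ! i)"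
      using i assms by (auto simp: weakly_regular_def)
    ultimately show ?case by (auto simp flip: i_def)
  qed
  from this[of "length xs"] show ?thesis by simp
qed

text \<open>The ideals generated by longer and longer regular sequences increase strictly, so some regular
sequence cannot be prolonged; by \<open>depth_ge_weakly_regular\<close> none is longer.\<close>

lemma exists_depth_bound: "\<exists>t. \<not> depth_ge R M t {}"
proof -
  define A where "A = {xs. set xs \<subseteq> M \<and> weakly_regular R xs}"
  have "\<exists>xs\<in>A. \<forall>ys\<in>A. Idl (set xs) \<subseteq> Idl (set ys) \<longrightarrow> Idl (set ys) = Idl (set xs)"
  proof (rule exists_maximal_ideal_in_family)
    have "[] \<in> A" by (simp add: A_def weakly_regular_def)
    then show "A \<noteq> {}" by blast
    show "ideal (Idl (set xs)) R" if "xs \<in> A" for xs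
      using that M_sub by (intro genideal_ideal) (auto simp: A_def)
  qed
  then obtain xs where "xs \<in> A"
    and maxA: "\<forall>ys\<in>A. Idl (set xs) \<subseteq> Idl (set ys) \<longrightarrow> Idl (set ys) = Idl (set xs)"
    by (rule bexE)
  then have xs: "set xs \<subseteq> M" "weakly_regular R xs" by (simp_all add: A_def)
  have max: "Idl (set ys) = Idl (set xs)"
    if "set ys \<subseteq> M" "weakly_regular R ys" "Idl (set xs) \<subseteq> Idl (set ys)" for ys
    using maxA[rule_format, of ys] that by (simp add: A_def)
  have xc: "set xs \<subseteq> carrier R" using xs(1) M_sub by auto
  have "\<not> depth_ge R M (Suc (length xs)) {}"
  proof
    assume "depth_ge R M (Suc (length xs)) {}"
    then have "depth_ge R M 1 (set xs)" using depth_ge_weakly_regular[OF xs] by fastforce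
    then obtain z where z: "z \<in> M" "nzd_mod R (Idl (set xs)) z" by auto
    have zc: "z \<in> carrier R" using z M_sub by auto
    have "Idl (set (xs @ [z])) = Idl (set xs)"
      using xs z xc zc by (intro max subset_Idl_subset) (auto simp: weakly_regular_snoc)
    then have "z \<otimes> \<one> \<in> Idl (set xs)" using genideal_self[of "set (xs @ [z])"] xc zc by auto
    then have "\<one> \<in> Idl (set xs)" using nzd_modD[OF z(2), of \<one>] by simp
    then show False using genideal_minimal[OF M_ideal xs(1)] M_proper by blast
  qed
  then show ?thesis by blast
qed

text \<open>If \<open>y \<in> M\<close> is regular modulo \<open>S\<close> and \<open>p\<close> is associated to \<open>S\<close>, then some associated prime of \<open>(S, y)\<close>
contains \<open>p\<close> and \<open>y\<close>, and so is strictly larger than \<open>p\<close>. Indeed, by Nakayama's lemma some element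
of \<open>R/S\<close> killed by \<open>p\<close> is not divisible by \<open>y\<close>.\<close>

lemma prime_chain_above_assoc_prime:
  assumes "S \<subseteq> M" "depth_ge R M t S" "p \<in> assoc_primes R (Idl S)"
  shows "prime_chain_above R p t"
  using assms
proof (induction t arbitrary: S p)
  case 0
  then show ?case by (auto simp: assoc_primes_def)
next
  case (Suc t)
  have S: "S \<subseteq> carrier R" using Suc.prems(1) M_sub by auto
  have id: "ideal (Idl S) R" by (rule genideal_ideal[OF S])
  obtain y where y: "y \<in> M" and ny: "nzd_mod R (Idl S) y" and dy: "depth_ge R M t (insert y S)"
    using Suc.prems(2) by auto
  have yc: "y \<in> carrier R" using y M_sub by auto
  obtain a where pp: "primeideal p R" and a: "a \<in> carrier R" "a \<notin> Idl S" "p = colon R (Idl S) a"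
    using Suc.prems(3) by (auto simp: assoc_primes_def)
  have pc: "p \<subseteq> carrier R" using a(3) by (auto simp: colon_def)
  define N where "N = {n \<in> carrier R. \<forall>r\<in>p. r \<otimes> n \<in> Idl S}"
  have aN: "a \<in> N" using a pc by (auto simp: N_def colon_def m_comm)
  \<comment> \<open>Otherwise each element of \<open>N\<close> is \<open>y\<close> times an element of \<open>N\<close>, modulo \<open>S\<close>. In place of
    Nakayama's lemma, take \<open>n\<close> that generates a maximal ideal \<open>(S, n)\<close>: then \<open>n = k y\<close> modulo \<open>S\<close>, and
    maximality makes \<open>k\<close> a multiple of \<open>n\<close>, so that \<open>1 - c y\<close> kills \<open>k\<close>.\<close>
  have "\<exists>n\<in>N. n \<notin> Idl (insert y S)"
  proof (rule ccontr)
    assume neg: "\<not> (\<exists>n\<in>N. n \<notin> Idl (insert y S))"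
    define A where "A = {n \<in> N. n \<notin> Idl S}"
    have "\<exists>n\<in>A. \<forall>k\<in>A. Idl (insert n S) \<subseteq> Idl (insert k S) \<longrightarrow> Idl (insert k S) = Idl (insert n S)"
    proof (rule exists_maximal_ideal_in_family)
      show "A \<noteq> {}" using aN a(2) unfolding A_def by blast
      show "ideal (Idl (insert n S)) R" if "n \<in> A" for n
        using that S by (intro genideal_ideal) (auto simp: A_def N_def)
    qed
    then obtain n where "n \<in> A"
      and maxA: "\<forall>k\<in>A. Idl (insert n S) \<subseteq> Idl (insert k S) \<longrightarrow> Idl (insert k S) = Idl (insert n S)"
      by (rule bexE)
    then have n: "n \<in> N" "n \<notin> Idl S" by (simp_all add: A_def)
    have max: "Idl (insert k S) = Idl (insert n S)"
      if "k \<in> N" "k \<notin> Idl S" "Idl (insert n S) \<subseteq> Idl (insert k S)" for k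
      using maxA[rule_format, of k] that by (simp add: A_def)
    have nc: "n \<in> carrier R" using n by (auto simp: N_def)
    have "n \<in> Idl (insert y S)" using neg n by auto
    then obtain i k where ik: "i \<in> Idl S" "k \<in> carrier R" "n = i \<oplus> k \<otimes> y"
      using Idl_insert_iff[OF S yc] by auto
    have ic: "i \<in> carrier R" using ideal_simps(1)[OF id ik(1)] .
    have kN: "k \<in> N"
    proof -
      have "r \<otimes> k \<in> Idl S" if r: "r \<in> p" for r
      proof -
        have rc: "r \<in> carrier R" using r pc by auto
        have "r \<otimes> (i \<oplus> k \<otimes> y) \<in> Idl S" using r n(1) ik(3) by (auto simp: N_def)
        moreover have "r \<otimes> (i \<oplus> k \<otimes> y) = y \<otimes> (r \<otimes> k) \<oplus> r \<otimes> i" using rc ic ik(2) yc by algebra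
        ultimately have "y \<otimes> (r \<otimes> k) \<in> Idl S"
          using ideal_diff_mem[OF id, of "y \<otimes> (r \<otimes> k)" "r \<otimes> i"] ideal_simps(4)[OF id ik(1) rc] yc rc ik(2) by auto
        then show ?thesis using nzd_modD[OF ny] rc ik(2) by auto
      qed
      then show ?thesis using ik(2) by (auto simp: N_def)
    qed
    have kS: "k \<notin> Idl S"
    proof
      assume "k \<in> Idl S"
      then have "n \<in> Idl S" using ik ideal_simps(2,5)[OF id] yc by auto
      then show False using n by simp
    qed
    have sub: "Idl (insert n S) \<subseteq> Idl (insert k S)"
    proof (rule genideal_minimal)
      show idk: "ideal (Idl (insert k S)) R" using S ik(2) by (intro genideal_ideal) auto
      have self: "insert k S \<subseteq> Idl (insert k S)" using S ik(2) by (intro genideal_self) auto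
      have "n \<in> Idl (insert k S)"
        using Idl_insert_iff[OF S ik(2), of n] ik(1) yc ik(3) m_comm[OF ik(2) yc] by auto
      then show "insert n S \<subseteq> Idl (insert k S)" using self by auto
    qed
    have "k \<in> Idl (insert n S)"
      using max[OF kN kS sub] genideal_self[of "insert k S"] S ik(2) by auto
    then obtain j c where jc: "j \<in> Idl S" "c \<in> carrier R" "k = j \<oplus> c \<otimes> n"
      using Idl_insert_iff[OF S nc] by auto
    have jcc: "j \<in> carrier R" using ideal_simps(1)[OF id jc(1)] .
    have "(\<one> \<ominus> c \<otimes> y) \<otimes> k = k \<ominus> c \<otimes> (k \<otimes> y)" using jc(2) yc ik(2) by algebra
    also have "k \<otimes> y = n \<ominus> i" using ik(2,3) yc ic by algebra
    also have "k \<ominus> c \<otimes> (n \<ominus> i) = j \<oplus> c \<otimes> i"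
      using jc(3) jc(2) nc ic jcc by algebra
    also have "\<dots> \<in> Idl S" using ideal_simps(2,4)[OF id] jc ik by auto
    finally have mem: "(\<one> \<ominus> c \<otimes> y) \<otimes> k \<in> Idl S" .
    have "c \<otimes> y \<in> M" using ideal_simps(4)[OF M_ideal y jc(2)] .
    then have "k \<in> Idl S" using ideal_cancel_unit[OF id one_minus_unit ik(2) mem] by auto
    then show False using kS by simp
  qed
  then obtain n where n: "n \<in> N" "n \<notin> Idl (insert y S)" by auto
  have nc: "n \<in> carrier R" using n by (auto simp: N_def)
  have idy: "ideal (Idl (insert y S)) R" using S yc by (intro genideal_ideal) auto
  obtain q where q: "q \<in> assoc_primes R (Idl (insert y S))" "colon R (Idl (insert y S)) n \<subseteq> q"
    using exists_assoc_prime_above_colon[OF idy nc n(2)] by auto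
  have sub: "Idl S \<subseteq> Idl (insert y S)" using S yc by (intro subset_Idl_subset) auto
  have "p \<subseteq> q"
  proof
    fix r assume r: "r \<in> p"
    then have "r \<otimes> n \<in> Idl (insert y S)" using n(1) sub by (auto simp: N_def)
    then have "r \<in> colon R (Idl (insert y S)) n" using r pc nc by (auto simp: colon_def m_comm)
    then show "r \<in> q" using q(2) by auto
  qed
  moreover have "y \<in> q"
  proof -
    have "y \<in> Idl (insert y S)" using genideal_self[of "insert y S"] S yc by auto
    then have "n \<otimes> y \<in> Idl (insert y S)" using ideal_simps(4)[OF idy] nc by auto
    then show ?thesis using q(2) yc by (auto simp: colon_def)
  qed
  moreover have "y \<notin> p"
  proof
    assume "y \<in> p"
    then have "y \<otimes> a \<in> Idl S" using a yc by (auto simp: colon_def m_comm)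
    then show False using nzd_modD[OF ny a(1)] a(2) by simp
  qed
  moreover have "prime_chain_above R q t"
    by (rule Suc.IH[OF _ dy q(1)]) (use y Suc.prems in auto)
  ultimately show ?case using pp by auto
qed

end

section \<open>Unmixedness in Cohen-Macaulay local rings\<close>

locale cohen_macaulay_local_ring = noetherian_local_ring +
  assumes depth_eq_dim: "depth M R = krull_dim R"
begin

text \<open>The depth is finite, and therefore it is attained and the dimension is finite as well.\<close>

lemma exists_depth_ge_krull_dim:
  obtains d where "depth_ge R M d {}" "krull_dim R = enat d"
proof -
  define L where "L = {enat (length xs) |xs. set xs \<subseteq> M \<and> regular_sequence R xs}"
  have dep: "depth_ge R M (length xs) {}" if "set xs \<subseteq> M" "regular_sequence R xs" for xs
    using that M_sub regular_sequence_iff[of xs] depth_ge_of_weakly_regular[of xs] by auto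
  obtain t where t: "\<not> depth_ge R M t {}" using exists_depth_bound by auto
  have mono: "depth_ge R M s S" if "depth_ge R M s' S" "s \<le> s'" for s s' S
    using that
  proof (induction s arbitrary: s' S)
    case (Suc s)
    then obtain s'' where "s' = Suc s''" by (cases s') auto
    then show ?case using Suc by auto
  qed simp
  have "L \<subseteq> enat ` {..<t}"
  proof
    fix l assume "l \<in> L"
    then obtain xs where xs: "l = enat (length xs)" "set xs \<subseteq> M" "regular_sequence R xs" by (auto simp: L_def)
    have "length xs < t" using mono[OF dep[OF xs(2,3)], of t] t by (meson not_le)
    then show "l \<in> enat ` {..<t}" using xs(1) by auto
  qed
  then have fin: "finite L" using finite_subset by blast
  have "Idl {} \<noteq> carrier R"
    using genideal_minimal[OF M_ideal, of "{}"] M_proper by auto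
  then have "regular_sequence R []" using regular_sequence_iff[of "[]"] by (auto simp: weakly_regular_def)
  then have ne: "L \<noteq> {}" unfolding L_def by (auto intro!: exI[of _ "[]"])
  have "Sup L \<in> L" using fin ne by (simp add: Sup_enat_def Max_in)
  then obtain xs where "Sup L = enat (length xs)" "set xs \<subseteq> M" "regular_sequence R xs" unfolding L_def by auto
  then show ?thesis using that[of "length xs"] dep depth_eq_dim by (auto simp: depth_def L_def)
qed

theorem assoc_prime_weakly_regular_minimal:
  assumes "set xs \<subseteq> M" "weakly_regular R xs" "p \<in> assoc_primes R (Idl (set xs))"
    and "primeideal q R" "Idl (set xs) \<subseteq> q" "q \<subseteq> p"
  shows "q = p"
proof (rule ccontr)
  assume ne: "q \<noteq> p"
  obtain d where d: "depth_ge R M d {}" "krull_dim R = enat d" using exists_depth_ge_krull_dim by auto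
  have xc: "set xs \<subseteq> carrier R" using assms(1) M_sub by auto
  have "prime_chain_above R p (d - length xs)"
    by (rule prime_chain_above_assoc_prime[OF assms(1) depth_ge_weakly_regular[OF assms(1,2) d(1)] assms(3)])
  then have "prime_chain_above R q (Suc (d - length xs))" using assms(4,6) ne by auto
  moreover have "set xs \<subseteq> q" using assms(5) genideal_self[OF xc] by auto
  ultimately obtain q' where "prime_chain_above R q' (Suc (d - length xs) + length xs)"
    using weakly_regular_extends_prime_chain[OF xc assms(2)] by blast
  then have "enat (Suc (d - length xs) + length xs) \<le> enat d" using prime_chain_above_le_krull_dim d(2) by metis
  then show False by simp
qed

end

section \<open>Modules and rings of fractions\<close>

locale module_of_fractions = module R M for R (structure) and M (structure) +
  fixes S
  assumes S_sub: "S \<subseteq> carrier R" and one_S: "\<one> \<in> S"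
    and mult_S: "\<lbrakk>s \<in> S; t \<in> S\<rbrakk> \<Longrightarrow> s \<otimes> t \<in> S"
begin

lemma S_closed: "s \<in> S \<Longrightarrow> s \<in> carrier R"
  using S_sub by auto

text \<open>The denominators need only become invertible in the module of fractions, that is, divide elements
of \<open>S\<close>. This generality is what the maps between modules of fractions for different multiplicative
sets require.\<close>

lemma frac_subset:
  assumes mn: "m \<in> carrier M" "n \<in> carrier M"
    and st: "s \<in> carrier R" "t \<in> carrier R" "u \<in> carrier R"
    and div: "c \<in> carrier R" "c \<otimes> u \<in> S" "d \<in> carrier R" "d \<otimes> t \<in> S"
    and eq: "(u \<otimes> s) \<odot>\<^bsub>M\<^esub> n = (u \<otimes> t) \<odot>\<^bsub>M\<^esub> m"
  shows "frac R S M n t \<subseteq> frac R S M m s"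
proof
  fix x assume "x \<in> frac R S M n t"
  then obtain k w v where x: "x = (k, w)" and k: "k \<in> carrier M" "w \<in> S" "v \<in> S"
    and v: "(v \<otimes> t) \<odot>\<^bsub>M\<^esub> k = (v \<otimes> w) \<odot>\<^bsub>M\<^esub> n" by (auto simp: frac_def)
  note c = st div(1,3) S_closed[OF k(2)] S_closed[OF k(3)]
  define v' where "v' = v \<otimes> (c \<otimes> u) \<otimes> (d \<otimes> t)"
  have v': "v' \<in> S" unfolding v'_def using k div by (simp add: mult_S)
  have "(v' \<otimes> s) \<odot>\<^bsub>M\<^esub> k = ((c \<otimes> u \<otimes> s \<otimes> d) \<otimes> (v \<otimes> t)) \<odot>\<^bsub>M\<^esub> k"
    unfolding v'_def using c by (intro arg_cong2[where f = "(\<odot>\<^bsub>M\<^esub>)"]) (simp_all add: R.m_ac)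
  also have "\<dots> = (c \<otimes> u \<otimes> s \<otimes> d) \<odot>\<^bsub>M\<^esub> ((v \<otimes> w) \<odot>\<^bsub>M\<^esub> n)"
    using c k by (simp add: smult_assoc1 v[symmetric])
  also have "\<dots> = ((c \<otimes> d \<otimes> v \<otimes> w) \<otimes> (u \<otimes> s)) \<odot>\<^bsub>M\<^esub> n"
    using c mn by (subst smult_assoc1[symmetric]) (auto simp: R.m_ac)
  also have "\<dots> = (c \<otimes> d \<otimes> v \<otimes> w) \<odot>\<^bsub>M\<^esub> ((u \<otimes> t) \<odot>\<^bsub>M\<^esub> m)"
    using c mn by (simp add: smult_assoc1[of "c \<otimes> d \<otimes> v \<otimes> w" "u \<otimes> s"] eq)
  also have "\<dots> = (v' \<otimes> w) \<odot>\<^bsub>M\<^esub> m"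
    unfolding v'_def using c mn by (subst smult_assoc1[symmetric]) (auto simp: R.m_ac)
  finally show "x \<in> frac R S M m s" unfolding frac_def x using k v' by auto
qed

lemma frac_eqI':
  assumes "m \<in> carrier M" "n \<in> carrier M" "s \<in> carrier R" "t \<in> carrier R" "u \<in> carrier R"
    and "c \<in> carrier R" "c \<otimes> u \<in> S" "d \<in> carrier R" "d \<otimes> t \<in> S" "e \<in> carrier R" "e \<otimes> s \<in> S"
    and "(u \<otimes> s) \<odot>\<^bsub>M\<^esub> n = (u \<otimes> t) \<odot>\<^bsub>M\<^esub> m"
  shows "frac R S M m s = frac R S M n t"
  using frac_subset[of m n s t u c d] frac_subset[of n m t s u c e] assms by auto

lemma frac_eqI:
  assumes "m \<in> carrier M" "n \<in> carrier M" "s \<in> S" "t \<in> S" "u \<in> S"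
    and "(u \<otimes> s) \<odot>\<^bsub>M\<^esub> n = (u \<otimes> t) \<odot>\<^bsub>M\<^esub> m"
  shows "frac R S M m s = frac R S M n t"
  using assms S_closed by (intro frac_eqI'[of m n s t u \<one> \<one> \<one>]) auto

lemma frac_self: "m \<in> carrier M \<Longrightarrow> s \<in> S \<Longrightarrow> (m, s) \<in> frac R S M m s"
  unfolding frac_def using one_S by auto

lemma frac_eqD:
  assumes "m \<in> carrier M" "s \<in> S" "frac R S M m s = frac R S M n t"
  shows "\<exists>u\<in>S. (u \<otimes> t) \<odot>\<^bsub>M\<^esub> m = (u \<otimes> s) \<odot>\<^bsub>M\<^esub> n"
  using frac_self[OF assms(1,2)] unfolding assms(3) by (auto simp: frac_def)

text \<open>An operation on fractions that is defined as a union over all representatives can be computed from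
any one of them, provided that it does not depend on the choice.\<close>

lemma UN_frac:
  assumes "m \<in> carrier M" "s \<in> S"
    and "\<And>n t u. n \<in> carrier M \<Longrightarrow> t \<in> S \<Longrightarrow> u \<in> S \<Longrightarrow>
      (u \<otimes> s) \<odot>\<^bsub>M\<^esub> n = (u \<otimes> t) \<odot>\<^bsub>M\<^esub> m \<Longrightarrow> F n t = F m s"
  shows "(\<Union>(n, t)\<in>frac R S M m s. F n t) = F m s"
proof -
  have "F n t = F m s" if "(n, t) \<in> frac R S M m s" for n t
    using that assms(3)[of n t] by (auto simp: frac_def)
  then have "(\<Union>x\<in>frac R S M m s. case x of (n, t) \<Rightarrow> F n t) = (\<Union>x\<in>frac R S M m s. F m s)"
    by (intro SUP_cong) auto
  also have "\<dots> = F m s" using frac_self[OF assms(1,2)] by blast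
  finally show ?thesis .
qed

lemma UN_frac2:
  assumes m: "m \<in> carrier M" "s \<in> S" and n: "n \<in> carrier M" "t \<in> S"
    and left: "\<And>m' s' n t u. m' \<in> carrier M \<Longrightarrow> s' \<in> S \<Longrightarrow> n \<in> carrier M \<Longrightarrow> t \<in> S \<Longrightarrow> u \<in> S \<Longrightarrow>
      (u \<otimes> s) \<odot>\<^bsub>M\<^esub> m' = (u \<otimes> s') \<odot>\<^bsub>M\<^esub> m \<Longrightarrow> F m' s' n t = F m s n t"
    and right: "\<And>n' t' u. n' \<in> carrier M \<Longrightarrow> t' \<in> S \<Longrightarrow> u \<in> S \<Longrightarrow>
      (u \<otimes> t) \<odot>\<^bsub>M\<^esub> n' = (u \<otimes> t') \<odot>\<^bsub>M\<^esub> n \<Longrightarrow> F m s n' t' = F m s n t"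
  shows "(\<Union>(m', s')\<in>frac R S M m s. \<Union>(n', t')\<in>frac R S M n t. F m' s' n' t') = F m s n t"
proof -
  have inner: "(\<Union>(n', t')\<in>frac R S M n t. F m s n' t') = F m s n t"
    by (rule UN_frac[OF n]) (rule right)
  have "(\<Union>(m', s')\<in>frac R S M m s. \<Union>(n', t')\<in>frac R S M n t. F m' s' n' t') =
      (\<Union>(n', t')\<in>frac R S M n t. F m s n' t')"
  proof (rule UN_frac[OF m])
    fix m' s' u assume *: "m' \<in> carrier M" "s' \<in> S" "u \<in> S" "(u \<otimes> s) \<odot>\<^bsub>M\<^esub> m' = (u \<otimes> s') \<odot>\<^bsub>M\<^esub> m"
    have "F m' s' n' t' = F m s n' t'" if "(n', t') \<in> frac R S M n t" for n' t'
      by (rule left[OF *(1,2) _ _ *(3,4)]) (use that in \<open>simp_all add: frac_def\<close>)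
    then show "(\<Union>(n', t')\<in>frac R S M n t. F m' s' n' t') = (\<Union>(n', t')\<in>frac R S M n t. F m s n' t')"
      by (intro SUP_cong refl) auto
  qed
  then show ?thesis using inner by simp
qed

abbreviation "fractions \<equiv> loc_module R S M"

lemma fractions_carrier:
  "X \<in> carrier fractions \<longleftrightarrow> (\<exists>m\<in>carrier M. \<exists>s\<in>S. X = frac R S M m s)"
  by (auto simp: loc_module_def)

lemma fractions_zero: "\<zero>\<^bsub>fractions\<^esub> = frac R S M \<zero>\<^bsub>M\<^esub> \<one>"
  by (simp add: loc_module_def)

lemma frac_zero: "s \<in> S \<Longrightarrow> frac R S M \<zero>\<^bsub>M\<^esub> s = \<zero>\<^bsub>fractions\<^esub>"
  unfolding fractions_zero by (rule frac_eqI[of _ _ _ _ \<one>]) (use one_S S_closed in auto)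

lemma fractions_smult:
  assumes "r \<in> carrier R" "m \<in> carrier M" "s \<in> S"
  shows "r \<odot>\<^bsub>fractions\<^esub> frac R S M m s = frac R S M (r \<odot>\<^bsub>M\<^esub> m) s"
proof -
  have "(\<Union>(m, s)\<in>frac R S M m s. frac R S M (r \<odot>\<^bsub>M\<^esub> m) s) = frac R S M (r \<odot>\<^bsub>M\<^esub> m) s"
  proof (rule UN_frac[OF assms(2,3)])
    fix n t u assume *: "n \<in> carrier M" "t \<in> S" "u \<in> S" "(u \<otimes> s) \<odot>\<^bsub>M\<^esub> n = (u \<otimes> t) \<odot>\<^bsub>M\<^esub> m"
    note c = S_closed[OF *(2)] S_closed[OF *(3)] S_closed[OF assms(3)] assms(1)
    have "(u \<otimes> t) \<odot>\<^bsub>M\<^esub> (r \<odot>\<^bsub>M\<^esub> m) = r \<odot>\<^bsub>M\<^esub> ((u \<otimes> t) \<odot>\<^bsub>M\<^esub> m)"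
      using c assms(2) by (simp flip: smult_assoc1 add: R.m_ac)
    also have "\<dots> = (u \<otimes> s) \<odot>\<^bsub>M\<^esub> (r \<odot>\<^bsub>M\<^esub> n)"
      unfolding *(4)[symmetric] using c *(1) by (simp flip: smult_assoc1 add: R.m_ac)
    finally show "frac R S M (r \<odot>\<^bsub>M\<^esub> n) t = frac R S M (r \<odot>\<^bsub>M\<^esub> m) s"
      using * assms by (intro frac_eqI[of _ _ _ _ u]) auto
  qed
  then show ?thesis by (simp add: loc_module_def)
qed

lemma fractions_add:
  assumes m: "m \<in> carrier M" "s \<in> S" and n: "n \<in> carrier M" "t \<in> S"
  shows "frac R S M m s \<oplus>\<^bsub>fractions\<^esub> frac R S M n t =
    frac R S M (t \<odot>\<^bsub>M\<^esub> m \<oplus>\<^bsub>M\<^esub> s \<odot>\<^bsub>M\<^esub> n) (s \<otimes> t)"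
proof -
  let ?F = "\<lambda>m s n t. frac R S M (t \<odot>\<^bsub>M\<^esub> m \<oplus>\<^bsub>M\<^esub> s \<odot>\<^bsub>M\<^esub> n) (s \<otimes> t)"
  have left: "?F m' s' n t = ?F m s n t"
    if *: "m \<in> carrier M" "s \<in> S" "m' \<in> carrier M" "s' \<in> S" "n \<in> carrier M" "t \<in> S" "u \<in> S"
      "(u \<otimes> s) \<odot>\<^bsub>M\<^esub> m' = (u \<otimes> s') \<odot>\<^bsub>M\<^esub> m" for m s m' s' n t u
  proof -
    note c = S_closed[OF *(2)] S_closed[OF *(4)] S_closed[OF *(6)] S_closed[OF *(7)]
    have "(u \<otimes> (s' \<otimes> t)) \<odot>\<^bsub>M\<^esub> (t \<odot>\<^bsub>M\<^esub> m \<oplus>\<^bsub>M\<^esub> s \<odot>\<^bsub>M\<^esub> n) =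
        (t \<otimes> t) \<odot>\<^bsub>M\<^esub> ((u \<otimes> s') \<odot>\<^bsub>M\<^esub> m) \<oplus>\<^bsub>M\<^esub> (u \<otimes> s' \<otimes> t \<otimes> s) \<odot>\<^bsub>M\<^esub> n"
      using c *(1,5) by (simp add: smult_r_distr flip: smult_assoc1) (simp add: R.m_ac)
    also have "\<dots> = (u \<otimes> (s \<otimes> t)) \<odot>\<^bsub>M\<^esub> (t \<odot>\<^bsub>M\<^esub> m' \<oplus>\<^bsub>M\<^esub> s' \<odot>\<^bsub>M\<^esub> n)"
      unfolding *(8)[symmetric]
      using c *(3,5) by (simp add: smult_r_distr flip: smult_assoc1) (simp add: R.m_ac)
    finally show ?thesis
      using * c by (intro frac_eqI[of _ _ _ _ u]) (auto intro: mult_S)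
  qed
  have swap: "?F m s n t = ?F n t m s" if "m \<in> carrier M" "s \<in> S" "n \<in> carrier M" "t \<in> S" for m s n t
    using that S_closed by (simp add: M.a_comm R.m_comm)
  have "(\<Union>(m, s)\<in>frac R S M m s. \<Union>(n, t)\<in>frac R S M n t. ?F m s n t) = ?F m s n t"
  proof (rule UN_frac2[OF m n])
    fix n' t' u assume *: "n' \<in> carrier M" "t' \<in> S" "u \<in> S" "(u \<otimes> t) \<odot>\<^bsub>M\<^esub> n' = (u \<otimes> t') \<odot>\<^bsub>M\<^esub> n"
    show "?F m s n' t' = ?F m s n t"
      using left[OF n *(1,2) m *(3,4)] swap[OF m *(1,2)] swap[OF m n] by simp
  qed (rule left[OF m])
  then show ?thesis by (simp add: loc_module_def)
qed

lemma fractions_add_same: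
  assumes "m \<in> carrier M" "n \<in> carrier M" "s \<in> S"
  shows "frac R S M m s \<oplus>\<^bsub>fractions\<^esub> frac R S M n s = frac R S M (m \<oplus>\<^bsub>M\<^esub> n) s"
proof -
  note c = S_closed[OF assms(3)]
  have "frac R S M (s \<odot>\<^bsub>M\<^esub> m \<oplus>\<^bsub>M\<^esub> s \<odot>\<^bsub>M\<^esub> n) (s \<otimes> s) = frac R S M (m \<oplus>\<^bsub>M\<^esub> n) s"
    by (rule frac_eqI[of _ _ _ _ \<one>])
       (use assms c one_S in \<open>auto intro: mult_S simp: smult_r_distr smult_assoc1\<close>)
  then show ?thesis using fractions_add[OF assms(1,3,2,3)] by simp
qed

lemma fracI: "m \<in> carrier M \<Longrightarrow> s \<in> S \<Longrightarrow> frac R S M m s \<in> carrier fractions"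
  unfolding fractions_carrier by blast

lemma frac_expand:
  assumes "m \<in> carrier M" "s \<in> S" "t \<in> S"
  shows "frac R S M m s = frac R S M (t \<odot>\<^bsub>M\<^esub> m) (t \<otimes> s)"
  using assms S_closed one_S
  by (intro frac_eqI[of _ _ _ _ \<one>]) (auto intro: mult_S simp: R.m_comm smult_assoc1[symmetric])

lemma common_denominator3:
  assumes "X \<in> carrier fractions" "Y \<in> carrier fractions" "Z \<in> carrier fractions"
  obtains m n k s where "m \<in> carrier M" "n \<in> carrier M" "k \<in> carrier M" "s \<in> S"
    "X = frac R S M m s" "Y = frac R S M n s" "Z = frac R S M k s"
proof -
  obtain m s where X: "m \<in> carrier M" "s \<in> S" "X = frac R S M m s" using assms(1) by (auto simp: fractions_carrier)
  obtain n t where Y: "n \<in> carrier M" "t \<in> S" "Y = frac R S M n t" using assms(2) by (auto simp: fractions_carrier)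
  obtain k u where Z: "k \<in> carrier M" "u \<in> S" "Z = frac R S M k u" using assms(3) by (auto simp: fractions_carrier)
  note c = S_closed[OF X(2)] S_closed[OF Y(2)] S_closed[OF Z(2)]
  have eq: "(t \<otimes> u) \<otimes> s = s \<otimes> t \<otimes> u" "(s \<otimes> u) \<otimes> t = s \<otimes> t \<otimes> u" using c by (simp_all add: R.m_ac)
  have "X = frac R S M ((t \<otimes> u) \<odot>\<^bsub>M\<^esub> m) (s \<otimes> t \<otimes> u)"
    using frac_expand[OF X(1,2) mult_S[OF Y(2) Z(2)]] X(3) eq(1) by simp
  moreover have "Y = frac R S M ((s \<otimes> u) \<odot>\<^bsub>M\<^esub> n) (s \<otimes> t \<otimes> u)"
    using frac_expand[OF Y(1,2) mult_S[OF X(2) Z(2)]] Y(3) eq(2) by simp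
  moreover have "Z = frac R S M ((s \<otimes> t) \<odot>\<^bsub>M\<^esub> k) (s \<otimes> t \<otimes> u)"
    using frac_expand[OF Z(1,2) mult_S[OF X(2) Y(2)]] Z(3) by simp
  ultimately show ?thesis
    by (intro that[of "(t \<otimes> u) \<odot>\<^bsub>M\<^esub> m" "(s \<otimes> u) \<odot>\<^bsub>M\<^esub> n" "(s \<otimes> t) \<odot>\<^bsub>M\<^esub> k" "s \<otimes> t \<otimes> u"])
      (use X Y Z c mult_S in simp_all)
qed

lemma common_denominator:
  assumes "X \<in> carrier fractions" "Y \<in> carrier fractions"
  obtains m n s where "m \<in> carrier M" "n \<in> carrier M" "s \<in> S"
    "X = frac R S M m s" "Y = frac R S M n s"
  using common_denominator3[OF assms assms(1)] .

lemma fractions_module: "module R fractions"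
proof (rule moduleI[OF R.is_cring])
  show "abelian_group fractions"
  proof (rule abelian_groupI)
    fix X Y assume X: "X \<in> carrier fractions" and Y: "Y \<in> carrier fractions"
    obtain m n s where *: "m \<in> carrier M" "n \<in> carrier M" "s \<in> S"
      "X = frac R S M m s" "Y = frac R S M n s" using common_denominator[OF X Y] .
    show "X \<oplus>\<^bsub>fractions\<^esub> Y \<in> carrier fractions" using * by (simp add: fractions_add_same fracI)
    show "X \<oplus>\<^bsub>fractions\<^esub> Y = Y \<oplus>\<^bsub>fractions\<^esub> X" using * by (simp add: fractions_add_same M.a_comm)
    fix Z assume Z: "Z \<in> carrier fractions"
    obtain m n k s where *: "m \<in> carrier M" "n \<in> carrier M" "k \<in> carrier M" "s \<in> S"
      "X = frac R S M m s" "Y = frac R S M n s" "Z = frac R S M k s"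
      using common_denominator3[OF X Y Z] .
    show "X \<oplus>\<^bsub>fractions\<^esub> Y \<oplus>\<^bsub>fractions\<^esub> Z = X \<oplus>\<^bsub>fractions\<^esub> (Y \<oplus>\<^bsub>fractions\<^esub> Z)"
      using * by (simp add: fractions_add_same M.a_assoc)
  next
    show "\<zero>\<^bsub>fractions\<^esub> \<in> carrier fractions" unfolding fractions_zero using one_S by (intro fracI) auto
    fix X assume "X \<in> carrier fractions"
    then obtain m s where *: "m \<in> carrier M" "s \<in> S" "X = frac R S M m s" by (auto simp: fractions_carrier)
    show "\<zero>\<^bsub>fractions\<^esub> \<oplus>\<^bsub>fractions\<^esub> X = X" unfolding frac_zero[OF *(2), symmetric] *(3)
      using * by (simp add: fractions_add_same)
    have "frac R S M (\<ominus>\<^bsub>M\<^esub> m) s \<oplus>\<^bsub>fractions\<^esub> X = \<zero>\<^bsub>fractions\<^esub>"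
      unfolding *(3) using * by (simp add: fractions_add_same M.l_neg frac_zero)
    then show "\<exists>Y\<in>carrier fractions. Y \<oplus>\<^bsub>fractions\<^esub> X = \<zero>\<^bsub>fractions\<^esub>"
      using * by (intro bexI[of _ "frac R S M (\<ominus>\<^bsub>M\<^esub> m) s"]) (auto intro: fracI)
  qed
next
  fix a b X assume a: "a \<in> carrier R" and X: "X \<in> carrier fractions"
  then obtain m s where *: "m \<in> carrier M" "s \<in> S" "X = frac R S M m s" by (auto simp: fractions_carrier)
  show "a \<odot>\<^bsub>fractions\<^esub> X \<in> carrier fractions" using a * by (simp add: fractions_smult fracI)
  assume b: "b \<in> carrier R"
  show "(a \<oplus> b) \<odot>\<^bsub>fractions\<^esub> X = a \<odot>\<^bsub>fractions\<^esub> X \<oplus>\<^bsub>fractions\<^esub> b \<odot>\<^bsub>fractions\<^esub> X"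
    using a b * by (simp add: fractions_smult fractions_add_same smult_l_distr)
  show "(a \<otimes> b) \<odot>\<^bsub>fractions\<^esub> X = a \<odot>\<^bsub>fractions\<^esub> (b \<odot>\<^bsub>fractions\<^esub> X)"
    using a b * by (simp add: fractions_smult smult_assoc1)
next
  fix a X Y assume a: "a \<in> carrier R" and X: "X \<in> carrier fractions" "Y \<in> carrier fractions"
  obtain m n s where *: "m \<in> carrier M" "n \<in> carrier M" "s \<in> S"
    "X = frac R S M m s" "Y = frac R S M n s" using common_denominator[OF X] .
  show "a \<odot>\<^bsub>fractions\<^esub> (X \<oplus>\<^bsub>fractions\<^esub> Y) = a \<odot>\<^bsub>fractions\<^esub> X \<oplus>\<^bsub>fractions\<^esub> a \<odot>\<^bsub>fractions\<^esub> Y"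
    using a * by (simp add: fractions_smult fractions_add_same smult_r_distr)
next
  fix X assume "X \<in> carrier fractions"
  then obtain m s where *: "m \<in> carrier M" "s \<in> S" "X = frac R S M m s" by (auto simp: fractions_carrier)
  show "\<one> \<odot>\<^bsub>fractions\<^esub> X = X" using * by (simp add: fractions_smult)
qed

end

lemma self_module_simps [simp]:
  "carrier (self_module R) = carrier R" "\<zero>\<^bsub>self_module R\<^esub> = \<zero>\<^bsub>R\<^esub>"
  "x \<oplus>\<^bsub>self_module R\<^esub> y = x \<oplus>\<^bsub>R\<^esub> y" "x \<odot>\<^bsub>self_module R\<^esub> y = x \<otimes>\<^bsub>R\<^esub> y"
  by (simp_all add: self_module_def)

lemma (in cring) self_module_is_module: "module R (self_module R)"
proof (rule moduleI[OF is_cring])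
  show "abelian_group (self_module R)"
    by (rule abelian_groupI) (auto simp: a_ac intro: l_neg)
qed (auto simp: l_distr r_distr m_assoc)

text \<open>The localization is used only through these properties, which determine it up to isomorphism.\<close>

locale ring_localization = R: cring R + L: cring L
  for R :: "('a, 'm) ring_scheme" (structure) and L :: "('b, 'n) ring_scheme" +
  fixes S h
  assumes S_sub: "S \<subseteq> carrier R" and one_S: "\<one> \<in> S"
    and mult_S: "\<lbrakk>s \<in> S; t \<in> S\<rbrakk> \<Longrightarrow> s \<otimes> t \<in> S"
    and hom: "h \<in> ring_hom R L"
    and unit: "s \<in> S \<Longrightarrow> h s \<in> Units L"
    and surj: "l \<in> carrier L \<Longrightarrow> \<exists>a\<in>carrier R. \<exists>s\<in>S. l \<otimes>\<^bsub>L\<^esub> h s = h a"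
    and eqD: "\<lbrakk>a \<in> carrier R; b \<in> carrier R; h a = h b\<rbrakk> \<Longrightarrow> \<exists>u\<in>S. u \<otimes> a = u \<otimes> b"

theorem (in cring) loc_ring_is_localization:
  assumes L: "cring (loc_ring R S)"
    and S: "S \<subseteq> carrier R" "\<one> \<in> S" "\<And>s t. s \<in> S \<Longrightarrow> t \<in> S \<Longrightarrow> s \<otimes> t \<in> S"
  shows "ring_localization R (loc_ring R S) S (\<lambda>a. frac R S (self_module R) a \<one>)"
proof -
  interpret module R "self_module R" by (rule self_module_is_module)
  interpret F: module_of_fractions R "self_module R" S
    by (unfold_locales) (use S in auto)
  let ?L = "loc_ring R S" and ?f = "frac R S (self_module R)"
  interpret L: cring ?L by fact
  have add: "?f a s \<oplus>\<^bsub>?L\<^esub> ?f b t = ?f (t \<otimes> a \<oplus> s \<otimes> b) (s \<otimes> t)"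
    if "a \<in> carrier R" "s \<in> S" "b \<in> carrier R" "t \<in> S" for a b s t
    using F.fractions_add[of a s b t] that by (simp add: loc_module_def loc_ring_def)
  have mult: "?f a s \<otimes>\<^bsub>?L\<^esub> ?f b t = ?f (a \<otimes> b) (s \<otimes> t)"
    if ab: "a \<in> carrier R" "s \<in> S" "b \<in> carrier R" "t \<in> S" for a b s t
  proof -
    have left: "?f (a' \<otimes> b) (s' \<otimes> t) = ?f (a \<otimes> b) (s \<otimes> t)"
      if *: "a \<in> carrier R" "s \<in> S" "a' \<in> carrier R" "s' \<in> S" "b \<in> carrier R" "t \<in> S" "u \<in> S"
        "(u \<otimes> s) \<otimes> a' = (u \<otimes> s') \<otimes> a" for a s a' s' b t u
    proof -
      note c = F.S_closed[OF *(2)] F.S_closed[OF *(4)] F.S_closed[OF *(6)] F.S_closed[OF *(7)] *(1,3,5)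
      have "(u \<otimes> (s' \<otimes> t)) \<otimes> (a \<otimes> b) = t \<otimes> b \<otimes> (u \<otimes> s' \<otimes> a)" using c by (simp add: m_ac)
      also have "\<dots> = (u \<otimes> (s \<otimes> t)) \<otimes> (a' \<otimes> b)" unfolding *(8)[symmetric] using c by (simp add: m_ac)
      finally show ?thesis by (intro F.frac_eqI[of _ _ _ _ u]) (use * S in auto)
    qed
    have "(\<Union>(a, s)\<in>?f a s. \<Union>(b, t)\<in>?f b t. ?f (a \<otimes> b) (s \<otimes> t)) = ?f (a \<otimes> b) (s \<otimes> t)"
    proof (rule F.UN_frac2)
      fix b' t' u assume *: "b' \<in> carrier (self_module R)" "t' \<in> S" "u \<in> S"
        "(u \<otimes> t) \<odot>\<^bsub>self_module R\<^esub> b' = (u \<otimes> t') \<odot>\<^bsub>self_module R\<^esub> b"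
      have "?f (b' \<otimes> a) (t' \<otimes> s) = ?f (b \<otimes> a) (t \<otimes> s)"
        by (rule left[OF ab(3,4) _ *(2) ab(1,2) *(3)]) (use * in simp_all)
      then show "?f (a \<otimes> b') (s \<otimes> t') = ?f (a \<otimes> b) (s \<otimes> t)"
        using ab * F.S_closed by (simp add: m_comm)
    next
      fix a' s' b t u assume "a' \<in> carrier (self_module R)" "s' \<in> S" "b \<in> carrier (self_module R)" "t \<in> S"
        "u \<in> S" "(u \<otimes> s) \<odot>\<^bsub>self_module R\<^esub> a' = (u \<otimes> s') \<odot>\<^bsub>self_module R\<^esub> a"
      then show "?f (a' \<otimes> b) (s' \<otimes> t) = ?f (a \<otimes> b) (s \<otimes> t)" using left[OF ab(1,2)] by simp
    qed (use ab in simp_all)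
    then show ?thesis by (simp add: loc_ring_def)
  qed
  have one: "\<one>\<^bsub>?L\<^esub> = ?f \<one> \<one>" by (simp add: loc_ring_def)
  have car: "X \<in> carrier ?L \<longleftrightarrow> (\<exists>a\<in>carrier R. \<exists>s\<in>S. X = ?f a s)" for X by (auto simp: loc_ring_def)
  show ?thesis
  proof (unfold_locales)
    show "(\<lambda>a. ?f a \<one>) \<in> ring_hom R ?L"
      by (rule ring_hom_memI) (use S add mult one car in auto)
    show "?f s \<one> \<in> Units ?L" if s: "s \<in> S" for s
    proof -
      have sc: "s \<in> carrier R" using s S by auto
      have "?f s \<one> \<otimes>\<^bsub>?L\<^esub> ?f \<one> s = ?f s s" using mult[of s \<one> \<one> s] s sc S by simp
      also have "\<dots> = \<one>\<^bsub>?L\<^esub>" unfolding one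
        by (rule F.frac_eqI[of _ _ _ _ \<one>]) (use s sc S in auto)
      finally have eq: "?f s \<one> \<otimes>\<^bsub>?L\<^esub> ?f \<one> s = \<one>\<^bsub>?L\<^esub>" .
      have c: "?f s \<one> \<in> carrier ?L" "?f \<one> s \<in> carrier ?L" using car s sc S by auto
      have "?f \<one> s \<otimes>\<^bsub>?L\<^esub> ?f s \<one> = \<one>\<^bsub>?L\<^esub>" using eq L.m_comm[OF c] by simp
      then show ?thesis using eq c unfolding Units_def by blast
    qed
    show "\<exists>a\<in>carrier R. \<exists>s\<in>S. l \<otimes>\<^bsub>?L\<^esub> ?f s \<one> = ?f a \<one>" if l: "l \<in> carrier ?L" for l
    proof -
      obtain a s where *: "a \<in> carrier R" "s \<in> S" "l = ?f a s" using l unfolding car by blast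
      have sc: "s \<in> carrier R" using * S by auto
      have "l \<otimes>\<^bsub>?L\<^esub> ?f s \<one> = ?f (a \<otimes> s) s" using mult[of a s s \<one>] * sc S by simp
      also have "\<dots> = ?f a \<one>"
        by (rule F.frac_eqI[of _ _ _ _ \<one>]) (use * sc S in \<open>auto simp: m_comm\<close>)
      finally show ?thesis using * by blast
    qed
    show "\<exists>u\<in>S. u \<otimes> a = u \<otimes> b" if ab: "a \<in> carrier R" "b \<in> carrier R" "?f a \<one> = ?f b \<one>" for a b
    proof -
      obtain u where "u \<in> S" "(u \<otimes> \<one>) \<odot>\<^bsub>self_module R\<^esub> a = (u \<otimes> \<one>) \<odot>\<^bsub>self_module R\<^esub> b"
        using F.frac_eqD[of a \<one> b \<one>] ab S by auto
      then show ?thesis using F.S_closed by auto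
    qed
  qed (use S in auto)
qed

section \<open>The monomial condition\<close>

abbreviation prod_elts :: "('a, 'm) ring_scheme \<Rightarrow> 'a list \<Rightarrow> 'a" where
  "prod_elts R xs \<equiv> foldr (monoid.mult R) xs \<one>\<^bsub>R\<^esub>"

definition pow_set :: "('a, 'm) ring_scheme \<Rightarrow> nat \<Rightarrow> 'a list \<Rightarrow> 'a set" where
  "pow_set R n xs = (\<lambda>x. x [^]\<^bsub>R\<^esub> n) ` set xs"

text \<open>For some \<open>n\<close>, the fraction \<open>1/(x\<^sub>1 \<cdots> x\<^sub>l)\<^sup>n\<close> is not forced to vanish in the localization at \<open>p\<close> of
the top Cech cohomology, viewed as the direct limit of the \<open>R/(x\<^sub>1\<^sup>m, \<dots>, x\<^sub>l\<^sup>m)\<close> along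
multiplication by \<open>x\<^sub>1 \<cdots> x\<^sub>l\<close>.\<close>

definition monomial_condition :: "('a, 'm) ring_scheme \<Rightarrow> 'a list \<Rightarrow> 'a set \<Rightarrow> bool" where
  "monomial_condition R xs p \<longleftrightarrow> (\<exists>n. \<forall>k. \<forall>s\<in>carrier R - p.
     s \<otimes>\<^bsub>R\<^esub> prod_elts R xs [^]\<^bsub>R\<^esub> k \<notin> genideal R (pow_set R (n + k) xs))"

context cring begin

lemma prod_elts_closed: "set xs \<subseteq> carrier R \<Longrightarrow> prod_elts R xs \<in> carrier R"
  by (induction xs) auto

lemma prod_elts_snoc:
  assumes "set xs \<subseteq> carrier R" "x \<in> carrier R"
  shows "prod_elts R (xs @ [x]) = prod_elts R xs \<otimes> x"
  using assms
proof (induction xs)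
  case (Cons a xs)
  then show ?case using prod_elts_closed[of xs] by (simp add: m_assoc)
qed simp

lemma prod_elts_factor:
  assumes "set xs \<subseteq> carrier R" "x \<in> set xs"
  shows "\<exists>r\<in>carrier R. prod_elts R xs = r \<otimes> x"
  using assms
proof (induction xs)
  case (Cons a xs)
  have P: "prod_elts R xs \<in> carrier R" using Cons.prems prod_elts_closed by simp
  show ?case
  proof (cases "x = a")
    case True
    have "prod_elts R (a # xs) = prod_elts R xs \<otimes> x" using P Cons.prems True by (simp add: m_comm)
    then show ?thesis using P by blast
  next
    case False
    then obtain r where r: "r \<in> carrier R" "prod_elts R xs = r \<otimes> x" using Cons by auto
    have "prod_elts R (a # xs) = (a \<otimes> r) \<otimes> x" using r Cons.prems False by (auto simp: m_assoc)
    then show ?thesis using r Cons.prems by auto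
  qed
qed simp

lemma pow_set_closed: "set xs \<subseteq> carrier R \<Longrightarrow> pow_set R n xs \<subseteq> carrier R"
  by (auto simp: pow_set_def)

lemma prod_pow_mult_Idl_pow_set:
  assumes xs: "set xs \<subseteq> carrier R" and c: "c \<in> Idl (pow_set R n xs)"
  shows "prod_elts R xs [^] (k::nat) \<otimes> c \<in> Idl (pow_set R (n + k) xs)"
proof -
  let ?P = "prod_elts R xs [^] k" and ?K = "Idl (pow_set R (n + k) xs)"
  have P: "?P \<in> carrier R" using prod_elts_closed[OF xs] by simp
  have K: "ideal ?K R" by (rule genideal_ideal[OF pow_set_closed[OF xs]])
  have "pow_set R n xs \<subseteq> colon R ?K ?P"
  proof
    fix y assume "y \<in> pow_set R n xs"
    then obtain x where x: "x \<in> set xs" "y = x [^] n" by (auto simp: pow_set_def)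
    have xc: "x \<in> carrier R" using x xs by auto
    obtain r where r: "r \<in> carrier R" "prod_elts R xs = r \<otimes> x" using prod_elts_factor[OF xs x(1)] by auto
    have "?P \<otimes> y = r [^] k \<otimes> x [^] (n + k)"
      unfolding x(2) r(2) using r(1) xc by (simp add: nat_pow_distrib m_ac flip: nat_pow_mult)
    moreover have "x [^] (n + k) \<in> ?K"
      using genideal_self[OF pow_set_closed[OF xs, of "n + k"]] x(1) by (auto simp: pow_set_def)
    ultimately have "?P \<otimes> y \<in> ?K" using ideal_simps(4)[OF K] r(1) by simp
    then show "y \<in> colon R ?K ?P" using xc x(2) by (simp add: colon_def)
  qed
  from genideal_minimal[OF ideal_colon[OF K P] this] show ?thesis using c by (auto simp: colon_def)
qed

end

context cohen_macaulay_local_ring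
begin

text \<open>If \<open>x\<close> is a zero divisor modulo \<open>xs\<close>, it lies in an associated prime \<open>p\<close> of \<open>xs\<close>, which is minimal over
\<open>xs\<close>. The primes above the \<open>n\<close>-th powers of \<open>xs\<close> are the primes above \<open>xs\<close>, so \<open>x\<close> is nilpotent modulo
those powers locally at \<open>p\<close>, for every \<open>n\<close>. This defeats each \<open>n\<close> in the monomial condition at \<open>p\<close>.\<close>

theorem weakly_regular_of_monomial_condition:
  assumes "set xs \<subseteq> M"
    and "\<And>i p. i < length xs \<Longrightarrow> primeideal p R \<Longrightarrow> set (take (Suc i) xs) \<subseteq> p \<Longrightarrow>
      monomial_condition R (take (Suc i) xs) p"
  shows "weakly_regular R xs"
  using assms
proof (induction xs rule: rev_induct)
  case Nil
  then show ?case by (simp add: weakly_regular_def)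
next
  case (snoc x xs)
  have qr: "weakly_regular R xs"
  proof (rule snoc.IH)
    show "set xs \<subseteq> M" using snoc.prems(1) by simp
    fix i p assume *: "i < length xs" "primeideal p R" "set (take (Suc i) xs) \<subseteq> p"
    then show "monomial_condition R (take (Suc i) xs) p" using snoc.prems(2)[of i p] by simp
  qed
  have xs: "set xs \<subseteq> carrier R" and x: "x \<in> carrier R" using snoc.prems(1) M_sub by auto
  let ?I = "Idl (set xs)"
  have I: "ideal ?I R" by (rule genideal_ideal[OF xs])
  have "nzd_mod R ?I x"
  proof (rule nzd_modI, rule ccontr)
    fix b assume b: "b \<in> carrier R" "x \<otimes> b \<in> ?I" "b \<notin> ?I"
    obtain p where p: "p \<in> assoc_primes R ?I" "colon R ?I b \<subseteq> p"
      using exists_assoc_prime_above_colon[OF I b(1,3)] by auto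
    have pp: "primeideal p R" using p(1) by (simp add: assoc_primes_def)
    have idp: "ideal p R" by (rule primeideal.axioms(1)[OF pp])
    have Ip: "?I \<subseteq> p" using colon_super[OF I b(1)] p(2) by blast
    have xp: "x \<in> p" using b x p(2) by (auto simp: colon_def m_comm)
    have sub: "set (xs @ [x]) \<subseteq> p" using Ip xp genideal_self[OF xs] by auto
    have "monomial_condition R (xs @ [x]) p"
      using snoc.prems(2)[of "length xs" p] pp sub by simp
    then obtain n where n: "\<And>k s. s \<in> carrier R - p \<Longrightarrow>
        s \<otimes> prod_elts R (xs @ [x]) [^] k \<notin> Idl (pow_set R (n + k) (xs @ [x]))"
      unfolding monomial_condition_def by blast
    let ?J = "Idl (pow_set R n xs)"
    have J: "ideal ?J R" by (rule genideal_ideal[OF pow_set_closed[OF xs]])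
    have "\<exists>s k. s \<in> carrier R \<and> s \<notin> p \<and> s \<otimes> x [^] (k::nat) \<in> ?J"
    proof (rule ccontr)
      assume "\<not> ?thesis"
      then obtain q where q: "primeideal q R" "?J \<subseteq> q" "q \<subseteq> p" "x \<notin> q"
        using prime_below_avoiding_element[OF pp x J] by blast
      have "set xs \<subseteq> q"
      proof
        fix y assume y: "y \<in> set xs"
        then have "y [^] n \<in> q" using genideal_self[OF pow_set_closed[OF xs, of n]] q(2) by (auto simp: pow_set_def)
        then show "y \<in> q" using primeideal_pow[OF q(1)] y xs by auto
      qed
      then have "?I \<subseteq> q" by (rule genideal_minimal[OF primeideal.axioms(1)[OF q(1)]])
      then have "q = p"
        using assoc_prime_weakly_regular_minimal[OF _ qr p(1) q(1) _ q(3)] snoc.prems(1) by simp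
      then show False using xp q(4) by simp
    qed
    then obtain s k where s: "s \<in> carrier R" "s \<notin> p" "s \<otimes> x [^] (k::nat) \<in> ?J" by blast
    let ?P = "prod_elts R xs"
    have P: "?P \<in> carrier R" by (rule prod_elts_closed[OF xs])
    have "s \<otimes> prod_elts R (xs @ [x]) [^] k = ?P [^] k \<otimes> (s \<otimes> x [^] k)"
      unfolding prod_elts_snoc[OF xs x] using P x s(1) by (simp add: nat_pow_distrib m_ac)
    also have "\<dots> \<in> Idl (pow_set R (n + k) xs)" by (rule prod_pow_mult_Idl_pow_set[OF xs s(3)])
    also have "\<dots> \<subseteq> Idl (pow_set R (n + k) (xs @ [x]))"
      using pow_set_closed[of "xs @ [x]"] xs x by (intro subset_Idl_subset) (auto simp: pow_set_def)
    finally show False using n[of s k] s(1,2) by blast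
  qed
  then show ?case using qr by (simp add: weakly_regular_snoc)
qed

end

section \<open>Transfer of the monomial condition along homomorphisms\<close>

lemma hom_Idl:
  assumes "cring R" "cring S" "h \<in> ring_hom R S" "X \<subseteq> carrier R" "c \<in> genideal R X"
  shows "h c \<in> genideal S (h ` X)"
proof -
  interpret R: cring R by fact
  interpret S: cring S by fact
  interpret ring_hom_ring R S h
    by (rule ring_hom_ringI2[OF R.ring_axioms S.ring_axioms assms(3)])
  have hX: "h ` X \<subseteq> carrier S" using assms(4) by auto
  have "genideal R X \<subseteq> {r \<in> carrier R. h r \<in> genideal S (h ` X)}"
  proof (rule R.genideal_minimal)
    show "ideal {r \<in> carrier R. h r \<in> genideal S (h ` X)} R"
      by (rule ideal_vimage[OF S.genideal_ideal[OF hX]])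
    show "X \<subseteq> {r \<in> carrier R. h r \<in> genideal S (h ` X)}"
      using S.genideal_self[OF hX] assms(4) by auto
  qed
  then show ?thesis using assms(5) by auto
qed

lemma prime_contraction:
  assumes "cring R" "cring S" "h \<in> ring_hom R S" "primeideal q S"
  shows "primeideal {r \<in> carrier R. h r \<in> q} R"
proof -
  interpret R: cring R by fact
  interpret S: cring S by fact
  interpret ring_hom_ring R S h
    by (rule ring_hom_ringI2[OF R.ring_axioms S.ring_axioms assms(3)])
  show ?thesis
  proof (rule primeidealI[OF ideal_vimage[OF primeideal.axioms(1)[OF assms(4)]] assms(1)])
    have "\<one>\<^bsub>R\<^esub> \<notin> {r \<in> carrier R. h r \<in> q}" using S.primeideal_one_notin[OF assms(4)] by simp
    then show "carrier R \<noteq> {r \<in> carrier R. h r \<in> q}" using R.one_closed by metis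
    fix a b assume "a \<in> carrier R" "b \<in> carrier R" "a \<otimes>\<^bsub>R\<^esub> b \<in> {r \<in> carrier R. h r \<in> q}"
    then show "a \<in> {r \<in> carrier R. h r \<in> q} \<or> b \<in> {r \<in> carrier R. h r \<in> q}"
      using primeideal.I_prime[OF assms(4), of "h a" "h b"] by simp
  qed
qed

lemma hom_prod_elts:
  assumes "cring R" "cring S" "h \<in> ring_hom R S" "set xs \<subseteq> carrier R"
  shows "h (prod_elts R xs) = prod_elts S (map h xs)"
  using assms(4)
proof (induction xs)
  case Nil
  then show ?case using ring_hom_one[OF assms(3)] by simp
next
  case (Cons a xs)
  then show ?case using ring_hom_mult[OF assms(3)] cring.prod_elts_closed[OF assms(1)] by simp
qed

lemma hom_nat_pow_elt:
  assumes "cring R" "cring S" "h \<in> ring_hom R S" "x \<in> carrier R"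
  shows "h (x [^]\<^bsub>R\<^esub> (n::nat)) = h x [^]\<^bsub>S\<^esub> n"
proof -
  interpret R: cring R by fact
  interpret S: cring S by fact
  interpret ring_hom_ring R S h
    by (rule ring_hom_ringI2[OF R.ring_axioms S.ring_axioms assms(3)])
  show ?thesis using assms(4) by (rule hom_nat_pow)
qed

lemma hom_pow_set:
  assumes "cring R" "cring S" "h \<in> ring_hom R S" "set xs \<subseteq> carrier R"
  shows "h ` pow_set R n xs = pow_set S n (map h xs)"
proof -
  have "h (x [^]\<^bsub>R\<^esub> n) = h x [^]\<^bsub>S\<^esub> n" if "x \<in> set xs" for x
    using hom_nat_pow_elt[OF assms(1-3)] that assms(4) by auto
  then show ?thesis unfolding pow_set_def by (auto simp: image_image)
qed

text \<open>A relation in \<open>R\<close> that violates the condition maps to one in \<open>S\<close>.\<close>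

lemma monomial_condition_contraction:
  assumes "cring R" "cring S" "h \<in> ring_hom R S" "set xs \<subseteq> carrier R"
    and mc: "monomial_condition S (map h xs) q"
  shows "monomial_condition R xs {r \<in> carrier R. h r \<in> q}"
proof -
  obtain n where n: "\<And>k s. s \<in> carrier S - q \<Longrightarrow>
      s \<otimes>\<^bsub>S\<^esub> prod_elts S (map h xs) [^]\<^bsub>S\<^esub> k \<notin> genideal S (pow_set S (n + k) (map h xs))"
    using mc unfolding monomial_condition_def by blast
  have P: "prod_elts R xs \<in> carrier R" by (rule cring.prod_elts_closed[OF assms(1,4)])
  interpret R: cring R by fact
  have "s \<otimes>\<^bsub>R\<^esub> prod_elts R xs [^]\<^bsub>R\<^esub> k \<notin> genideal R (pow_set R (n + k) xs)"
    if s: "s \<in> carrier R" "h s \<notin> q" for s k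
  proof
    assume "s \<otimes>\<^bsub>R\<^esub> prod_elts R xs [^]\<^bsub>R\<^esub> k \<in> genideal R (pow_set R (n + k) xs)"
    then have "h (s \<otimes>\<^bsub>R\<^esub> prod_elts R xs [^]\<^bsub>R\<^esub> k) \<in> genideal S (pow_set S (n + k) (map h xs))"
      using hom_Idl[OF assms(1-3) cring.pow_set_closed[OF assms(1,4)], of _ "n + k"]
        hom_pow_set[OF assms(1-4)] by simp
    also have "h (s \<otimes>\<^bsub>R\<^esub> prod_elts R xs [^]\<^bsub>R\<^esub> k) = h s \<otimes>\<^bsub>S\<^esub> prod_elts S (map h xs) [^]\<^bsub>S\<^esub> k"
      using ring_hom_mult[OF assms(3) s(1), of "prod_elts R xs [^]\<^bsub>R\<^esub> k"] P
        hom_nat_pow_elt[OF assms(1-3) P] hom_prod_elts[OF assms(1-4)] by simp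
    finally show False using n[of "h s" k] s ring_hom_closed[OF assms(3)] by auto
  qed
  then show ?thesis unfolding monomial_condition_def by blast
qed

context ring_localization
begin

lemma h_closed: "a \<in> carrier R \<Longrightarrow> h a \<in> carrier L"
  using ring_hom_closed[OF hom] .

lemma S_closed: "s \<in> S \<Longrightarrow> s \<in> carrier R"
  using S_sub by auto

lemma h_mult: "a \<in> carrier R \<Longrightarrow> b \<in> carrier R \<Longrightarrow> h (a \<otimes> b) = h a \<otimes>\<^bsub>L\<^esub> h b"
  using ring_hom_mult[OF hom] .

lemma h_add: "a \<in> carrier R \<Longrightarrow> b \<in> carrier R \<Longrightarrow> h (a \<oplus> b) = h a \<oplus>\<^bsub>L\<^esub> h b"
  using ring_hom_add[OF hom] .

text \<open>The elements of the form \<open>c/s\<close> with \<open>c\<close> in the ideal generated by \<open>X\<close> form an ideal.\<close>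

lemma Idl_extension:
  assumes X: "X \<subseteq> carrier R" and l: "l \<in> genideal L (h ` X)"
  shows "\<exists>c\<in>Idl X. \<exists>s\<in>S. l \<otimes>\<^bsub>L\<^esub> h s = h c"
proof -
  interpret h: ring_hom_ring R L h
    by (rule ring_hom_ringI2[OF R.ring_axioms L.ring_axioms hom])
  have I: "ideal (Idl X) R" by (rule R.genideal_ideal[OF X])
  define K where "K = {l \<in> carrier L. \<exists>c\<in>Idl X. \<exists>s\<in>S. l \<otimes>\<^bsub>L\<^esub> h s = h c}"
  have sub: "K \<subseteq> carrier L" by (auto simp: K_def)
  have hXK: "h ` X \<subseteq> K"
  proof
    fix y assume "y \<in> h ` X"
    then obtain x where x: "x \<in> X" "y = h x" by auto
    then have "y \<otimes>\<^bsub>L\<^esub> h \<one> = h x" using X by auto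
    moreover have "x \<in> Idl X" using R.genideal_self[OF X] x by auto
    moreover have "y \<in> carrier L" using x X by auto
    ultimately show "y \<in> K" using one_S unfolding K_def by blast
  qed
  have "ideal K L"
  proof (rule L.ideal_of_closed[OF sub])
    have "\<zero>\<^bsub>L\<^esub> \<otimes>\<^bsub>L\<^esub> h \<one> = h \<zero>" by simp
    then have "\<zero>\<^bsub>L\<^esub> \<in> K" using R.ideal_simps(6)[OF I] one_S unfolding K_def by blast
    then show "K \<noteq> {}" by blast
    fix l assume "l \<in> K"
    then obtain c s where c: "l \<in> carrier L" "c \<in> Idl X" "s \<in> S" "l \<otimes>\<^bsub>L\<^esub> h s = h c" by (auto simp: K_def)
    have cc: "c \<in> carrier R" by (rule R.ideal_simps(1)[OF I c(2)])
    {
      fix m assume "m \<in> K"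
      then obtain d t where d: "m \<in> carrier L" "d \<in> Idl X" "t \<in> S" "m \<otimes>\<^bsub>L\<^esub> h t = h d" by (auto simp: K_def)
      have dc: "d \<in> carrier R" by (rule R.ideal_simps(1)[OF I d(2)])
      have "(l \<oplus>\<^bsub>L\<^esub> m) \<otimes>\<^bsub>L\<^esub> h (s \<otimes> t) = (l \<otimes>\<^bsub>L\<^esub> h s) \<otimes>\<^bsub>L\<^esub> h t \<oplus>\<^bsub>L\<^esub> (m \<otimes>\<^bsub>L\<^esub> h t) \<otimes>\<^bsub>L\<^esub> h s"
        using c(1) d(1) c(3) d(3) by (simp add: h_mult S_closed h_closed L.m_ac L.r_distr)
      also have "\<dots> = h (c \<otimes> t \<oplus> d \<otimes> s)" using c d cc dc by (simp add: h_mult h_add S_closed)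
      finally have "(l \<oplus>\<^bsub>L\<^esub> m) \<otimes>\<^bsub>L\<^esub> h (s \<otimes> t) = h (c \<otimes> t \<oplus> d \<otimes> s)" .
      moreover have "c \<otimes> t \<oplus> d \<otimes> s \<in> Idl X"
        using R.ideal_simps(5)[OF I c(2) S_closed[OF d(3)]] R.ideal_simps(5)[OF I d(2) S_closed[OF c(3)]]
        by (rule R.ideal_simps(2)[OF I])
      ultimately show "l \<oplus>\<^bsub>L\<^esub> m \<in> K" using c(1) d(1) mult_S[OF c(3) d(3)] unfolding K_def by blast
    next
      fix x assume x: "x \<in> carrier L"
      obtain a t where a: "a \<in> carrier R" "t \<in> S" "x \<otimes>\<^bsub>L\<^esub> h t = h a" using surj x by blast
      have "(x \<otimes>\<^bsub>L\<^esub> l) \<otimes>\<^bsub>L\<^esub> h (s \<otimes> t) = (l \<otimes>\<^bsub>L\<^esub> h s) \<otimes>\<^bsub>L\<^esub> (x \<otimes>\<^bsub>L\<^esub> h t)"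
        using c(1) x c(3) a(2) by (simp add: h_mult S_closed h_closed L.m_ac)
      also have "\<dots> = h (c \<otimes> a)" using c a cc by (simp add: h_mult)
      finally show "x \<otimes>\<^bsub>L\<^esub> l \<in> K"
        using c(1) x R.ideal_simps(5)[OF I c(2) a(1)] mult_S[OF c(3) a(2)] unfolding K_def by blast
    }
  qed
  then have "genideal L (h ` X) \<subseteq> K" using hXK by (rule L.genideal_minimal)
  then show ?thesis using l by (auto simp: K_def)
qed

lemma mem_Idl_extensionD:
  assumes X: "X \<subseteq> carrier R" and a: "a \<in> carrier R" "h a \<in> genideal L (h ` X)"
  shows "\<exists>s\<in>S. s \<otimes> a \<in> Idl X"
proof -
  have I: "ideal (Idl X) R" by (rule R.genideal_ideal[OF X])
  obtain c s where c: "c \<in> Idl X" "s \<in> S" "h a \<otimes>\<^bsub>L\<^esub> h s = h c" using Idl_extension[OF X a(2)] by blast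
  have cc: "c \<in> carrier R" by (rule R.ideal_simps(1)[OF I c(1)])
  have "h (a \<otimes> s) = h c" using c a by (simp add: h_mult S_closed)
  then obtain u where u: "u \<in> S" "u \<otimes> (a \<otimes> s) = u \<otimes> c"
    using eqD[of "a \<otimes> s" c] a S_closed[OF c(2)] cc by auto
  have "(u \<otimes> s) \<otimes> a = u \<otimes> c" using u a c S_closed by (simp add: R.m_ac flip: u(2))
  then have "(u \<otimes> s) \<otimes> a \<in> Idl X" using R.ideal_simps(4)[OF I c(1)] u S_closed by simp
  then show ?thesis using mult_S[OF u(1) c(2)] by blast
qed

lemma unit_notin_prime:
  assumes "primeideal q L" "s \<in> S" shows "h s \<notin> q"
proof
  assume "h s \<in> q"
  moreover have "inv\<^bsub>L\<^esub> h s \<in> carrier L" "inv\<^bsub>L\<^esub> h s \<otimes>\<^bsub>L\<^esub> h s = \<one>\<^bsub>L\<^esub>" using unit[OF assms(2)] by auto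
  ultimately have "\<one>\<^bsub>L\<^esub> \<in> q" using L.ideal_simps(4)[OF primeideal.axioms(1)[OF assms(1)], of "h s" "inv\<^bsub>L\<^esub> h s"] by simp
  then show False using L.primeideal_one_notin[OF assms(1)] by simp
qed

text \<open>A relation in the localization that violates the condition holds in \<open>R\<close> after clearing
denominators, and elements of \<open>S\<close> lie outside every contracted prime.\<close>

lemma monomial_condition_extension:
  assumes q: "primeideal q L" and xs: "set xs \<subseteq> carrier R"
    and mc: "monomial_condition R xs {r \<in> carrier R. h r \<in> q}"
  shows "monomial_condition L (map h xs) q"
proof -
  note cr = R.is_cring L.is_cring hom
  have pp: "primeideal {r \<in> carrier R. h r \<in> q} R" by (rule prime_contraction[OF cr q])
  obtain n where n: "\<And>k s. s \<in> carrier R - {r \<in> carrier R. h r \<in> q} \<Longrightarrow>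
      s \<otimes> prod_elts R xs [^] k \<notin> Idl (pow_set R (n + k) xs)"
    using mc unfolding monomial_condition_def by blast
  let ?P = "prod_elts R xs"
  have P: "?P \<in> carrier R" by (rule R.prod_elts_closed[OF xs])
  have "l \<otimes>\<^bsub>L\<^esub> prod_elts L (map h xs) [^]\<^bsub>L\<^esub> k \<notin> genideal L (pow_set L (n + k) (map h xs))"
    if l: "l \<in> carrier L" "l \<notin> q" for l k
  proof
    assume mem: "l \<otimes>\<^bsub>L\<^esub> prod_elts L (map h xs) [^]\<^bsub>L\<^esub> k \<in> genideal L (pow_set L (n + k) (map h xs))"
    have pc: "pow_set R (n + k) xs \<subseteq> carrier R" by (rule R.pow_set_closed[OF xs])
    have hp: "prod_elts L (map h xs) [^]\<^bsub>L\<^esub> k = h (?P [^] k)"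
      using hom_nat_pow_elt[OF cr P] hom_prod_elts[OF cr xs] by simp
    obtain a t where a: "a \<in> carrier R" "t \<in> S" "l \<otimes>\<^bsub>L\<^esub> h t = h a" using surj[OF l(1)] by blast
    have Lid: "ideal (genideal L (h ` pow_set R (n + k) xs)) L"
      using pc h_closed by (intro L.genideal_ideal) auto
    have "l \<otimes>\<^bsub>L\<^esub> h (?P [^] k) \<in> genideal L (h ` pow_set R (n + k) xs)"
      using mem hp hom_pow_set[OF cr xs] by simp
    then have "l \<otimes>\<^bsub>L\<^esub> h (?P [^] k) \<otimes>\<^bsub>L\<^esub> h t \<in> genideal L (h ` pow_set R (n + k) xs)"
      using L.ideal_simps(5)[OF Lid] a(2) S_closed h_closed by simp
    also have "l \<otimes>\<^bsub>L\<^esub> h (?P [^] k) \<otimes>\<^bsub>L\<^esub> h t = (l \<otimes>\<^bsub>L\<^esub> h t) \<otimes>\<^bsub>L\<^esub> h (?P [^] k)"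
      using l(1) P a(2) by (simp add: S_closed h_closed L.m_ac)
    also have "\<dots> = h (a \<otimes> ?P [^] k)" using a P by (simp add: h_mult)
    finally obtain s where s: "s \<in> S" "s \<otimes> (a \<otimes> ?P [^] k) \<in> Idl (pow_set R (n + k) xs)"
      using mem_Idl_extensionD[OF pc, of "a \<otimes> ?P [^] k"] a(1) P by auto
    have "h a \<notin> q" unfolding a(3)[symmetric]
      by (rule L.primeideal_not_mem_mult[OF q l(1) _ l(2) unit_notin_prime[OF q a(2)]])
         (simp add: h_closed S_closed a(2))
    then have "h (s \<otimes> a) \<notin> q"
      unfolding h_mult[OF S_closed[OF s(1)] a(1)]
      by (intro L.primeideal_not_mem_mult[OF q] unit_notin_prime[OF q s(1)])
         (simp_all add: h_closed S_closed s(1) a(1))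
    then have "(s \<otimes> a) \<otimes> ?P [^] k \<notin> Idl (pow_set R (n + k) xs)"
      using n[of "s \<otimes> a" k] S_closed[OF s(1)] a(1) by simp
    then show False using s S_closed[OF s(1)] a(1) P by (simp add: R.m_assoc)
  qed
  then show ?thesis unfolding monomial_condition_def by blast
qed

end

section \<open>Noetherian Cohen-Macaulay rings\<close>

lemma local_cohen_macaulayE:
  assumes "local_cohen_macaulay L"
  obtains N where "cohen_macaulay_local_ring L N"
    "\<And>x. x \<in> carrier L \<Longrightarrow> x \<notin> Units L \<Longrightarrow> x \<in> N"
proof -
  obtain N where cr: "cring L" and noeth: "noetherian_ring L"
    and N: "\<forall>N'. maximalideal N' L \<longleftrightarrow> N' = N" and dim: "depth N L = krull_dim L"
    using assms unfolding local_cohen_macaulay_def by blast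
  interpret cring L by fact
  have max: "maximalideal N L" using N by blast
  interpret N: maximalideal N L by (rule max)
  have "x \<in> N" if x: "x \<in> carrier L" "x \<notin> Units L" for x
  proof -
    have "ideal (PIdl\<^bsub>L\<^esub> x) L" by (rule cgenideal_ideal[OF x(1)])
    moreover have "PIdl\<^bsub>L\<^esub> x \<noteq> carrier L"
    proof
      assume "PIdl\<^bsub>L\<^esub> x = carrier L"
      then have "\<one>\<^bsub>L\<^esub> \<in> PIdl\<^bsub>L\<^esub> x" by simp
      then obtain y where "y \<in> carrier L" "y \<otimes>\<^bsub>L\<^esub> x = \<one>\<^bsub>L\<^esub>" unfolding cgenideal_def by auto
      then have "x \<in> Units L" using x(1) m_comm[of y x] unfolding Units_def by auto
      then show False using x(2) by simp
    qed
    ultimately obtain m where "maximalideal m L" "PIdl\<^bsub>L\<^esub> x \<subseteq> m" using exists_maximal_ideal_above by blast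
    then show ?thesis using N cgenideal_self[OF x(1)] by blast
  qed
  moreover have "\<one>\<^bsub>L\<^esub> \<notin> N" using N.one_imp_carrier N.I_notcarr by blast
  ultimately have "cohen_macaulay_local_ring L N"
    by (intro cohen_macaulay_local_ring.intro noetherian_local_ring.intro noetherian_cring.intro
        noetherian_local_ring_axioms.intro cohen_macaulay_local_ring_axioms.intro cr noeth dim
        N.is_ideal) auto
  then show ?thesis using that \<open>\<And>x. x \<in> carrier L \<Longrightarrow> x \<notin> Units L \<Longrightarrow> x \<in> N\<close> by blast
qed

text \<open>A witness \<open>b\<close> that \<open>x\<^sub>i\<close> is a zero divisor modulo \<open>I = (x\<^sub>j : j < i)\<close> remains one in the localization
at any maximal ideal that contains \<open>(I : b)\<close>. Since \<open>(I : b)\<close> contains the \<open>x\<^sub>j\<close> with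
\<open>j \<le> i\<close>, these lie in the maximal ideal and the local statement applies to them.\<close>

theorem noetherian_cohen_macaulay_weakly_regular:
  assumes cm: "noetherian_cohen_macaulay R" and xs: "set xs \<subseteq> carrier R"
    and mc: "\<And>i p. i < length xs \<Longrightarrow> primeideal p R \<Longrightarrow> set (take (Suc i) xs) \<subseteq> p \<Longrightarrow>
      monomial_condition R (take (Suc i) xs) p"
  shows "weakly_regular R xs"
proof -
  interpret R: cring R using cm by (simp add: noetherian_cohen_macaulay_def)
  have "nzd_mod R (genideal R (set (take i xs))) (xs ! i)" if i: "i < length xs" for i
  proof (rule nzd_modI, rule ccontr)
    define I where "I = genideal R (set (take i xs))"
    fix b assume "b \<in> carrier R" "xs ! i \<otimes>\<^bsub>R\<^esub> b \<in> genideal R (set (take i xs))"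
      "b \<notin> genideal R (set (take i xs))"
    then have b: "b \<in> carrier R" "xs ! i \<otimes>\<^bsub>R\<^esub> b \<in> I" "b \<notin> I" by (simp_all add: I_def)
    have tk: "set (take i xs) \<subseteq> carrier R" using xs set_take_subset[of i xs] by blast
    have xi: "xs ! i \<in> carrier R" using i xs by auto
    have I: "ideal I R" unfolding I_def by (rule R.genideal_ideal[OF tk])
    have "\<one>\<^bsub>R\<^esub> \<notin> colon R I b" using b by (simp add: colon_def)
    then have "colon R I b \<noteq> carrier R" using R.one_closed by metis
    then obtain m where m: "maximalideal m R" "colon R I b \<subseteq> m"
      using R.exists_maximal_ideal_above[OF R.ideal_colon[OF I b(1)]] by blast
    have mp: "primeideal m R" by (rule R.maximalideal_prime[OF m(1)])
    define S where "S = carrier R - m"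
    define L where "L = loc_ring R S"
    have Lcm: "local_cohen_macaulay L" using cm m(1) by (simp add: noetherian_cohen_macaulay_def L_def S_def)
    then have Lcr: "cring L" by (simp add: local_cohen_macaulay_def)
    define h where "h = (\<lambda>a. frac R S (self_module R) a \<one>\<^bsub>R\<^esub>)"
    have "ring_localization R L S h"
      unfolding L_def h_def
    proof (rule R.loc_ring_is_localization)
      show "s \<otimes>\<^bsub>R\<^esub> t \<in> S" if "s \<in> S" "t \<in> S" for s t
        using that R.primeideal_not_mem_mult[OF mp] by (simp add: S_def)
    qed (use Lcr R.primeideal_one_notin[OF mp] in \<open>auto simp: L_def S_def\<close>)
    then interpret loc: ring_localization R L S h .
    obtain N where N: "cohen_macaulay_local_ring L N" "\<And>x. x \<in> carrier L \<Longrightarrow> x \<notin> Units L \<Longrightarrow> x \<in> N"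
      using local_cohen_macaulayE[OF Lcm] by blast
    interpret L: cohen_macaulay_local_ring L N by (rule N(1))
    define zs where "zs = take (Suc i) xs"
    have zc: "set zs \<subseteq> carrier R" using xs set_take_subset[of "Suc i" xs] unfolding zs_def by blast
    have zs: "zs = take i xs @ [xs ! i]" using i by (simp add: zs_def take_Suc_conv_app_nth)
    have zm: "set zs \<subseteq> m"
    proof -
      have "set (take i xs) \<subseteq> I" unfolding I_def by (rule R.genideal_self[OF tk])
      moreover have "I \<subseteq> m" using R.colon_super[OF I b(1)] m(2) by blast
      moreover have "xs ! i \<in> m" using b xi m(2) by (auto simp: colon_def R.m_comm)
      ultimately show ?thesis unfolding zs by auto
    qed
    have hN: "h z \<in> N" if z: "z \<in> m" "z \<in> carrier R" for z
    proof (rule N(2)[OF loc.h_closed[OF z(2)]])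
      show "h z \<notin> Units L"
      proof
        assume u: "h z \<in> Units L"
        obtain a s where a: "a \<in> carrier R" "s \<in> S" "inv\<^bsub>L\<^esub> h z \<otimes>\<^bsub>L\<^esub> h s = h a"
          using loc.surj loc.L.Units_inv_closed[OF u] by blast
        have sc: "s \<in> carrier R" by (rule loc.S_closed[OF a(2)])
        have "h (z \<otimes>\<^bsub>R\<^esub> a) = h z \<otimes>\<^bsub>L\<^esub> (inv\<^bsub>L\<^esub> h z \<otimes>\<^bsub>L\<^esub> h s)" using a z by (simp add: loc.h_mult)
        also have "\<dots> = h s"
          using u loc.h_closed[OF z(2)] loc.h_closed[OF sc] by (simp flip: loc.L.m_assoc)
        finally obtain v where v: "v \<in> S" "v \<otimes>\<^bsub>R\<^esub> (z \<otimes>\<^bsub>R\<^esub> a) = v \<otimes>\<^bsub>R\<^esub> s"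
          using loc.eqD[of "z \<otimes>\<^bsub>R\<^esub> a" s] z a sc by auto
        have vc: "v \<in> carrier R" by (rule loc.S_closed[OF v(1)])
        have idm: "ideal m R" by (rule primeideal.axioms(1)[OF mp])
        have "z \<otimes>\<^bsub>R\<^esub> a \<in> m" by (rule R.ideal_simps(5)[OF idm z(1) a(1)])
        then have "v \<otimes>\<^bsub>R\<^esub> (z \<otimes>\<^bsub>R\<^esub> a) \<in> m" by (rule R.ideal_simps(4)[OF idm _ vc])
        then have "v \<otimes>\<^bsub>R\<^esub> s \<in> m" using v(2) by simp
        moreover have "v \<otimes>\<^bsub>R\<^esub> s \<in> S" by (rule loc.mult_S[OF v(1) a(2)])
        ultimately show False by (simp add: S_def)
      qed
    qed
    have "weakly_regular L (map h zs)"
    proof (rule L.weakly_regular_of_monomial_condition)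
      show "set (map h zs) \<subseteq> N" using hN zm zc by auto
      fix j q assume j: "j < length (map h zs)" and q: "primeideal q L"
        and sub: "set (take (Suc j) (map h zs)) \<subseteq> q"
      let ?p = "{r \<in> carrier R. h r \<in> q}"
      have pp: "primeideal ?p R" by (rule prime_contraction[OF R.is_cring Lcr loc.hom q])
      have tz: "take (Suc j) zs = take (Suc j) xs" "j < length xs" using j i by (auto simp: zs_def)
      have tc: "set (take (Suc j) zs) \<subseteq> carrier R" using zc set_take_subset[of "Suc j" zs] by blast
      have "set (take (Suc j) zs) \<subseteq> ?p" using sub tc by (auto simp: take_map)
      then have "monomial_condition R (take (Suc j) zs) ?p" using mc[OF tz(2) pp] tz(1) by simp
      then show "monomial_condition L (take (Suc j) (map h zs)) q"
        using loc.monomial_condition_extension[OF q tc] by (simp add: take_map)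
    qed
    then have nzd: "nzd_mod L (genideal L (h ` set (take i xs))) (h (xs ! i))"
      unfolding zs by (simp add: weakly_regular_snoc)
    have "h (xs ! i \<otimes>\<^bsub>R\<^esub> b) \<in> genideal L (h ` set (take i xs))"
      using hom_Idl[OF R.is_cring Lcr loc.hom tk] b(2) by (simp add: I_def)
    then have "h b \<in> genideal L (h ` set (take i xs))"
      using nzd_modD[OF nzd loc.h_closed[OF b(1)]] by (simp add: loc.h_mult xi b(1))
    then obtain s where s: "s \<in> S" "s \<otimes>\<^bsub>R\<^esub> b \<in> I"
      using loc.mem_Idl_extensionD[OF tk b(1)] unfolding I_def by blast
    then have "s \<in> colon R I b" using loc.S_closed[OF s(1)] b(1) by (simp add: colon_def R.m_comm)
    then show False using m(2) s(1) by (auto simp: S_def)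
  qed
  then show ?thesis by (simp add: weakly_regular_def)
qed

section \<open>Products and quotients of modules\<close>

lemma prod_module_simps:
  "carrier (prod_module I M) = (\<Pi>\<^sub>E i\<in>I. carrier (M i))"
  "\<zero>\<^bsub>prod_module I M\<^esub> = (\<lambda>i\<in>I. \<zero>\<^bsub>M i\<^esub>)"
  "f \<oplus>\<^bsub>prod_module I M\<^esub> g = (\<lambda>i\<in>I. f i \<oplus>\<^bsub>M i\<^esub> g i)"
  "r \<odot>\<^bsub>prod_module I M\<^esub> f = (\<lambda>i\<in>I. r \<odot>\<^bsub>M i\<^esub> f i)"
  by (simp_all add: prod_module_def)

lemma prod_module_is_module:
  fixes R :: "('a, 'm) ring_scheme"
  assumes R: "cring R" and M: "\<And>i. i \<in> I \<Longrightarrow> module R (M i)"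
  shows "module R (prod_module I M)"
proof (rule moduleI[OF R])
  let ?P = "prod_module I M"
  have ag: "abelian_group (M i)" if "i \<in> I" for i using M[OF that] by (simp add: module_def)
  note am = abelian_group.axioms(1)[OF ag]
  show "abelian_group ?P"
  proof (rule abelian_groupI)
    fix f g assume f: "f \<in> carrier ?P" and g: "g \<in> carrier ?P"
    have fi: "f i \<in> carrier (M i)" "g i \<in> carrier (M i)" if "i \<in> I" for i
      using f g that by (auto simp: prod_module_simps)
    show "f \<oplus>\<^bsub>?P\<^esub> g \<in> carrier ?P"
      unfolding prod_module_simps
      by (rule restrict_PiE_iff[THEN iffD2]) (auto intro: abelian_monoid.a_closed[OF am] fi)
    show "f \<oplus>\<^bsub>?P\<^esub> g = g \<oplus>\<^bsub>?P\<^esub> f"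
      unfolding prod_module_simps
      by (rule restrict_ext) (rule abelian_monoid.a_comm[OF am], auto intro: fi)
    fix k assume k: "k \<in> carrier ?P"
    have ki: "k i \<in> carrier (M i)" if "i \<in> I" for i
      using k that by (auto simp: prod_module_simps)
    show "f \<oplus>\<^bsub>?P\<^esub> g \<oplus>\<^bsub>?P\<^esub> k = f \<oplus>\<^bsub>?P\<^esub> (g \<oplus>\<^bsub>?P\<^esub> k)"
      unfolding prod_module_simps
      by (rule restrict_ext) (simp add: abelian_monoid.a_assoc[OF am] fi ki)
  next
    show "\<zero>\<^bsub>?P\<^esub> \<in> carrier ?P"
      unfolding prod_module_simps
      by (rule restrict_PiE_iff[THEN iffD2]) (auto intro: abelian_monoid.zero_closed[OF am])
    fix f assume f: "f \<in> carrier ?P"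
    have fi: "f i \<in> carrier (M i)" if "i \<in> I" for i
      using f that by (auto simp: prod_module_simps)
    have "(\<lambda>i\<in>I. \<zero>\<^bsub>M i\<^esub> \<oplus>\<^bsub>M i\<^esub> f i) = restrict f I"
      by (rule restrict_ext) (rule abelian_monoid.l_zero[OF am], auto intro: fi)
    also have "\<dots> = f" using f by (simp add: prod_module_simps PiE_restrict)
    finally show "\<zero>\<^bsub>?P\<^esub> \<oplus>\<^bsub>?P\<^esub> f = f"
      unfolding prod_module_simps by (simp cong: restrict_cong)
    define g where "g = (\<lambda>i\<in>I. \<ominus>\<^bsub>M i\<^esub> f i)"
    have "g \<in> carrier ?P"
      unfolding prod_module_simps g_def
      by (rule restrict_PiE_iff[THEN iffD2]) (auto intro: abelian_group.a_inv_closed[OF ag] fi)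
    moreover have "g \<oplus>\<^bsub>?P\<^esub> f = \<zero>\<^bsub>?P\<^esub>"
      unfolding prod_module_simps g_def
      by (rule restrict_ext) (simp add: abelian_group.l_neg[OF ag] fi)
    ultimately show "\<exists>g\<in>carrier ?P. g \<oplus>\<^bsub>?P\<^esub> f = \<zero>\<^bsub>?P\<^esub>" by blast
  qed
  fix a b f g assume a: "a \<in> carrier R" and f: "f \<in> carrier ?P"
  have fi: "f i \<in> carrier (M i)" if "i \<in> I" for i
    using f that by (auto simp: prod_module_simps)
  show "a \<odot>\<^bsub>?P\<^esub> f \<in> carrier ?P"
    unfolding prod_module_simps
    by (rule restrict_PiE_iff[THEN iffD2]) (auto intro: module.smult_closed[OF M] fi a)
  show "b \<in> carrier R \<Longrightarrow> (a \<oplus>\<^bsub>R\<^esub> b) \<odot>\<^bsub>?P\<^esub> f =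
      a \<odot>\<^bsub>?P\<^esub> f \<oplus>\<^bsub>?P\<^esub> b \<odot>\<^bsub>?P\<^esub> f"
    unfolding prod_module_simps
    by (rule restrict_ext) (simp add: module.smult_l_distr[OF M] fi a)
  show "b \<in> carrier R \<Longrightarrow> (a \<otimes>\<^bsub>R\<^esub> b) \<odot>\<^bsub>?P\<^esub> f =
      a \<odot>\<^bsub>?P\<^esub> (b \<odot>\<^bsub>?P\<^esub> f)"
    unfolding prod_module_simps
    by (rule restrict_ext) (simp add: module.smult_assoc1[OF M] fi a)
  assume g: "g \<in> carrier ?P"
  have gi: "g i \<in> carrier (M i)" if "i \<in> I" for i
    using g that by (auto simp: prod_module_simps)
  show "a \<odot>\<^bsub>?P\<^esub> (f \<oplus>\<^bsub>?P\<^esub> g) =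
      a \<odot>\<^bsub>?P\<^esub> f \<oplus>\<^bsub>?P\<^esub> a \<odot>\<^bsub>?P\<^esub> g"
    unfolding prod_module_simps
    by (rule restrict_ext) (simp add: module.smult_r_distr[OF M] fi gi a)
next
  let ?P = "prod_module I M"
  fix f assume f: "f \<in> carrier ?P"
  have "(\<lambda>i\<in>I. \<one>\<^bsub>R\<^esub> \<odot>\<^bsub>M i\<^esub> f i) = restrict f I"
    by (rule restrict_ext) (use f in \<open>auto simp: prod_module_simps intro!: module.smult_one[OF M]\<close>)
  also have "\<dots> = f" using f by (simp add: prod_module_simps PiE_restrict)
  finally show "\<one>\<^bsub>R\<^esub> \<odot>\<^bsub>?P\<^esub> f = f" unfolding prod_module_simps .
qed

context module
begin

lemma submodule_abelian_subgroup:
  assumes "submodule N R M" shows "abelian_subgroup N M"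
  by (rule abelian_subgroupI3[OF additive_subgroup.intro[OF submodule.axioms(1)[OF assms]] M.abelian_group_axioms])

lemma quot_module_simps:
  assumes N: "submodule N R M"
  shows "carrier (quot_module M N) = (\<lambda>x. N +>\<^bsub>M\<^esub> x) ` carrier M"
    and "\<zero>\<^bsub>quot_module M N\<^esub> = N +>\<^bsub>M\<^esub> \<zero>\<^bsub>M\<^esub>"
    and "\<lbrakk>x \<in> carrier M; y \<in> carrier M\<rbrakk> \<Longrightarrow>
      (N +>\<^bsub>M\<^esub> x) \<oplus>\<^bsub>quot_module M N\<^esub> (N +>\<^bsub>M\<^esub> y) = N +>\<^bsub>M\<^esub> (x \<oplus>\<^bsub>M\<^esub> y)"
    and "\<lbrakk>r \<in> carrier R; x \<in> carrier M\<rbrakk> \<Longrightarrow>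
      r \<odot>\<^bsub>quot_module M N\<^esub> (N +>\<^bsub>M\<^esub> x) = N +>\<^bsub>M\<^esub> (r \<odot>\<^bsub>M\<^esub> x)"
proof -
  interpret N: abelian_subgroup N M by (rule submodule_abelian_subgroup[OF N])
  show "carrier (quot_module M N) = (\<lambda>x. N +>\<^bsub>M\<^esub> x) ` carrier M"
    by (auto simp: quot_module_def A_RCOSETS_def RCOSETS_def a_r_coset_def)
  show "\<zero>\<^bsub>quot_module M N\<^esub> = N +>\<^bsub>M\<^esub> \<zero>\<^bsub>M\<^esub>"
    using N.a_subset by (simp add: quot_module_def)
  show "\<lbrakk>x \<in> carrier M; y \<in> carrier M\<rbrakk> \<Longrightarrow>
      (N +>\<^bsub>M\<^esub> x) \<oplus>\<^bsub>quot_module M N\<^esub> (N +>\<^bsub>M\<^esub> y) = N +>\<^bsub>M\<^esub> (x \<oplus>\<^bsub>M\<^esub> y)"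
    using N.a_rcos_sum by (simp add: quot_module_def)
  assume r: "r \<in> carrier R" and x: "x \<in> carrier M"
  have "N +>\<^bsub>M\<^esub> (r \<odot>\<^bsub>M\<^esub> z) = N +>\<^bsub>M\<^esub> (r \<odot>\<^bsub>M\<^esub> x)" if "z \<in> N +>\<^bsub>M\<^esub> x" for z
  proof -
    obtain n where n: "n \<in> N" "z = n \<oplus>\<^bsub>M\<^esub> x" using \<open>z \<in> N +>\<^bsub>M\<^esub> x\<close> by (auto simp: a_r_coset_def')
    have nc: "n \<in> carrier M" using n(1) N.a_subset by auto
    have rn: "r \<odot>\<^bsub>M\<^esub> n \<in> N" using submodule.smult_closed[OF N r n(1)] .
    have "N +>\<^bsub>M\<^esub> (r \<odot>\<^bsub>M\<^esub> z) = N +>\<^bsub>M\<^esub> (r \<odot>\<^bsub>M\<^esub> n \<oplus>\<^bsub>M\<^esub> r \<odot>\<^bsub>M\<^esub> x)"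
      using n(2) nc x r by (simp add: smult_r_distr)
    also have "\<dots> = (N +>\<^bsub>M\<^esub> r \<odot>\<^bsub>M\<^esub> n) +>\<^bsub>M\<^esub> r \<odot>\<^bsub>M\<^esub> x"
      using N.a_subset nc x r by (simp add: M.a_coset_add_assoc)
    also have "N +>\<^bsub>M\<^esub> r \<odot>\<^bsub>M\<^esub> n = N" using N.a_rcos_const[OF rn] .
    finally show ?thesis .
  qed
  then have "(\<Union>z\<in>N +>\<^bsub>M\<^esub> x. N +>\<^bsub>M\<^esub> (r \<odot>\<^bsub>M\<^esub> z)) = (\<Union>z\<in>N +>\<^bsub>M\<^esub> x. N +>\<^bsub>M\<^esub> (r \<odot>\<^bsub>M\<^esub> x))"
    by (intro SUP_cong refl)
  also have "\<dots> = N +>\<^bsub>M\<^esub> (r \<odot>\<^bsub>M\<^esub> x)"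
  proof -
    have "N +>\<^bsub>M\<^esub> x \<noteq> {}" using N.a_rcos_self[OF x] by blast
    then show ?thesis by simp
  qed
  finally show "r \<odot>\<^bsub>quot_module M N\<^esub> (N +>\<^bsub>M\<^esub> x) = N +>\<^bsub>M\<^esub> (r \<odot>\<^bsub>M\<^esub> x)"
    by (simp add: quot_module_def)
qed

lemma quot_module_is_module:
  assumes N: "submodule N R M"
  shows "module R (quot_module M N)"
proof (rule moduleI[OF R.is_cring])
  note simps = quot_module_simps[OF N]
  show "abelian_group (quot_module M N)"
  proof (rule abelian_groupI)
    fix X assume "X \<in> carrier (quot_module M N)"
    then obtain x where x: "x \<in> carrier M" "X = N +>\<^bsub>M\<^esub> x" unfolding simps by blast
    have "(N +>\<^bsub>M\<^esub> \<ominus>\<^bsub>M\<^esub> x) \<oplus>\<^bsub>quot_module M N\<^esub> X = \<zero>\<^bsub>quot_module M N\<^esub>"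
      using x by (simp add: simps M.l_neg)
    then show "\<exists>Y\<in>carrier (quot_module M N). Y \<oplus>\<^bsub>quot_module M N\<^esub> X = \<zero>\<^bsub>quot_module M N\<^esub>"
      using x(1) by (intro bexI[of _ "N +>\<^bsub>M\<^esub> \<ominus>\<^bsub>M\<^esub> x"]) (auto simp: simps)
  qed (auto simp: simps M.a_ac)
qed (use quot_module_simps[OF N] in \<open>auto simp: smult_l_distr smult_r_distr smult_assoc1\<close>)

end

section \<open>Maps between modules of fractions\<close>

context module_of_fractions
begin

text \<open>The formula is meaningful although \<open>s\<close> need not belong to \<open>S'\<close>: a fraction is defined for arbitrary
denominators, and it behaves well for divisors of elements of \<open>S'\<close>.\<close>

lemma loc_map_frac:
  assumes S': "module_of_fractions R M S'"
    and div: "\<And>s. s \<in> S \<Longrightarrow> \<exists>d\<in>carrier R. d \<otimes> s \<in> S'"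
    and m: "m \<in> carrier M" "s \<in> S"
  shows "loc_map R M S' (frac R S M m s) = frac R S' M m s"
proof -
  interpret S': module_of_fractions R M S' by fact
  show ?thesis unfolding loc_map_def
  proof (rule UN_frac[OF m])
    fix n t u assume *: "n \<in> carrier M" "t \<in> S" "u \<in> S" "(u \<otimes> s) \<odot>\<^bsub>M\<^esub> n = (u \<otimes> t) \<odot>\<^bsub>M\<^esub> m"
    obtain c where c: "c \<in> carrier R" "c \<otimes> u \<in> S'" using div *(3) by blast
    obtain d where d: "d \<in> carrier R" "d \<otimes> t \<in> S'" using div *(2) by blast
    obtain e where e: "e \<in> carrier R" "e \<otimes> s \<in> S'" using div m(2) by blast
    have "frac R S' M m s = frac R S' M n t"
      by (rule S'.frac_eqI'[OF m(1) *(1) _ _ _ c d e *(4)]) (use * m S_closed in auto)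
    then show "frac R S' M n t = frac R S' M m s" by simp
  qed
qed

lemma loc_map_linear:
  assumes S': "module_of_fractions R M S'"
    and div: "\<And>s. s \<in> S \<Longrightarrow> \<exists>d\<in>carrier R. d \<otimes> s \<in> S'"
    and X: "X \<in> carrier fractions"
  shows "loc_map R M S' X \<in> carrier (loc_module R S' M)"
    and "r \<in> carrier R \<Longrightarrow> loc_map R M S' (r \<odot>\<^bsub>fractions\<^esub> X) = r \<odot>\<^bsub>loc_module R S' M\<^esub> loc_map R M S' X"
    and "Y \<in> carrier fractions \<Longrightarrow> loc_map R M S' (X \<oplus>\<^bsub>fractions\<^esub> Y) =
      loc_map R M S' X \<oplus>\<^bsub>loc_module R S' M\<^esub> loc_map R M S' Y"
proof -
  interpret S': module_of_fractions R M S' by fact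
  have lm: "loc_map R M S' (frac R S M m s) = frac R S' M m s" if "m \<in> carrier M" "s \<in> S" for m s
    by (rule loc_map_frac[OF S' div]) (use that in auto)
  have conv: "\<exists>d\<in>carrier R. d \<otimes> s \<in> S' \<and>
      (\<forall>m\<in>carrier M. frac R S' M m s = frac R S' M (d \<odot>\<^bsub>M\<^esub> m) (d \<otimes> s))" if s: "s \<in> S" for s
  proof -
    obtain d where d: "d \<in> carrier R" "d \<otimes> s \<in> S'" using div s by blast
    have sc: "s \<in> carrier R" using S_closed[OF s] .
    have "frac R S' M m s = frac R S' M (d \<odot>\<^bsub>M\<^esub> m) (d \<otimes> s)" if m: "m \<in> carrier M" for m
    proof (rule S'.frac_eqI'[of _ _ _ _ \<one> \<one> \<one> d])
      show "(\<one> \<otimes> s) \<odot>\<^bsub>M\<^esub> (d \<odot>\<^bsub>M\<^esub> m) = (\<one> \<otimes> (d \<otimes> s)) \<odot>\<^bsub>M\<^esub> m"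
        using d sc m by (simp add: R.m_comm flip: smult_assoc1)
    qed (use d sc m S'.one_S in auto)
    then show ?thesis using d by blast
  qed
  obtain m s where X': "m \<in> carrier M" "s \<in> S" "X = frac R S M m s" using X by (auto simp: fractions_carrier)
  obtain d where d: "d \<in> carrier R" "d \<otimes> s \<in> S'"
    "\<And>m. m \<in> carrier M \<Longrightarrow> frac R S' M m s = frac R S' M (d \<odot>\<^bsub>M\<^esub> m) (d \<otimes> s)" using conv[OF X'(2)] by blast
  show "loc_map R M S' X \<in> carrier (loc_module R S' M)"
    unfolding X'(3) lm[OF X'(1,2)] d(3)[OF X'(1)] using d X' by (intro S'.fracI) auto
  show "loc_map R M S' (r \<odot>\<^bsub>fractions\<^esub> X) = r \<odot>\<^bsub>loc_module R S' M\<^esub> loc_map R M S' X" if r: "r \<in> carrier R"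
    using d(1,2) X'(1,2) r unfolding X'(3)
    by (simp add: fractions_smult lm d(3) S'.fractions_smult R.m_comm flip: smult_assoc1)
  assume "Y \<in> carrier fractions"
  then obtain m n s where XY: "m \<in> carrier M" "n \<in> carrier M" "s \<in> S"
    "X = frac R S M m s" "Y = frac R S M n s" using common_denominator[OF X] by blast
  obtain d where d: "d \<in> carrier R" "d \<otimes> s \<in> S'"
    "\<And>m. m \<in> carrier M \<Longrightarrow> frac R S' M m s = frac R S' M (d \<odot>\<^bsub>M\<^esub> m) (d \<otimes> s)" using conv[OF XY(3)] by blast
  show "loc_map R M S' (X \<oplus>\<^bsub>fractions\<^esub> Y) = loc_map R M S' X \<oplus>\<^bsub>loc_module R S' M\<^esub> loc_map R M S' Y"
    using d(1,2) XY(1-3) unfolding XY(4,5)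
    by (simp add: fractions_add_same lm d(3) S'.fractions_add_same smult_r_distr)
qed

end

section \<open>Top Cech cohomology\<close>

context cring
begin

lemma module_of_fractions_powers:
  assumes "f \<in> carrier R"
  shows "module_of_fractions R (self_module R) (powers R f)"
proof (intro module_of_fractions.intro module_of_fractions_axioms.intro self_module_is_module)
  show "powers R f \<subseteq> carrier R" using assms by (auto simp: powers_def)
  have "f [^] (0::nat) \<in> powers R f" unfolding powers_def by blast
  then show "\<one> \<in> powers R f" by simp
  fix s t assume "s \<in> powers R f" "t \<in> powers R f"
  then obtain n m where "s = f [^] (n::nat)" "t = f [^] (m::nat)" by (auto simp: powers_def)
  then have "s \<otimes> t = f [^] (n + m)" using assms by (simp add: nat_pow_mult)
  then show "s \<otimes> t \<in> powers R f" by (auto simp: powers_def)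
qed

lemma prod_elts_eq_finprod:
  "set xs \<subseteq> carrier R \<Longrightarrow> prod_elts R xs = (\<Otimes>j\<in>{..<length xs}. xs ! j)"
proof (induction xs rule: rev_induct)
  case (snoc x xs)
  have c: "set xs \<subseteq> carrier R" "x \<in> carrier R" using snoc.prems by auto
  have "(\<Otimes>j\<in>{..<length (xs @ [x])}. (xs @ [x]) ! j) =
      (\<Otimes>j\<in>insert (length xs) {..<length xs}. (xs @ [x]) ! j)" by (simp add: lessThan_Suc)
  also have "\<dots> = x \<otimes> (\<Otimes>j\<in>{..<length xs}. (xs @ [x]) ! j)"
    using c by (subst finprod_insert) (auto simp: nth_append)
  also have "(\<Otimes>j\<in>{..<length xs}. (xs @ [x]) ! j) = (\<Otimes>j\<in>{..<length xs}. xs ! j)"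
    using c by (intro finprod_cong') (auto simp: nth_append)
  also have "x \<otimes> \<dots> = prod_elts R (xs @ [x])"
    using snoc.IH[OF c(1)] c prod_elts_closed[OF c(1)] unfolding prod_elts_snoc[OF c] by (simp add: m_comm)
  finally show ?case by simp
qed simp

end

text \<open>In the top degree \<open>l\<close> of the Cech complex of \<open>x\<^sub>1, \<dots>, x\<^sub>l\<close> there is one component, with denominators
the powers of the product of all \<open>x\<^sub>j\<close>; the components in degree \<open>l - 1\<close> omit one factor each.\<close>

locale cech_top = cring R for R (structure) +
  fixes xs :: "'a list"
  assumes xs: "set xs \<subseteq> carrier R" and nonempty: "xs \<noteq> []"
begin

abbreviation "ell \<equiv> length xs"
abbreviation "top_set \<equiv> {..<length xs}"
abbreviation "sub_prod T \<equiv> (\<Otimes>j\<in>T. xs ! j)"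
abbreviation "part T \<equiv> loc_module R (cech_powers R xs T) (self_module R)"
abbreviation "P \<equiv> prod_elts R xs"
abbreviation "Top \<equiv> part top_set"
abbreviation "top_frac \<equiv> frac R (cech_powers R xs top_set) (self_module R)"
abbreviation "to_top \<equiv> loc_map R (self_module R) (cech_powers R xs top_set)"
definition csign where "csign j = (\<ominus> \<one>) [^] card {k \<in> top_set. k < j}"

lemma nth_closed: "j < ell \<Longrightarrow> xs ! j \<in> carrier R"
  using xs by auto

lemma sub_prod_closed: "T \<subseteq> top_set \<Longrightarrow> sub_prod T \<in> carrier R"
  by (rule finprod_closed) (use nth_closed in auto)

lemma P_closed: "P \<in> carrier R"
  by (rule prod_elts_closed[OF xs])

lemma sub_prod_top: "sub_prod top_set = P"
  using prod_elts_eq_finprod[OF xs] by simp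

lemma part_fractions: "T \<subseteq> top_set \<Longrightarrow> module_of_fractions R (self_module R) (cech_powers R xs T)"
  unfolding cech_powers_def by (rule module_of_fractions_powers[OF sub_prod_closed])

lemma part_module: "T \<subseteq> top_set \<Longrightarrow> module R (part T)"
  by (rule module_of_fractions.fractions_module[OF part_fractions])

lemma sub_prod_split:
  assumes "T \<subseteq> top_set" shows "sub_prod (top_set - T) \<otimes> sub_prod T = P"
proof -
  have "sub_prod ((top_set - T) \<union> T) = sub_prod (top_set - T) \<otimes> sub_prod T"
    using assms nth_closed by (intro finprod_Un_disjoint) (auto intro: finite_subset)
  moreover have "(top_set - T) \<union> T = top_set" using assms by auto
  ultimately show ?thesis using sub_prod_top by simp
qed

lemma cech_powers_divides:
  assumes T: "T \<subseteq> top_set" and s: "s \<in> cech_powers R xs T"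
  shows "\<exists>d\<in>carrier R. d \<otimes> s \<in> cech_powers R xs top_set"
proof -
  obtain n where n: "s = sub_prod T [^] (n::nat)" using s by (auto simp: cech_powers_def powers_def)
  have c: "sub_prod (top_set - T) \<in> carrier R" "sub_prod T \<in> carrier R"
    using T by (auto intro!: sub_prod_closed)
  have "sub_prod (top_set - T) [^] n \<otimes> s = P [^] n"
    unfolding n sub_prod_split[OF T, symmetric] using c by (simp add: nat_pow_distrib)
  also have "\<dots> \<in> cech_powers R xs top_set" unfolding cech_powers_def sub_prod_top by (auto simp: powers_def)
  finally show ?thesis using c by blast
qed

lemma P_pow_mem: "P [^] (n::nat) \<in> cech_powers R xs top_set"
  unfolding cech_powers_def sub_prod_top by (auto simp: powers_def)

lemma subsets_top: "subsets_of_card ell ell = {top_set}"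
proof -
  have "T = top_set" if "T \<subseteq> top_set" "card T = ell" for T
    using that by (intro card_subset_eq) auto
  then show ?thesis by (auto simp: subsets_of_card_def)
qed

lemma top_minus: "j < ell \<Longrightarrow> top_set - {j} \<in> subsets_of_card ell (ell - 1)"
  by (auto simp: subsets_of_card_def)

abbreviation "penult \<equiv> cech R (self_module R) xs (ell - 1)"

text \<open>The single component of the Cech differential into the top degree.\<close>

definition delta where
  "delta f = (\<Oplus>\<^bsub>Top\<^esub>j\<in>top_set. csign j \<odot>\<^bsub>Top\<^esub>
     to_top (f (top_set - {j})))"

lemma coboundaries_eq:
  "cech_coboundaries R (self_module R) xs ell = (\<lambda>f. \<lambda>T\<in>{top_set}. delta f) ` carrier penult"
proof -
  obtain k where k: "ell = Suc k" using nonempty by (cases xs) auto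
  have "cech_diff R (self_module R) xs k f = (\<lambda>T\<in>{top_set}. delta f)" for f
    unfolding cech_diff_def delta_def csign_def k[symmetric] subsets_top Let_def
    by (rule restrict_ext) simp
  then show ?thesis using k by (simp add: cech_coboundaries_def)
qed

lemma cech_module: "module R (cech R (self_module R) xs i)"
  unfolding cech_def
  by (rule prod_module_is_module[OF is_cring part_module]) (auto simp: subsets_of_card_def)

lemma penult_coord:
  assumes "f \<in> carrier penult" "j < ell"
  shows "f (top_set - {j}) \<in> carrier (part (top_set - {j}))"
  using assms(1) top_minus[OF assms(2)] unfolding cech_def prod_module_simps by auto

lemma csign_closed [simp]: "csign j \<in> carrier R" by (simp add: csign_def)

lemma to_top_linear:
  assumes j: "j < ell" and X: "X \<in> carrier (part (top_set - {j}))"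
  shows "to_top X \<in> carrier Top"
    and "r \<in> carrier R \<Longrightarrow> to_top (r \<odot>\<^bsub>part (top_set - {j})\<^esub> X) = r \<odot>\<^bsub>Top\<^esub> to_top X"
    and "Y \<in> carrier (part (top_set - {j})) \<Longrightarrow>
      to_top (X \<oplus>\<^bsub>part (top_set - {j})\<^esub> Y) = to_top X \<oplus>\<^bsub>Top\<^esub> to_top Y"
proof -
  have sub: "top_set - {j} \<subseteq> top_set" by auto
  interpret F: module_of_fractions R "self_module R" "cech_powers R xs (top_set - {j})"
    by (rule part_fractions[OF sub])
  note lin = F.loc_map_linear[OF part_fractions[OF order_refl] cech_powers_divides[OF sub] X]
  show "to_top X \<in> carrier Top" by (rule lin(1))
  show "r \<in> carrier R \<Longrightarrow> to_top (r \<odot>\<^bsub>part (top_set - {j})\<^esub> X) = r \<odot>\<^bsub>Top\<^esub> to_top X" by (rule lin(2))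
  show "Y \<in> carrier (part (top_set - {j})) \<Longrightarrow>
      to_top (X \<oplus>\<^bsub>part (top_set - {j})\<^esub> Y) = to_top X \<oplus>\<^bsub>Top\<^esub> to_top Y" by (rule lin(3))
qed

lemma delta_term_closed:
  "f \<in> carrier penult \<Longrightarrow> j < ell \<Longrightarrow> to_top (f (top_set - {j})) \<in> carrier Top"
  by (rule to_top_linear(1)[OF _ penult_coord])

lemma delta_closed:
  assumes "f \<in> carrier penult" shows "delta f \<in> carrier (Top)"
proof -
  interpret T: module R "Top" by (rule part_module) simp
  show ?thesis unfolding delta_def
    by (rule T.M.finsum_closed) (use delta_term_closed[OF assms] in auto)
qed

lemma delta_add:
  assumes f: "f \<in> carrier penult" and g: "g \<in> carrier penult"
  shows "delta (f \<oplus>\<^bsub>penult\<^esub> g) = delta f \<oplus>\<^bsub>Top\<^esub> delta g"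
proof -
  interpret T: module R "Top" by (rule part_module) simp
  have "delta (f \<oplus>\<^bsub>penult\<^esub> g) = (\<Oplus>\<^bsub>Top\<^esub>j\<in>top_set.
      csign j \<odot>\<^bsub>Top\<^esub> to_top (f (top_set - {j})) \<oplus>\<^bsub>Top\<^esub>
      csign j \<odot>\<^bsub>Top\<^esub> to_top (g (top_set - {j})))"
    unfolding delta_def
  proof (rule T.M.finsum_cong')
    fix j assume "j \<in> top_set"
    then have j: "j < ell" by simp
    have "(f \<oplus>\<^bsub>penult\<^esub> g) (top_set - {j}) =
        f (top_set - {j}) \<oplus>\<^bsub>part (top_set - {j})\<^esub> g (top_set - {j})"
      unfolding cech_def prod_module_simps using top_minus[OF j] by simp
    moreover have "to_top \<dots> = to_top (f (top_set - {j})) \<oplus>\<^bsub>Top\<^esub> to_top (g (top_set - {j}))"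
      by (rule to_top_linear(3)[OF j penult_coord[OF f j] penult_coord[OF g j]])
    ultimately show "csign j \<odot>\<^bsub>Top\<^esub> to_top ((f \<oplus>\<^bsub>penult\<^esub> g) (top_set - {j})) =
        csign j \<odot>\<^bsub>Top\<^esub> to_top (f (top_set - {j})) \<oplus>\<^bsub>Top\<^esub>
        csign j \<odot>\<^bsub>Top\<^esub> to_top (g (top_set - {j}))"
      using T.smult_r_distr[OF csign_closed delta_term_closed[OF f j] delta_term_closed[OF g j]] by simp
  qed (use delta_term_closed f g in auto)
  also have "\<dots> = delta f \<oplus>\<^bsub>Top\<^esub> delta g"
    unfolding delta_def by (rule T.M.finsum_addf) (use delta_term_closed f g in auto)
  finally show ?thesis .
qed

lemma delta_smult:
  assumes f: "f \<in> carrier penult" and r: "r \<in> carrier R"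
  shows "delta (r \<odot>\<^bsub>penult\<^esub> f) = r \<odot>\<^bsub>Top\<^esub> delta f"
proof -
  interpret T: module R "Top" by (rule part_module) simp
  have "r \<odot>\<^bsub>Top\<^esub> delta f = (\<Oplus>\<^bsub>Top\<^esub>j\<in>top_set.
      r \<odot>\<^bsub>Top\<^esub> (csign j \<odot>\<^bsub>Top\<^esub> to_top (f (top_set - {j}))))"
    unfolding delta_def
    by (rule T.finsum_smult_ldistr) (use delta_term_closed[OF f] r in auto)
  also have "\<dots> = delta (r \<odot>\<^bsub>penult\<^esub> f)"
    unfolding delta_def
  proof (rule T.M.finsum_cong')
    fix j assume "j \<in> top_set"
    then have j: "j < ell" by simp
    have "(r \<odot>\<^bsub>penult\<^esub> f) (top_set - {j}) = r \<odot>\<^bsub>part (top_set - {j})\<^esub> f (top_set - {j})"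
      unfolding cech_def prod_module_simps using top_minus[OF j] by simp
    moreover have "to_top \<dots> = r \<odot>\<^bsub>Top\<^esub> to_top (f (top_set - {j}))"
      by (rule to_top_linear(2)[OF j penult_coord[OF f j] r])
    ultimately show "r \<odot>\<^bsub>Top\<^esub> (csign j \<odot>\<^bsub>Top\<^esub> to_top (f (top_set - {j}))) =
        csign j \<odot>\<^bsub>Top\<^esub> to_top ((r \<odot>\<^bsub>penult\<^esub> f) (top_set - {j}))"
      using delta_term_closed[OF f j] r by (simp add: m_comm flip: T.smult_assoc1)
  qed (use delta_term_closed[OF module.smult_closed[OF cech_module r f]] in auto)
  finally show ?thesis by simp
qed

text \<open>In the component that omits \<open>x\<^sub>j\<close>, take, up to sign, the fraction with numerator one and denominator the
\<open>N\<close>-th power of the product of the other factors; over the common denominator its numerator is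
\<open>x\<^sub>j\<^sup>N\<close>. The sign is chosen to cancel the one in the differential.\<close>

lemma delta_generator:
  assumes j: "j < ell"
  shows "\<exists>f\<in>carrier penult. delta f = top_frac
    ((xs ! j) [^] (N::nat)) (P [^] N)"
proof -
  let ?U = "top_set - {j}"
  interpret T: module R "Top" by (rule part_module) simp
  interpret F: module_of_fractions R "self_module R" "cech_powers R xs top_set"
    by (rule part_fractions) simp
  interpret U: module_of_fractions R "self_module R" "cech_powers R xs ?U"
    by (rule part_fractions) auto
  let ?s = "csign j"
  have uc: "sub_prod ?U \<in> carrier R" by (rule sub_prod_closed) auto
  have pm: "sub_prod ?U [^] N \<in> cech_powers R xs ?U" unfolding cech_powers_def powers_def by blast
  have xj: "xs ! j \<in> carrier R" by (rule nth_closed[OF j])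
  define f where "f = (\<lambda>T\<in>subsets_of_card ell (ell - 1).
    if T = ?U then frac R (cech_powers R xs ?U) (self_module R) ?s (sub_prod ?U [^] N) else \<zero>\<^bsub>part T\<^esub>)"
  have f: "f \<in> carrier penult"
    unfolding cech_def prod_module_simps f_def
  proof (rule restrict_PiE_iff[THEN iffD2], rule ballI)
    fix T assume T: "T \<in> subsets_of_card ell (ell - 1)"
    then have Ts: "T \<subseteq> top_set" by (simp add: subsets_of_card_def)
    show "(if T = ?U then frac R (cech_powers R xs ?U) (self_module R) ?s (sub_prod ?U [^] N)
        else \<zero>\<^bsub>part T\<^esub>) \<in> carrier (part T)"
    proof (cases "T = ?U")
      case True
      then show ?thesis using U.fracI[of ?s "sub_prod ?U [^] N"] pm by simp
    next
      case False
      interpret V: module R "part T" by (rule part_module[OF Ts])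
      show ?thesis using False by simp
    qed
  qed
  define y where "y = top_frac ((xs ! j) [^] N) (P [^] N)"
  have yc: "y \<in> carrier (Top)" unfolding y_def using xj by (intro F.fracI P_pow_mem) simp
  have tj: "?s \<odot>\<^bsub>Top\<^esub> to_top (f ?U) = y"
  proof -
    have fU: "f ?U = frac R (cech_powers R xs ?U) (self_module R) ?s (sub_prod ?U [^] N)"
      unfolding f_def using top_minus[OF j] by simp
    have "?s \<odot>\<^bsub>Top\<^esub> to_top (f ?U) = to_top (?s \<odot>\<^bsub>part ?U\<^esub> f ?U)"
      by (rule to_top_linear(2)[OF j penult_coord[OF f j] csign_closed, symmetric])
    also have "?s \<odot>\<^bsub>part ?U\<^esub> f ?U = frac R (cech_powers R xs ?U) (self_module R) \<one> (sub_prod ?U [^] N)"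
    proof -
      have "?s \<otimes> ?s = (\<ominus> \<one> \<otimes> \<ominus> \<one>) [^] card {k \<in> top_set. k < j}"
        by (simp add: csign_def nat_pow_distrib)
      also have "\<dots> = \<one>" by (simp add: l_minus)
      finally show ?thesis unfolding fU using U.fractions_smult[OF csign_closed _ pm, of ?s] by simp
    qed
    also have "to_top \<dots> = top_frac \<one> (sub_prod ?U [^] N)"
      by (rule U.loc_map_frac[OF F.module_of_fractions_axioms cech_powers_divides _ pm]) auto
    also have "\<dots> = y" unfolding y_def
    proof (rule F.frac_eqI'[of _ _ _ _ \<one> \<one> \<one> "(xs ! j) [^] N"])
      have "sub_prod {j} \<otimes> sub_prod ?U = P"
      proof -
        have "top_set - ?U = {j}" using j by auto
        then show ?thesis using sub_prod_split[of ?U] by auto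
      qed
      moreover have "sub_prod {j} = xs ! j" using finprod_insert[of "{}" j "\<lambda>j. xs ! j"] xj by simp
      ultimately have P: "(xs ! j) \<otimes> sub_prod ?U = P" by simp
      then have PN: "(xs ! j) [^] N \<otimes> sub_prod ?U [^] N = P [^] N"
        using xj uc by (simp flip: nat_pow_distrib)
      then show "(xs ! j) [^] N \<otimes> sub_prod ?U [^] N \<in> cech_powers R xs top_set" using P_pow_mem by simp
      show "(\<one> \<otimes> sub_prod ?U [^] N) \<odot>\<^bsub>self_module R\<^esub> (xs ! j) [^] N =
          (\<one> \<otimes> P [^] N) \<odot>\<^bsub>self_module R\<^esub> \<one>"
        using xj uc P_closed PN by (simp add: m_comm)
    qed (use xj uc P_closed P_pow_mem F.one_S in auto)
    finally show ?thesis .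
  qed
  have other: "to_top (f (top_set - {i})) = \<zero>\<^bsub>Top\<^esub>" if i: "i < ell" "i \<noteq> j" for i
  proof -
    let ?V = "top_set - {i}"
    interpret V: module R "part ?V" by (rule part_module) auto
    have "?V \<noteq> ?U" using i j by blast
    then have fV: "f ?V = \<zero>\<^bsub>part ?V\<^esub>" unfolding f_def using top_minus[OF i(1)] by simp
    have "to_top (\<zero> \<odot>\<^bsub>part ?V\<^esub> f ?V) = \<zero> \<odot>\<^bsub>Top\<^esub> to_top (f ?V)"
      by (rule to_top_linear(2)[OF i(1) penult_coord[OF f i(1)] zero_closed])
    then show ?thesis using delta_term_closed[OF f i(1)] by (simp add: fV)
  qed
  have "delta f = (\<Oplus>\<^bsub>Top\<^esub>i\<in>top_set. if j = i then y else \<zero>\<^bsub>Top\<^esub>)"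
    unfolding delta_def
    by (rule T.M.finsum_cong') (use tj other yc in auto)
  also have "\<dots> = y" by (rule T.M.finsum_singleton) (use j yc in auto)
  finally show ?thesis using f unfolding y_def by blast
qed

text \<open>The numerators of the coboundaries with denominator \<open>P\<^sup>N\<close> form an ideal, and it contains
each \<open>x\<^sub>j\<^sup>N\<close>.\<close>

lemma delta_attains_Idl:
  assumes c: "c \<in> Idl (pow_set R N xs)"
  shows "\<exists>f\<in>carrier penult. delta f = top_frac c (P [^] N)"
proof -
  interpret F: module_of_fractions R "self_module R" "cech_powers R xs top_set"
    by (rule part_fractions) simp
  interpret C: module R penult by (rule cech_module)
  let ?y = "\<lambda>c. top_frac c (P [^] N)"
  define J where "J = {c \<in> carrier R. \<exists>f\<in>carrier penult. delta f = ?y c}"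
  have gen: "pow_set R N xs \<subseteq> J"
  proof
    fix y assume "y \<in> pow_set R N xs"
    then obtain j where "j < ell" "y = (xs ! j) [^] N" by (auto simp: pow_set_def in_set_conv_nth)
    then show "y \<in> J" using delta_generator[of j N] nth_closed[of j] by (simp add: J_def)
  qed
  have "ideal J R"
  proof (rule ideal_of_closed)
    show "J \<subseteq> carrier R" by (auto simp: J_def)
    show "J \<noteq> {}" using gen nonempty by (auto simp: pow_set_def)
    fix c assume "c \<in> J"
    then obtain f where f: "c \<in> carrier R" "f \<in> carrier penult" "delta f = ?y c" by (auto simp: J_def)
    {
      fix d assume "d \<in> J"
      then obtain g where g: "d \<in> carrier R" "g \<in> carrier penult" "delta g = ?y d" by (auto simp: J_def)
      have "delta (f \<oplus>\<^bsub>penult\<^esub> g) = ?y (c \<oplus> d)"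
        unfolding delta_add[OF f(2) g(2)] f(3) g(3)
        using F.fractions_add_same[OF _ _ P_pow_mem, of c d] f(1) g(1) by simp
      then show "c \<oplus> d \<in> J" using f(1) g(1) C.M.a_closed[OF f(2) g(2)] unfolding J_def by blast
    next
      fix a assume a: "a \<in> carrier R"
      have "delta (a \<odot>\<^bsub>penult\<^esub> f) = ?y (a \<otimes> c)"
        unfolding delta_smult[OF f(2) a] f(3) using F.fractions_smult[OF a _ P_pow_mem, of c] f(1) by simp
      then show "a \<otimes> c \<in> J" using f a C.smult_closed[OF a f(2)] unfolding J_def by blast
    }
  qed
  then have "Idl (pow_set R N xs) \<subseteq> J" using gen by (rule genideal_minimal)
  then show ?thesis using c by (auto simp: J_def)
qed

abbreviation "topC \<equiv> cech R (self_module R) xs ell"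

lemma topC_simps:
  "carrier topC = (\<Pi>\<^sub>E T\<in>{top_set}. carrier (part T))"
  "\<zero>\<^bsub>topC\<^esub> = (\<lambda>T\<in>{top_set}. \<zero>\<^bsub>part T\<^esub>)"
  "f \<oplus>\<^bsub>topC\<^esub> g = (\<lambda>T\<in>{top_set}. f T \<oplus>\<^bsub>part T\<^esub> g T)"
  "r \<odot>\<^bsub>topC\<^esub> f = (\<lambda>T\<in>{top_set}. r \<odot>\<^bsub>part T\<^esub> f T)"
  unfolding cech_def prod_module_simps subsets_top by simp_all

abbreviation "bdry \<equiv> cech_coboundaries R (self_module R) xs ell"

lemma bdry_submodule: "submodule bdry R topC"
proof -
  interpret C: module R topC by (rule cech_module)
  interpret D: module R penult by (rule cech_module)
  have sm: "r \<odot>\<^bsub>topC\<^esub> x \<in> bdry" if rx: "r \<in> carrier R" "x \<in> bdry" for r x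
  proof -
    obtain f where f: "f \<in> carrier penult" "x = (\<lambda>T\<in>{top_set}. delta f)"
      using rx(2) unfolding coboundaries_eq by blast
    have "r \<odot>\<^bsub>topC\<^esub> x = (\<lambda>T\<in>{top_set}. delta (r \<odot>\<^bsub>penult\<^esub> f))"
      unfolding f(2) topC_simps delta_smult[OF f(1) rx(1)] by (rule restrict_ext) simp
    then show ?thesis unfolding coboundaries_eq using D.smult_closed[OF rx(1) f(1)] by blast
  qed
  have sub: "bdry \<subseteq> carrier topC"
  proof
    fix b assume "b \<in> bdry"
    then obtain f where "f \<in> carrier penult" "b = (\<lambda>T\<in>{top_set}. delta f)"
      unfolding coboundaries_eq by blast
    then show "b \<in> carrier topC" unfolding topC_simps using delta_closed[of f] by simp
  qed
  have ne: "(\<lambda>T\<in>{top_set}. delta \<zero>\<^bsub>penult\<^esub>) \<in> bdry" unfolding coboundaries_eq using D.M.zero_closed by blast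
  show ?thesis
  proof (rule C.submoduleI[OF sub _ _ _ sm])
    show "\<zero>\<^bsub>topC\<^esub> \<in> bdry" using sm[OF zero_closed ne] C.smult_l_null[OF rev_subsetD[OF ne sub]] by simp
    show "\<ominus>\<^bsub>topC\<^esub> a \<in> bdry" if a: "a \<in> bdry" for a
    proof -
      have ac: "a \<in> carrier topC" using a sub by blast
      have "(\<ominus> \<one>) \<odot>\<^bsub>topC\<^esub> a \<in> bdry" by (rule sm[OF _ a]) simp
      then show ?thesis using C.smult_l_minus[OF one_closed ac] ac by simp
    qed
    fix a b assume "a \<in> bdry" "b \<in> bdry"
    then obtain f g where f: "f \<in> carrier penult" "a = (\<lambda>T\<in>{top_set}. delta f)"
      and g: "g \<in> carrier penult" "b = (\<lambda>T\<in>{top_set}. delta g)"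
      unfolding coboundaries_eq by blast
    have "a \<oplus>\<^bsub>topC\<^esub> b = (\<lambda>T\<in>{top_set}. delta (f \<oplus>\<^bsub>penult\<^esub> g))"
      unfolding f(2) g(2) topC_simps delta_add[OF f(1) g(1)] by (rule restrict_ext) simp
    then show "a \<oplus>\<^bsub>topC\<^esub> b \<in> bdry" unfolding coboundaries_eq using D.M.a_closed[OF f(1) g(1)] by blast
  qed
qed

lemma top_cohomology_eq:
  "cech_cohomology R (self_module R) xs ell = quot_module topC bdry"
proof -
  have "subsets_of_card ell (Suc ell) = {}"
  proof -
    have "card T \<noteq> Suc ell" if "T \<subseteq> top_set" for T using card_mono[OF _ that] by simp
    then show ?thesis by (simp add: subsets_of_card_def)
  qed
  then have "cech_diff R (self_module R) xs ell z = \<zero>\<^bsub>cech R (self_module R) xs (Suc ell)\<^esub>" for z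
    by (simp add: cech_diff_def cech_def prod_module_simps restrict_def)
  then show ?thesis by (simp add: cech_cohomology_def homology_module_def)
qed

text \<open>If the condition fails, then every class \<open>a/P\<^sup>n\<close> is killed by some \<open>s \<notin> p\<close>: the numerator of
\<open>s a/P\<^sup>n = s a P\<^sup>k/P\<^bsup>n+k\<^esup>\<close> lies in the ideal of numerators of coboundaries.\<close>

theorem monomial_condition_of_nonzero_localization:
  assumes p: "primeideal p R"
    and nz: "carrier (loc_module R (carrier R - p) (cech_cohomology R (self_module R) xs ell)) \<noteq>
      {\<zero>\<^bsub>loc_module R (carrier R - p) (cech_cohomology R (self_module R) xs ell)\<^esub>}"
  shows "monomial_condition R xs p"
proof (rule ccontr)
  assume "\<not> monomial_condition R xs p"
  then have kill: "\<exists>k. \<exists>s\<in>carrier R - p. s \<otimes> P [^] k \<in> Idl (pow_set R (n + k) xs)" for n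
    unfolding monomial_condition_def by blast
  let ?H = "quot_module topC bdry"
  interpret C: module R topC by (rule cech_module)
  interpret F: module_of_fractions R "self_module R" "cech_powers R xs top_set"
    by (rule part_fractions) simp
  have Hmod: "module R ?H" by (rule C.quot_module_is_module[OF bdry_submodule])
  have "module_of_fractions R ?H (carrier R - p)"
  proof (intro module_of_fractions.intro module_of_fractions_axioms.intro Hmod)
    show "\<one> \<in> carrier R - p" using primeideal_one_notin[OF p] by simp
    show "s \<otimes> t \<in> carrier R - p" if "s \<in> carrier R - p" "t \<in> carrier R - p" for s t
      using that primeideal_not_mem_mult[OF p] by simp
  qed auto
  then interpret H: module_of_fractions R ?H "carrier R - p" .
  have ann: "\<exists>s\<in>carrier R - p. s \<odot>\<^bsub>?H\<^esub> X = \<zero>\<^bsub>?H\<^esub>" if X: "X \<in> carrier ?H" for X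
  proof -
    obtain z where z: "z \<in> carrier topC" "X = bdry +>\<^bsub>topC\<^esub> z"
      using X unfolding C.quot_module_simps(1)[OF bdry_submodule] by blast
    have "z top_set \<in> carrier (Top)" using z(1) unfolding topC_simps by auto
    then obtain a t where a: "a \<in> carrier R" "t \<in> cech_powers R xs top_set"
      "z top_set = top_frac a t"
      unfolding F.fractions_carrier by auto
    obtain n where n: "t = P [^] (n::nat)" using a(2) unfolding cech_powers_def sub_prod_top by (auto simp: powers_def)
    obtain k s where s: "s \<in> carrier R - p" "s \<otimes> P [^] k \<in> Idl (pow_set R (n + k) xs)" using kill by blast
    have sc: "s \<in> carrier R" using s(1) by simp
    have "a \<otimes> (s \<otimes> P [^] k) \<in> Idl (pow_set R (n + k) xs)"
      by (rule ideal_simps(4)[OF genideal_ideal[OF pow_set_closed[OF xs]] s(2) a(1)])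
    then obtain f where f: "f \<in> carrier penult" "delta f =
        top_frac (a \<otimes> (s \<otimes> P [^] k)) (P [^] (n + k))"
      using delta_attains_Idl by blast
    have "delta f = top_frac (s \<otimes> a) (P [^] n)"
      unfolding f(2)
    proof (rule F.frac_eqI[of _ _ _ _ \<one>])
      show "(\<one> \<otimes> P [^] (n + k)) \<odot>\<^bsub>self_module R\<^esub> (s \<otimes> a) =
          (\<one> \<otimes> P [^] n) \<odot>\<^bsub>self_module R\<^esub> (a \<otimes> (s \<otimes> P [^] k))"
        using a(1) sc P_closed by (simp add: m_ac flip: nat_pow_mult)
    qed (use a(1) sc P_closed P_pow_mem F.one_S in auto)
    also have "\<dots> = s \<odot>\<^bsub>Top\<^esub> z top_set"
      unfolding a(3) n using F.fractions_smult[OF sc _ P_pow_mem, of a] a(1) by simp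
    finally have "s \<odot>\<^bsub>topC\<^esub> z = (\<lambda>T\<in>{top_set}. delta f)"
      unfolding topC_simps by (intro restrict_ext) simp
    then have mem: "s \<odot>\<^bsub>topC\<^esub> z \<in> bdry" unfolding coboundaries_eq using f(1) by blast
    interpret B: abelian_subgroup bdry topC by (rule C.submodule_abelian_subgroup[OF bdry_submodule])
    have "s \<odot>\<^bsub>?H\<^esub> X = bdry +>\<^bsub>topC\<^esub> (s \<odot>\<^bsub>topC\<^esub> z)"
      unfolding z(2) by (rule C.quot_module_simps(4)[OF bdry_submodule sc z(1)])
    also have "\<dots> = \<zero>\<^bsub>?H\<^esub>" using B.a_rcos_const[OF mem] by (simp add: quot_module_def)
    finally show ?thesis using s(1) by blast
  qed
  have "X = \<zero>\<^bsub>loc_module R (carrier R - p) ?H\<^esub>"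
    if X: "X \<in> carrier (loc_module R (carrier R - p) ?H)" for X
  proof -
    obtain c t where c: "c \<in> carrier ?H" "t \<in> carrier R - p" "X = frac R (carrier R - p) ?H c t"
      using X unfolding H.fractions_carrier by blast
    obtain s where s: "s \<in> carrier R - p" "s \<odot>\<^bsub>?H\<^esub> c = \<zero>\<^bsub>?H\<^esub>" using ann[OF c(1)] by blast
    have "frac R (carrier R - p) ?H c t = frac R (carrier R - p) ?H \<zero>\<^bsub>?H\<^esub> \<one>"
      by (rule H.frac_eqI[of _ _ _ _ s]) (use c s H.one_S in auto)
    then show ?thesis by (simp add: c(3) H.fractions_zero)
  qed
  moreover have "\<zero>\<^bsub>loc_module R (carrier R - p) ?H\<^esub> \<in> carrier (loc_module R (carrier R - p) ?H)"
    unfolding H.fractions_zero using H.one_S by (intro H.fracI) auto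
  ultimately have "carrier (loc_module R (carrier R - p) ?H) = {\<zero>\<^bsub>loc_module R (carrier R - p) ?H\<^esub>}" by blast
  then show False using nz unfolding top_cohomology_eq by simp
qed

end

section \<open>Direct limits of rings\<close>

context direct_system
begin

abbreviation "cls \<equiv> dlim_class \<Gamma> leq A \<phi>"
abbreviation "D \<equiv> direct_limit \<Gamma> leq A \<phi>"

lemma phi_closed: "\<lbrakk>i \<in> \<Gamma>; j \<in> \<Gamma>; leq i j; a \<in> carrier (A i)\<rbrakk> \<Longrightarrow> \<phi> i j a \<in> carrier (A j)"
  using ring_hom_closed[OF hom] .

lemma phi_eq_mono:
  assumes "i \<in> \<Gamma>" "a \<in> carrier (A i)" "j \<in> \<Gamma>" "b \<in> carrier (A j)" "k \<in> \<Gamma>" "u \<in> \<Gamma>"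
    and "leq i k" "leq j k" "leq k u" "\<phi> i k a = \<phi> j k b"
  shows "\<phi> i u a = \<phi> j u b"
  using hom_comp[OF assms(1,5,6,7,9,2)] hom_comp[OF assms(3,5,6,8,9,4)] assms(10) by simp

lemma cls_subset:
  assumes i: "i \<in> \<Gamma>" "a \<in> carrier (A i)" and j: "j \<in> \<Gamma>" "b \<in> carrier (A j)"
    and k: "k \<in> \<Gamma>" "leq i k" "leq j k" "\<phi> i k a = \<phi> j k b"
  shows "cls i a \<subseteq> cls j b"
proof
  fix x assume "x \<in> cls i a"
  then obtain u c v where x: "x = (u, c)" "u \<in> \<Gamma>" "c \<in> carrier (A u)"
    and v: "v \<in> \<Gamma>" "leq i v" "leq u v" "\<phi> i v a = \<phi> u v c"
    unfolding dlim_class_def by blast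
  obtain w where w: "w \<in> \<Gamma>" "leq k w" "leq v w" using directed[OF k(1) v(1)] by blast
  have "\<phi> j w b = \<phi> u w c"
    using phi_eq_mono[OF i j k(1) w(1) k(2,3) w(2) k(4)]
      phi_eq_mono[OF i x(2,3) v(1) w(1) v(2,3) w(3) v(4)] by simp
  moreover have "leq j w" "leq u w"
    using le_trans[OF j(1) k(1) w(1) k(3) w(2)] le_trans[OF x(2) v(1) w(1) v(3) w(3)] .
  ultimately show "x \<in> cls j b" unfolding dlim_class_def using x w(1) by blast
qed

lemma cls_eqI:
  assumes "i \<in> \<Gamma>" "a \<in> carrier (A i)" "j \<in> \<Gamma>" "b \<in> carrier (A j)"
    "k \<in> \<Gamma>" "leq i k" "leq j k" "\<phi> i k a = \<phi> j k b"
  shows "cls i a = cls j b"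
  using cls_subset[OF assms] cls_subset[OF assms(3,4,1,2,5,7,6) assms(8)[symmetric]] by (rule equalityI)

lemma cls_self: "i \<in> \<Gamma> \<Longrightarrow> a \<in> carrier (A i) \<Longrightarrow> (i, a) \<in> cls i a"
  unfolding dlim_class_def using le_refl by blast

lemma cls_memD:
  assumes "i \<in> \<Gamma>" "a \<in> carrier (A i)" "(j, b) \<in> cls i a"
  shows "j \<in> \<Gamma>" "b \<in> carrier (A j)" "cls j b = cls i a"
proof -
  obtain k where *: "j \<in> \<Gamma>" "b \<in> carrier (A j)" "k \<in> \<Gamma>" "leq i k" "leq j k" "\<phi> i k a = \<phi> j k b"
    using assms(3) unfolding dlim_class_def by blast
  then show "j \<in> \<Gamma>" "b \<in> carrier (A j)" by simp_all
  show "cls j b = cls i a" using cls_eqI[OF assms(1,2) *] by simp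
qed

lemma cls_eqD:
  assumes "i \<in> \<Gamma>" "j \<in> \<Gamma>" "b \<in> carrier (A j)" "cls i a = cls j b"
  shows "\<exists>k\<in>\<Gamma>. leq i k \<and> leq j k \<and> \<phi> i k a = \<phi> j k b"
  using cls_self[OF assms(2,3)] unfolding assms(4)[symmetric] by (simp add: dlim_class_def)

lemma cls_up:
  assumes "i \<in> \<Gamma>" "j \<in> \<Gamma>" "leq i j" "a \<in> carrier (A i)"
  shows "cls j (\<phi> i j a) = cls i a"
  by (rule cls_eqI[OF assms(2) phi_closed[OF assms] assms(1,4) assms(2) le_refl[OF assms(2)] assms(3)])
     (simp add: hom_id[OF assms(2) phi_closed[OF assms]])

lemma D_carrier: "X \<in> carrier D \<longleftrightarrow> (\<exists>i\<in>\<Gamma>. \<exists>a\<in>carrier (A i). X = cls i a)"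
  by (auto simp: direct_limit_def)

lemma cls_closed: "i \<in> \<Gamma> \<Longrightarrow> a \<in> carrier (A i) \<Longrightarrow> cls i a \<in> carrier D"
  unfolding D_carrier by blast

text \<open>The operation is a union over all representatives and all stages beyond theirs. Each contributes the
same class, because the values agree at a sufficiently late stage.\<close>

lemma dlim_op_cls:
  assumes f: "\<And>k x y. \<lbrakk>k \<in> \<Gamma>; x \<in> carrier (A k); y \<in> carrier (A k)\<rbrakk> \<Longrightarrow> f k x y \<in> carrier (A k)"
    and \<phi>f: "\<And>k u x y. \<lbrakk>k \<in> \<Gamma>; u \<in> \<Gamma>; leq k u; x \<in> carrier (A k); y \<in> carrier (A k)\<rbrakk> \<Longrightarrow>
      \<phi> k u (f k x y) = f u (\<phi> k u x) (\<phi> k u y)"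
    and i: "i \<in> \<Gamma>" "a \<in> carrier (A i)" "b \<in> carrier (A i)"
  shows "dlim_op \<Gamma> leq A \<phi> f (cls i a) (cls i b) = cls i (f i a b)"
proof -
  have eq: "cls v (f v (\<phi> j v c) (\<phi> k v d)) = cls i (f i a b)"
    if mem: "(j, c) \<in> cls i a" "(k, d) \<in> cls i b" and v: "v \<in> \<Gamma>" "leq j v" "leq k v" for j c k d v
  proof -
    note c = cls_memD[OF i(1,2) mem(1)] and d = cls_memD[OF i(1,3) mem(2)]
    define c' where "c' = \<phi> j v c"
    define d' where "d' = \<phi> k v d"
    have c': "c' \<in> carrier (A v)" "cls v c' = cls i a"
      unfolding c'_def using phi_closed[OF c(1) v(1,2) c(2)] cls_up[OF c(1) v(1,2) c(2)] c(3) by simp_all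
    have d': "d' \<in> carrier (A v)" "cls v d' = cls i b"
      unfolding d'_def using phi_closed[OF d(1) v(1,3) d(2)] cls_up[OF d(1) v(1,3) d(2)] d(3) by simp_all
    obtain u1 where u1: "u1 \<in> \<Gamma>" "leq v u1" "leq i u1" "\<phi> v u1 c' = \<phi> i u1 a"
      using cls_eqD[OF v(1) i(1,2) c'(2)] by blast
    obtain u2 where u2: "u2 \<in> \<Gamma>" "leq v u2" "leq i u2" "\<phi> v u2 d' = \<phi> i u2 b"
      using cls_eqD[OF v(1) i(1,3) d'(2)] by blast
    obtain w where w: "w \<in> \<Gamma>" "leq u1 w" "leq u2 w" using directed[OF u1(1) u2(1)] by blast
    have le: "leq v w" "leq i w"
      using le_trans[OF v(1) u1(1) w(1) u1(2) w(2)] le_trans[OF i(1) u1(1) w(1) u1(3) w(2)] .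
    have 1: "\<phi> v w c' = \<phi> i w a"
      by (rule phi_eq_mono[OF v(1) c'(1) i(1,2) u1(1) w(1) u1(2,3) w(2) u1(4)])
    have 2: "\<phi> v w d' = \<phi> i w b"
      by (rule phi_eq_mono[OF v(1) d'(1) i(1,3) u2(1) w(1) u2(2,3) w(3) u2(4)])
    show ?thesis unfolding c'_def[symmetric] d'_def[symmetric]
    proof (rule cls_eqI[OF v(1) f[OF v(1) c'(1) d'(1)] i(1) f[OF i] w(1) le])
      show "\<phi> v w (f v c' d') = \<phi> i w (f i a b)"
        using \<phi>f[OF v(1) w(1) le(1) c'(1) d'(1)] \<phi>f[OF i(1) w(1) le(2) i(2,3)] 1 2 by simp
    qed
  qed
  show ?thesis
  proof
    show "dlim_op \<Gamma> leq A \<phi> f (cls i a) (cls i b) \<subseteq> cls i (f i a b)"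
    proof
      fix z assume "z \<in> dlim_op \<Gamma> leq A \<phi> f (cls i a) (cls i b)"
      then obtain j c k d v where "(j, c) \<in> cls i a" "(k, d) \<in> cls i b" "v \<in> \<Gamma>" "leq j v" "leq k v"
        and "z \<in> cls v (f v (\<phi> j v c) (\<phi> k v d))" unfolding dlim_op_def by blast
      then show "z \<in> cls i (f i a b)" using eq by simp
    qed
    show "cls i (f i a b) \<subseteq> dlim_op \<Gamma> leq A \<phi> f (cls i a) (cls i b)"
    proof
      fix z assume "z \<in> cls i (f i a b)"
      then have "z \<in> cls i (f i (\<phi> i i a) (\<phi> i i b))" by (simp add: hom_id i)
      then show "z \<in> dlim_op \<Gamma> leq A \<phi> f (cls i a) (cls i b)"
        unfolding dlim_op_def using cls_self[OF i(1,2)] cls_self[OF i(1,3)] i(1) le_refl[OF i(1)] by blast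
    qed
  qed
qed

lemma stage_ring: "i \<in> \<Gamma> \<Longrightarrow> Ring.ring (A i)"
  using ring cring.axioms(1) by blast

lemma cls_mult:
  assumes "i \<in> \<Gamma>" "a \<in> carrier (A i)" "b \<in> carrier (A i)"
  shows "cls i a \<otimes>\<^bsub>D\<^esub> cls i b = cls i (a \<otimes>\<^bsub>A i\<^esub> b)"
proof -
  have "cls i a \<otimes>\<^bsub>D\<^esub> cls i b = dlim_op \<Gamma> leq A \<phi> (\<lambda>k. monoid.mult (A k)) (cls i a) (cls i b)"
    by (simp add: direct_limit_def)
  also have "\<dots> = cls i (a \<otimes>\<^bsub>A i\<^esub> b)"
    by (rule dlim_op_cls[OF _ _ assms])
       (simp_all add: ring_hom_mult[OF hom] monoid.m_closed[OF ring.is_monoid[OF stage_ring]])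
  finally show ?thesis .
qed

lemma cls_add:
  assumes "i \<in> \<Gamma>" "a \<in> carrier (A i)" "b \<in> carrier (A i)"
  shows "cls i a \<oplus>\<^bsub>D\<^esub> cls i b = cls i (a \<oplus>\<^bsub>A i\<^esub> b)"
proof -
  have "cls i a \<oplus>\<^bsub>D\<^esub> cls i b = dlim_op \<Gamma> leq A \<phi> (\<lambda>k. add (A k)) (cls i a) (cls i b)"
    by (simp add: direct_limit_def)
  also have "\<dots> = cls i (a \<oplus>\<^bsub>A i\<^esub> b)"
    by (rule dlim_op_cls[OF _ _ assms])
       (simp_all add: ring_hom_add[OF hom] abelian_monoid.a_closed[OF abelian_group.axioms(1)[OF ring.is_abelian_group[OF stage_ring]]])
  finally show ?thesis .
qed

lemma cls_const:
  assumes c: "\<And>i. i \<in> \<Gamma> \<Longrightarrow> c i \<in> carrier (A i)"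
    and \<phi>c: "\<And>i j. \<lbrakk>i \<in> \<Gamma>; j \<in> \<Gamma>; leq i j\<rbrakk> \<Longrightarrow> \<phi> i j (c i) = c j"
    and i: "i \<in> \<Gamma>"
  shows "(\<Union>j\<in>\<Gamma>. cls j (c j)) = cls i (c i)"
proof -
  have "cls j (c j) = cls i (c i)" if j: "j \<in> \<Gamma>" for j
  proof -
    obtain k where k: "k \<in> \<Gamma>" "leq i k" "leq j k" using directed[OF i j] by blast
    show ?thesis
      by (rule cls_eqI[OF j c[OF j] i c[OF i] k(1,3,2)]) (simp add: \<phi>c i j k)
  qed
  then have "(\<Union>j\<in>\<Gamma>. cls j (c j)) = (\<Union>j\<in>\<Gamma>. cls i (c i))" by (intro SUP_cong refl)
  then show ?thesis using i by auto
qed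

lemma cls_one: "i \<in> \<Gamma> \<Longrightarrow> \<one>\<^bsub>D\<^esub> = cls i \<one>\<^bsub>A i\<^esub>"
  using cls_const[of "\<lambda>i. \<one>\<^bsub>A i\<^esub>" i] ring_hom_one[OF hom]
    monoid.one_closed[OF ring.is_monoid[OF stage_ring]]
  by (simp add: direct_limit_def)

lemma cls_zero: "i \<in> \<Gamma> \<Longrightarrow> \<zero>\<^bsub>D\<^esub> = cls i \<zero>\<^bsub>A i\<^esub>"
  using cls_const[of "\<lambda>i. \<zero>\<^bsub>A i\<^esub>" i] ring_hom_zero[OF hom stage_ring stage_ring]
    ring.ring_simprules(2)[OF stage_ring]
  by (simp add: direct_limit_def)

lemma lift_stage:
  assumes "X \<in> carrier D" "i \<in> \<Gamma>"
  obtains j a where "j \<in> \<Gamma>" "leq i j" "a \<in> carrier (A j)" "X = cls j a"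
proof -
  obtain k a where k: "k \<in> \<Gamma>" "a \<in> carrier (A k)" "X = cls k a" using assms(1) unfolding D_carrier by blast
  obtain j where j: "j \<in> \<Gamma>" "leq i j" "leq k j" using directed[OF assms(2) k(1)] by blast
  show ?thesis
    using that[OF j(1,2) phi_closed[OF k(1) j(1,3) k(2)]] cls_up[OF k(1) j(1,3) k(2)] k(3) by simp
qed

lemma common_stage2:
  assumes "X \<in> carrier D" "Y \<in> carrier D"
  obtains i a b where "i \<in> \<Gamma>" "a \<in> carrier (A i)" "b \<in> carrier (A i)" "X = cls i a" "Y = cls i b"
proof -
  obtain i a where i: "i \<in> \<Gamma>" "a \<in> carrier (A i)" "X = cls i a" using assms(1) unfolding D_carrier by blast
  obtain j b where j: "j \<in> \<Gamma>" "leq i j" "b \<in> carrier (A j)" "Y = cls j b" using lift_stage[OF assms(2) i(1)] .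
  show ?thesis
    using that[OF j(1) phi_closed[OF i(1) j(1,2) i(2)] j(3)] cls_up[OF i(1) j(1,2) i(2)] i(3) j(4) by simp
qed

lemma common_stage3:
  assumes "X \<in> carrier D" "Y \<in> carrier D" "Z \<in> carrier D"
  obtains i a b c where "i \<in> \<Gamma>" "a \<in> carrier (A i)" "b \<in> carrier (A i)" "c \<in> carrier (A i)"
    "X = cls i a" "Y = cls i b" "Z = cls i c"
proof -
  obtain i a b where i: "i \<in> \<Gamma>" "a \<in> carrier (A i)" "b \<in> carrier (A i)" "X = cls i a" "Y = cls i b"
    using common_stage2[OF assms(1,2)] .
  obtain j c where j: "j \<in> \<Gamma>" "leq i j" "c \<in> carrier (A j)" "Z = cls j c" using lift_stage[OF assms(3) i(1)] .
  show ?thesis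
    using that[OF j(1) phi_closed[OF i(1) j(1,2) i(2)] phi_closed[OF i(1) j(1,2) i(3)] j(3)]
      cls_up[OF i(1) j(1,2) i(2)] cls_up[OF i(1) j(1,2) i(3)] i(4,5) j(4) by simp
qed

theorem direct_limit_cring: "cring D"
proof (rule cringI)
  show "abelian_group D"
  proof (rule abelian_groupI)
    fix X Y assume XY: "X \<in> carrier D" "Y \<in> carrier D"
    obtain i a b where i: "i \<in> \<Gamma>" "a \<in> carrier (A i)" "b \<in> carrier (A i)" "X = cls i a" "Y = cls i b"
      using common_stage2[OF XY] .
    interpret cring "A i" by (rule ring[OF i(1)])
    show "X \<oplus>\<^bsub>D\<^esub> Y \<in> carrier D" using i by (simp add: cls_add cls_closed)
    show "X \<oplus>\<^bsub>D\<^esub> Y = Y \<oplus>\<^bsub>D\<^esub> X" using i by (simp add: cls_add a_comm)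
  next
    fix X Y Z assume XYZ: "X \<in> carrier D" "Y \<in> carrier D" "Z \<in> carrier D"
    obtain i a b c where i: "i \<in> \<Gamma>" "a \<in> carrier (A i)" "b \<in> carrier (A i)" "c \<in> carrier (A i)"
      "X = cls i a" "Y = cls i b" "Z = cls i c" using common_stage3[OF XYZ] .
    interpret cring "A i" by (rule ring[OF i(1)])
    show "X \<oplus>\<^bsub>D\<^esub> Y \<oplus>\<^bsub>D\<^esub> Z = X \<oplus>\<^bsub>D\<^esub> (Y \<oplus>\<^bsub>D\<^esub> Z)" using i by (simp add: cls_add a_assoc)
  next
    obtain i where i: "i \<in> \<Gamma>" using nonempty by blast
    interpret cring "A i" by (rule ring[OF i])
    show "\<zero>\<^bsub>D\<^esub> \<in> carrier D" using i by (simp add: cls_zero cls_closed)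
  next
    fix X assume "X \<in> carrier D"
    then obtain i a where i: "i \<in> \<Gamma>" "a \<in> carrier (A i)" "X = cls i a" unfolding D_carrier by blast
    interpret cring "A i" by (rule ring[OF i(1)])
    show "\<zero>\<^bsub>D\<^esub> \<oplus>\<^bsub>D\<^esub> X = X" unfolding cls_zero[OF i(1)] using i by (simp add: cls_add)
    have "cls i (\<ominus>\<^bsub>A i\<^esub> a) \<oplus>\<^bsub>D\<^esub> X = \<zero>\<^bsub>D\<^esub>" unfolding cls_zero[OF i(1)] using i by (simp add: cls_add l_neg)
    moreover have "cls i (\<ominus>\<^bsub>A i\<^esub> a) \<in> carrier D" using i by (simp add: cls_closed)
    ultimately show "\<exists>Y\<in>carrier D. Y \<oplus>\<^bsub>D\<^esub> X = \<zero>\<^bsub>D\<^esub>" by blast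
  qed
  show "comm_monoid D"
  proof (rule comm_monoidI)
    fix X Y assume XY: "X \<in> carrier D" "Y \<in> carrier D"
    obtain i a b where i: "i \<in> \<Gamma>" "a \<in> carrier (A i)" "b \<in> carrier (A i)" "X = cls i a" "Y = cls i b"
      using common_stage2[OF XY] .
    interpret cring "A i" by (rule ring[OF i(1)])
    show "X \<otimes>\<^bsub>D\<^esub> Y \<in> carrier D" using i by (simp add: cls_mult cls_closed)
    show "X \<otimes>\<^bsub>D\<^esub> Y = Y \<otimes>\<^bsub>D\<^esub> X" using i by (simp add: cls_mult m_comm)
  next
    fix X Y Z assume XYZ: "X \<in> carrier D" "Y \<in> carrier D" "Z \<in> carrier D"
    obtain i a b c where i: "i \<in> \<Gamma>" "a \<in> carrier (A i)" "b \<in> carrier (A i)" "c \<in> carrier (A i)"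
      "X = cls i a" "Y = cls i b" "Z = cls i c" using common_stage3[OF XYZ] .
    interpret cring "A i" by (rule ring[OF i(1)])
    show "X \<otimes>\<^bsub>D\<^esub> Y \<otimes>\<^bsub>D\<^esub> Z = X \<otimes>\<^bsub>D\<^esub> (Y \<otimes>\<^bsub>D\<^esub> Z)" using i by (simp add: cls_mult m_assoc)
  next
    obtain i where i: "i \<in> \<Gamma>" using nonempty by blast
    interpret cring "A i" by (rule ring[OF i])
    show "\<one>\<^bsub>D\<^esub> \<in> carrier D" using i by (simp add: cls_one cls_closed)
  next
    fix X assume "X \<in> carrier D"
    then obtain i a where i: "i \<in> \<Gamma>" "a \<in> carrier (A i)" "X = cls i a" unfolding D_carrier by blast
    interpret cring "A i" by (rule ring[OF i(1)])
    show "\<one>\<^bsub>D\<^esub> \<otimes>\<^bsub>D\<^esub> X = X" unfolding cls_one[OF i(1)] using i by (simp add: cls_mult)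
  qed
  fix X Y Z assume XYZ: "X \<in> carrier D" "Y \<in> carrier D" "Z \<in> carrier D"
  obtain i a b c where i: "i \<in> \<Gamma>" "a \<in> carrier (A i)" "b \<in> carrier (A i)" "c \<in> carrier (A i)"
    "X = cls i a" "Y = cls i b" "Z = cls i c" using common_stage3[OF XYZ] .
  interpret cring "A i" by (rule ring[OF i(1)])
  show "(X \<oplus>\<^bsub>D\<^esub> Y) \<otimes>\<^bsub>D\<^esub> Z = X \<otimes>\<^bsub>D\<^esub> Z \<oplus>\<^bsub>D\<^esub> Y \<otimes>\<^bsub>D\<^esub> Z"
    using i by (simp add: cls_mult cls_add l_distr)
qed

lemma cls_hom: "i \<in> \<Gamma> \<Longrightarrow> cls i \<in> ring_hom (A i) D"
  by (rule ring_hom_memI) (simp_all add: cls_closed cls_mult cls_add cls_one[of i])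

lemma phi_image_comp:
  assumes "i \<in> \<Gamma>" "j \<in> \<Gamma>" "k \<in> \<Gamma>" "leq i j" "leq j k" "X \<subseteq> carrier (A i)"
  shows "\<phi> j k ` \<phi> i j ` X = \<phi> i k ` X"
  unfolding image_image using hom_comp[OF assms(1-5)] assms(6) by (intro image_cong refl) auto

lemma phi_image_closed:
  assumes "i \<in> \<Gamma>" "j \<in> \<Gamma>" "leq i j" "X \<subseteq> carrier (A i)"
  shows "\<phi> i j ` X \<subseteq> carrier (A j)"
  using phi_closed[OF assms(1-3)] assms(4) by auto

lemma phi_Idl:
  assumes "i \<in> \<Gamma>" "j \<in> \<Gamma>" "k \<in> \<Gamma>" "leq i j" "leq j k" "X \<subseteq> carrier (A i)"
    and e: "e \<in> genideal (A j) (\<phi> i j ` X)"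
  shows "\<phi> j k e \<in> genideal (A k) (\<phi> i k ` X)"
  using hom_Idl[OF ring[OF assms(2)] ring[OF assms(3)] hom[OF assms(2,3,5)]
      phi_image_closed[OF assms(1,2,4,6)] e] phi_image_comp[OF assms(1-6)] by simp

lemma Idl_closed:
  assumes "i \<in> \<Gamma>" "X \<subseteq> carrier (A i)" "e \<in> genideal (A i) X"
  shows "e \<in> carrier (A i)"
  using cring.ideal_simps(1)[OF ring[OF assms(1)] ring.genideal_ideal[OF stage_ring[OF assms(1)] assms(2)] assms(3)] .

text \<open>The classes of elements that lie, at some stage, in the ideal generated by \<open>X\<close> form an ideal of
the limit, since any two of them can be compared at a common later stage.\<close>

lemma mem_Idl_limitD:
  assumes i: "i \<in> \<Gamma>" and X: "X \<subseteq> carrier (A i)" and c: "c \<in> genideal D (cls i ` X)"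
  shows "\<exists>j\<in>\<Gamma>. leq i j \<and> (\<exists>e\<in>genideal (A j) (\<phi> i j ` X). c = cls j e)"
proof -
  interpret D: cring D by (rule direct_limit_cring)
  define K where "K = {cls j e |j e. j \<in> \<Gamma> \<and> leq i j \<and> e \<in> genideal (A j) (\<phi> i j ` X)}"
  have KI: "cls j e \<in> K" if "j \<in> \<Gamma>" "leq i j" "e \<in> genideal (A j) (\<phi> i j ` X)" for j e
    using that unfolding K_def by blast
  have id: "ideal (genideal (A j) (\<phi> i j ` X)) (A j)" if "j \<in> \<Gamma>" "leq i j" for j
    by (rule ring.genideal_ideal[OF stage_ring[OF that(1)] phi_image_closed[OF i that X]])
  have Kc: "K \<subseteq> carrier D"
    unfolding K_def using cls_closed Idl_closed[OF _ phi_image_closed[OF i _ _ X]] by blast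
  have up: "\<exists>e'. e' \<in> genideal (A k) (\<phi> i k ` X) \<and> cls k e' = cls j e"
    if *: "j \<in> \<Gamma>" "leq i j" "e \<in> genideal (A j) (\<phi> i j ` X)" "k \<in> \<Gamma>" "leq j k" for j e k
    using phi_Idl[OF i *(1,4,2,5) X *(3)]
      cls_up[OF *(1,4,5) Idl_closed[OF *(1) phi_image_closed[OF i *(1,2) X] *(3)]] by blast
  have XK: "cls i ` X \<subseteq> K"
  proof
    fix y assume "y \<in> cls i ` X"
    then obtain x where x: "x \<in> X" "y = cls i x" by blast
    have "\<phi> i i x = x" using hom_id[OF i] x X by auto
    then have "x \<in> \<phi> i i ` X" using x(1) by force
    then have "x \<in> genideal (A i) (\<phi> i i ` X)"
      using ring.genideal_self[OF stage_ring[OF i] phi_image_closed[OF i i le_refl[OF i] X]] by blast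
    then show "y \<in> K" unfolding x(2) by (rule KI[OF i le_refl[OF i]])
  qed
  have "ideal K D"
  proof (rule D.ideal_of_closed[OF Kc])
    have "\<zero>\<^bsub>A i\<^esub> \<in> genideal (A i) (\<phi> i i ` X)"
      by (rule cring.ideal_simps(6)[OF ring[OF i] id[OF i le_refl[OF i]]])
    then show "K \<noteq> {}" using KI[OF i le_refl[OF i]] by blast
    fix y assume "y \<in> K"
    then obtain j e where e: "y = cls j e" "j \<in> \<Gamma>" "leq i j" "e \<in> genideal (A j) (\<phi> i j ` X)"
      unfolding K_def by blast
    {
      fix z assume "z \<in> K"
      then obtain k f where f: "z = cls k f" "k \<in> \<Gamma>" "leq i k" "f \<in> genideal (A k) (\<phi> i k ` X)"
        unfolding K_def by blast
      obtain u where u: "u \<in> \<Gamma>" "leq j u" "leq k u" using directed[OF e(2) f(2)] by blast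
      have le: "leq i u" by (rule le_trans[OF i e(2) u(1) e(3) u(2)])
      obtain e' where e': "e' \<in> genideal (A u) (\<phi> i u ` X)" "cls u e' = cls j e" using up[OF e(2-4) u(1,2)] by blast
      obtain f' where f': "f' \<in> genideal (A u) (\<phi> i u ` X)" "cls u f' = cls k f" using up[OF f(2-4) u(1,3)] by blast
      note cl = Idl_closed[OF u(1) phi_image_closed[OF i u(1) le X]]
      have "y \<oplus>\<^bsub>D\<^esub> z = cls u (e' \<oplus>\<^bsub>A u\<^esub> f')"
        unfolding e(1) f(1) e'(2)[symmetric] f'(2)[symmetric]
        by (rule cls_add[OF u(1) cl[OF e'(1)] cl[OF f'(1)]])
      also have "\<dots> \<in> K"
        by (rule KI[OF u(1) le cring.ideal_simps(2)[OF ring[OF u(1)] id[OF u(1) le] e'(1) f'(1)]])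
      finally show "y \<oplus>\<^bsub>D\<^esub> z \<in> K" .
    next
      fix x assume x: "x \<in> carrier D"
      obtain k a where k: "k \<in> \<Gamma>" "leq j k" "a \<in> carrier (A k)" "x = cls k a" using lift_stage[OF x e(2)] .
      have le: "leq i k" by (rule le_trans[OF i e(2) k(1) e(3) k(2)])
      obtain e' where e': "e' \<in> genideal (A k) (\<phi> i k ` X)" "cls k e' = cls j e" using up[OF e(2-4) k(1,2)] by blast
      have "x \<otimes>\<^bsub>D\<^esub> y = cls k (a \<otimes>\<^bsub>A k\<^esub> e')"
        unfolding e(1) k(4) e'(2)[symmetric]
        by (rule cls_mult[OF k(1,3) Idl_closed[OF k(1) phi_image_closed[OF i k(1) le X] e'(1)]])
      also have "\<dots> \<in> K"
        by (rule KI[OF k(1) le cring.ideal_simps(4)[OF ring[OF k(1)] id[OF k(1) le] e'(1) k(3)]])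
      finally show "x \<otimes>\<^bsub>D\<^esub> y \<in> K" .
    }
  qed
  then have "genideal D (cls i ` X) \<subseteq> K" using XK by (rule D.genideal_minimal)
  then show ?thesis using c unfolding K_def by blast
qed

lemma cls_mem_Idl_limitD:
  assumes i: "i \<in> \<Gamma>" and X: "X \<subseteq> carrier (A i)" and a: "a \<in> carrier (A i)"
    and mem: "cls i a \<in> genideal D (cls i ` X)"
  shows "\<exists>j\<in>\<Gamma>. leq i j \<and> \<phi> i j a \<in> genideal (A j) (\<phi> i j ` X)"
proof -
  obtain j e where j: "j \<in> \<Gamma>" "leq i j" "e \<in> genideal (A j) (\<phi> i j ` X)" "cls i a = cls j e"
    using mem_Idl_limitD[OF i X mem] by blast
  have e: "e \<in> carrier (A j)" by (rule Idl_closed[OF j(1) phi_image_closed[OF i j(1,2) X] j(3)])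
  obtain k where k: "k \<in> \<Gamma>" "leq i k" "leq j k" "\<phi> i k a = \<phi> j k e"
    using cls_eqD[OF i j(1) e j(4)] by blast
  then show ?thesis using phi_Idl[OF i j(1) k(1) j(2) k(3) X j(3)] by auto
qed

text \<open>A prime over \<open>p\<close> exists as soon as the ideal that \<open>p\<close> generates in the limit does not meet the image
of the complement of \<open>p\<close>. An element in both would already appear in both at a finite stage, which
lying over for the transition maps excludes.\<close>

theorem lying_over_limit:
  assumes lo: "\<And>i j. \<lbrakk>i \<in> \<Gamma>; j \<in> \<Gamma>; leq i j\<rbrakk> \<Longrightarrow> lying_over (A i) (A j) (\<phi> i j)"
    and i: "i \<in> \<Gamma>"
  shows "lying_over (A i) D (cls i)"
  unfolding lying_over_def
proof (intro allI impI)
  interpret D: cring D by (rule direct_limit_cring)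
  interpret A: cring "A i" by (rule ring[OF i])
  fix p assume p: "primeideal p (A i)"
  have pc: "p \<subseteq> carrier (A i)" using A.ideal_simps(1)[OF primeideal.axioms(1)[OF p]] by blast
  have cc: "cls i ` p \<subseteq> carrier D" using pc cls_closed[OF i] by auto
  define W where "W = cls i ` (carrier (A i) - p)"
  have "\<exists>q. primeideal q D \<and> genideal D (cls i ` p) \<subseteq> q \<and> q \<inter> W = {}"
  proof (rule D.exists_prime_disjoint[OF D.genideal_ideal[OF cc]])
    show "genideal D (cls i ` p) \<inter> W = {}"
    proof (rule ccontr)
      assume "\<not> ?thesis"
      then obtain s where s: "s \<in> carrier (A i)" "s \<notin> p" "cls i s \<in> genideal D (cls i ` p)"
        unfolding W_def by blast
      obtain j where j: "j \<in> \<Gamma>" "leq i j" "\<phi> i j s \<in> genideal (A j) (\<phi> i j ` p)"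
        using cls_mem_Idl_limitD[OF i pc s(1,3)] by blast
      obtain q where q: "primeideal q (A j)" "p = {r \<in> carrier (A i). \<phi> i j r \<in> q}"
        using lo[OF i j(1,2)] p unfolding lying_over_def by blast
      have "genideal (A j) (\<phi> i j ` p) \<subseteq> q"
        by (rule ring.genideal_minimal[OF stage_ring[OF j(1)] primeideal.axioms(1)[OF q(1)]]) (use q(2) in auto)
      then show False using j(3) s(1,2) q(2) by blast
    qed
    show "W \<subseteq> carrier D" unfolding W_def using cls_closed[OF i] by auto
    show "\<one>\<^bsub>D\<^esub> \<in> W" unfolding W_def cls_one[OF i] using A.primeideal_one_notin[OF p] by auto
    fix x y assume "x \<in> W" "y \<in> W"
    then obtain a b where ab: "a \<in> carrier (A i) - p" "b \<in> carrier (A i) - p" "x = cls i a" "y = cls i b"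
      unfolding W_def by blast
    then have "x \<otimes>\<^bsub>D\<^esub> y = cls i (a \<otimes>\<^bsub>A i\<^esub> b)" using cls_mult[OF i] by simp
    moreover have "a \<otimes>\<^bsub>A i\<^esub> b \<in> carrier (A i) - p" using ab A.primeideal_not_mem_mult[OF p] by simp
    ultimately show "x \<otimes>\<^bsub>D\<^esub> y \<in> W" unfolding W_def by blast
  qed
  then obtain q where q: "primeideal q D" "genideal D (cls i ` p) \<subseteq> q" "q \<inter> W = {}" by blast
  have "p = {r \<in> carrier (A i). cls i r \<in> q}"
    using q(2,3) D.genideal_self[OF cc] pc unfolding W_def by blast
  then show "\<exists>q. primeideal q D \<and> p = {r \<in> carrier (A i). cls i r \<in> q}" using q(1) by blast
qed

lemma lift_list:
  assumes "set xs \<subseteq> carrier D"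
  shows "\<exists>i\<in>\<Gamma>. \<exists>ys. set ys \<subseteq> carrier (A i) \<and> xs = map (cls i) ys"
  using assms
proof (induction xs)
  case Nil
  obtain i where "i \<in> \<Gamma>" using nonempty by blast
  then show ?case by (intro bexI[of _ i] exI[of _ "[]"]) auto
next
  case (Cons x xs)
  then obtain i ys where i: "i \<in> \<Gamma>" "set ys \<subseteq> carrier (A i)" "xs = map (cls i) ys" by auto
  have x: "x \<in> carrier D" using Cons.prems by simp
  obtain j a where j: "j \<in> \<Gamma>" "leq i j" "a \<in> carrier (A j)" "x = cls j a" using lift_stage[OF x i(1)] .
  have "set (a # map (\<phi> i j) ys) \<subseteq> carrier (A j)" using phi_closed[OF i(1) j(1,2)] i(2) j(3) by auto
  moreover have "x # xs = map (cls j) (a # map (\<phi> i j) ys)"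
    using cls_up[OF i(1) j(1,2)] i(2,3) j(4) by auto
  ultimately show ?case
    by (intro bexI[OF _ j(1)] exI[of _ "a # map (\<phi> i j) ys"] conjI)
qed

text \<open>Both the hypothesis \<open>x\<^sub>i b \<in> (x\<^sub>j : j < i)\<close> and its conclusion \<open>b \<in> (x\<^sub>j : j < i)\<close> are relations
between finitely many elements, which hold in the limit exactly if they hold at some stage.\<close>

lemma weakly_regular_limit:
  assumes i: "i \<in> \<Gamma>" and ys: "set ys \<subseteq> carrier (A i)"
    and qr: "\<And>j. j \<in> \<Gamma> \<Longrightarrow> leq i j \<Longrightarrow> weakly_regular (A j) (map (\<phi> i j) ys)"
  shows "weakly_regular D (map (cls i) ys)"
  unfolding weakly_regular_def
proof (intro allI impI nzd_modI)
  interpret D: cring D by (rule direct_limit_cring)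
  fix n b assume "n < length (map (cls i) ys)" and b: "b \<in> carrier D"
    and mem: "map (cls i) ys ! n \<otimes>\<^bsub>D\<^esub> b \<in> genideal D (set (take n (map (cls i) ys)))"
  then have n: "n < length ys" by simp
  define X where "X = set (take n ys)"
  have X: "X \<subseteq> carrier (A i)" using ys set_take_subset[of n ys] unfolding X_def by blast
  have yi: "ys ! n \<in> carrier (A i)" using ys n by auto
  have cX: "set (take n (map (cls i) ys)) = cls i ` X" by (simp add: take_map X_def)
  obtain j a where j: "j \<in> \<Gamma>" "leq i j" "a \<in> carrier (A j)" "b = cls j a" using lift_stage[OF b i] .
  let ?y = "\<phi> i j (ys ! n)"
  have y: "?y \<in> carrier (A j)" by (rule phi_closed[OF i j(1,2) yi])
  have up: "cls k ` \<phi> i k ` X = cls i ` X" if "k \<in> \<Gamma>" "leq i k" for k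
    unfolding image_image using cls_up[OF i that] X by (intro image_cong refl) auto
  interpret A: cring "A j" by (rule ring[OF j(1)])
  have "cls j (?y \<otimes>\<^bsub>A j\<^esub> a) \<in> genideal D (cls j ` \<phi> i j ` X)"
    using mem n cls_mult[OF j(1) y j(3)] cls_up[OF i j(1,2) yi] j(4) cX up[OF j(1,2)] by simp
  then obtain k where k: "k \<in> \<Gamma>" "leq j k" "\<phi> j k (?y \<otimes>\<^bsub>A j\<^esub> a) \<in> genideal (A k) (\<phi> j k ` \<phi> i j ` X)"
    using cls_mem_Idl_limitD[OF j(1) phi_image_closed[OF i j(1,2) X] A.m_closed[OF y j(3)]] by blast
  have le: "leq i k" by (rule le_trans[OF i j(1) k(1) j(2) k(2)])
  have "\<phi> i k (ys ! n) \<otimes>\<^bsub>A k\<^esub> \<phi> j k a \<in> genideal (A k) (\<phi> i k ` X)"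
    using k(3) ring_hom_mult[OF hom[OF j(1) k(1,2)] y j(3)]
      phi_image_comp[OF i j(1) k(1) j(2) k(2) X] hom_comp[OF i j(1) k(1) j(2) k(2) yi] by simp
  moreover have "nzd_mod (A k) (genideal (A k) (\<phi> i k ` X)) (\<phi> i k (ys ! n))"
    using qr[OF k(1) le] n unfolding weakly_regular_def X_def by (simp add: take_map)
  ultimately have "\<phi> j k a \<in> genideal (A k) (\<phi> i k ` X)"
    using nzd_modD phi_closed[OF j(1) k(1,2) j(3)] by metis
  then have "cls k (\<phi> j k a) \<in> genideal D (cls k ` \<phi> i k ` X)"
    by (rule hom_Idl[OF ring[OF k(1)] direct_limit_cring cls_hom[OF k(1)] phi_image_closed[OF i k(1) le X]])
  then show "b \<in> genideal D (set (take n (map (cls i) ys)))"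
    unfolding cX j(4) using cls_up[OF j(1) k(1,2) j(3)] up[OF k(1) le] by simp
qed

end

section \<open>Limits of Cohen-Macaulay rings are Cohen-Macaulay\<close>

lemma parameter_sequence_monomial_condition:
  assumes "cring R" "parameter_sequence R xs" "xs \<noteq> []" "primeideal p R" "set xs \<subseteq> p"
  shows "monomial_condition R xs p"
proof -
  interpret cring R by fact
  have xs: "set xs \<subseteq> carrier R" using assms(2) by (simp add: parameter_sequence_def)
  interpret cech_top R xs
    by (intro cech_top.intro cech_top_axioms.intro is_cring xs assms(3))
  have "genideal R (set xs) \<subseteq> p" by (rule genideal_minimal[OF primeideal.axioms(1)[OF assms(4)] assms(5)])
  then show ?thesis
    using assms(2,4) by (intro monomial_condition_of_nonzero_localization) (auto simp: parameter_sequence_def Let_def)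
qed

theorem proposition4p2:
  fixes \<Gamma> :: "'i set" and leq :: "'i \<Rightarrow> 'i \<Rightarrow> bool"
    and A :: "'i \<Rightarrow> 'a ring" and \<phi> :: "'i \<Rightarrow> 'i \<Rightarrow> 'a \<Rightarrow> 'a"
  assumes "direct_system \<Gamma> leq A \<phi>"
    and "\<And>\<gamma>. \<gamma> \<in> \<Gamma> \<Longrightarrow> noetherian_cohen_macaulay (A \<gamma>)"
    and "\<And>\<gamma> \<delta>. \<lbrakk>\<gamma> \<in> \<Gamma>; \<delta> \<in> \<Gamma>; leq \<gamma> \<delta>\<rbrakk> \<Longrightarrow> lying_over (A \<gamma>) (A \<delta>) (\<phi> \<gamma> \<delta>)"
  shows "hamilton_marley_cohen_macaulay (direct_limit \<Gamma> leq A \<phi>)"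
proof -
  interpret direct_system \<Gamma> leq A \<phi> by (rule assms(1))
  interpret D: cring D by (rule direct_limit_cring)
  have "regular_sequence D xs" if strong: "strong_parameter_sequence D xs" for xs
  proof -
    have par: "parameter_sequence D (take (Suc i) xs)" if "i < length xs" for i
      using strong that by (simp add: strong_parameter_sequence_def)
    have ne: "xs \<noteq> []" using strong by (simp add: strong_parameter_sequence_def)
    then have "parameter_sequence D xs" using par[of "length xs - 1"] by simp
    then have xs: "set xs \<subseteq> carrier D" "genideal D (set xs) \<noteq> carrier D"
      by (simp_all add: parameter_sequence_def)
    obtain \<gamma> ys where \<gamma>: "\<gamma> \<in> \<Gamma>" and ys: "set ys \<subseteq> carrier (A \<gamma>)" "xs = map (cls \<gamma>) ys"
      using lift_list[OF xs(1)] by blast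
    have "weakly_regular (A \<delta>) (map (\<phi> \<gamma> \<delta>) ys)" if \<delta>: "\<delta> \<in> \<Gamma>" "leq \<gamma> \<delta>" for \<delta>
    proof (rule noetherian_cohen_macaulay_weakly_regular[OF assms(2)[OF \<delta>(1)]])
      define zs where "zs = map (\<phi> \<gamma> \<delta>) ys"
      show zs: "set (map (\<phi> \<gamma> \<delta>) ys) \<subseteq> carrier (A \<delta>)"
        using phi_closed[OF \<gamma> \<delta>] ys(1) by auto
      have xz: "xs = map (cls \<delta>) zs" using ys cls_up[OF \<gamma> \<delta>] by (auto simp: zs_def)
      fix i p assume i: "i < length (map (\<phi> \<gamma> \<delta>) ys)" and p: "primeideal p (A \<delta>)"
        and sub: "set (take (Suc i) (map (\<phi> \<gamma> \<delta>) ys)) \<subseteq> p"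
      obtain q where q: "primeideal q D" "p = {r \<in> carrier (A \<delta>). cls \<delta> r \<in> q}"
        using lying_over_limit[OF assms(3) \<delta>(1)] p unfolding lying_over_def by blast
      have il: "i < length xs" using i by (simp add: ys(2))
      have tx: "take (Suc i) xs = map (cls \<delta>) (take (Suc i) zs)" by (simp add: xz take_map)
      have nonempty_prefix: "take (Suc i) xs \<noteq> []" using ne by simp
      have "set (take (Suc i) xs) \<subseteq> q" unfolding tx using sub q(2) by (auto simp: zs_def)
      then have "monomial_condition D (map (cls \<delta>) (take (Suc i) zs)) q"
        using parameter_sequence_monomial_condition[OF D.is_cring par[OF il] nonempty_prefix q(1)]
        unfolding tx by simp
      then show "monomial_condition (A \<delta>) (take (Suc i) (map (\<phi> \<gamma> \<delta>) ys)) p"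
        unfolding q(2) zs_def[symmetric]
        using zs set_take_subset[of "Suc i" zs]
        by (intro monomial_condition_contraction[OF ring[OF \<delta>(1)] D.is_cring cls_hom[OF \<delta>(1)]])
           (auto simp: zs_def)
    qed
    then have "weakly_regular D xs" unfolding ys(2) by (rule weakly_regular_limit[OF \<gamma> ys(1)])
    then show ?thesis using D.regular_sequence_iff[OF xs(1)] xs(2) by simp
  qed
  then show ?thesis using D.is_cring by (simp add: hamilton_marley_cohen_macaulay_def)
qed

end
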